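(* For every $\beta>-2$, as $n\to\infty$, $$\mathsf E D_n\sim\frac{\log n}{\mu_\beta},\qquad\text{and}\qquad \frac{D_n-\mu_\beta^{-1}\log n}{\sqrt{\tau_\beta^2\mu_\beta^{-3}\log n}}\xrightarrow{d}\mathcal N(0,1).$$
   Context: For $\beta>-2$ put $\phi_\beta(z)=\int_0^1(1-s^z)s^{\beta+1}(1-s)^\beta\,ds$, and $$\mu_\beta=\phi_\beta'(0)=-\int_0^1\log(s)\,s^{\beta+1}(1-s)^\beta\,ds,\qquad \tau_\beta^2=-\phi_\beta''(0)=\int_0^1(\log s)^2s^{\beta+1}(1-s)^\beta\,ds.$$ $B(a,b)=\Gamma(a)\Gamma(b)/\Gamma(a+b)$ is the beta function. Continuous-time beta-splitting tree on $n$ leaves: a continuous-time Markov chain $\Pi_n$ on partitions of $[n]=\{1,\dots,n\}$ started from the one-block partition, in which different blocks evolve independently, singletons are absorbing, and a block containing $m\ge2$ labels waits an exponential time of rate $\phi_\beta(m-1)$ and then splits into an ordered pair of nonempty blocks; the first has size $i$, $1\le i\le m-1$, with probability $q_\beta(m,i)=\frac{1}{2\phi_\beta(m-1)}\binom mi B(i+\beta+1,m-i+\beta+1)$, and, given $i$, the set of labels of the first block is uniform among subsets of size $i$. $D_n$ is the continuous height of a uniformly chosen leaf, i.e. the first time at which a uniformly chosen label of $[n]$ is a singleton block. *)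

theory Defs
  imports "HOL-Probability.Probability" "HOL-Library.Disjoint_Sets" "HOL-Library.Landau_Symbols"
begin

definition phi :: "real \<Rightarrow> real \<Rightarrow> real" where
  "phi \<beta> z = (LINT s:{0<..<1}|lborel. (1 - s powr z) * s powr (\<beta> + 1) * (1 - s) powr \<beta>)"

definition mu :: "real \<Rightarrow> real" where
  "mu \<beta> = deriv (phi \<beta>) 0"

definition tau2 :: "real \<Rightarrow> real" where
  "tau2 \<beta> = - deriv (deriv (phi \<beta>)) 0"

definition q :: "real \<Rightarrow> nat \<Rightarrow> nat \<Rightarrow> real" where
  "q \<beta> m i = 1 / (2 * phi \<beta> (real m - 1)) * real (m choose i)
               * Beta (real i + \<beta> + 1) (real m - real i + \<beta> + 1)"

text \<open>Continuous-time Markov chains on a finite state space \<open>S\<close> with off-diagonal jump rates \<open>r\<close>: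
  the generator matrix \<open>Q\<close>, its powers, and the transition function \<open>exp (t Q)\<close>. A chain
  has right-continuous paths (for the discrete topology on \<open>S\<close>) and the finite-dimensional
  distributions determined by the initial state and the transition function.\<close>

definition generator :: "'s set \<Rightarrow> ('s \<Rightarrow> 's \<Rightarrow> real) \<Rightarrow> 's \<Rightarrow> 's \<Rightarrow> real" where
  "generator S r x y = (if x = y then - (\<Sum>z\<in>S - {x}. r x z) else r x y)"

primrec generator_power :: "'s set \<Rightarrow> ('s \<Rightarrow> 's \<Rightarrow> real) \<Rightarrow> nat \<Rightarrow> 's \<Rightarrow> 's \<Rightarrow> real" where
  "generator_power S r 0 x y = (if x = y then 1 else 0)"
| "generator_power S r (Suc k) x y = (\<Sum>z\<in>S. generator S r x z * generator_power S r k z y)"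

definition transition :: "'s set \<Rightarrow> ('s \<Rightarrow> 's \<Rightarrow> real) \<Rightarrow> real \<Rightarrow> 's \<Rightarrow> 's \<Rightarrow> real" where
  "transition S r t x y = (\<Sum>k. t ^ k / fact k * generator_power S r k x y)"

definition ctmc ::
  "'w measure \<Rightarrow> 's set \<Rightarrow> ('s \<Rightarrow> 's \<Rightarrow> real) \<Rightarrow> 's \<Rightarrow> (real \<Rightarrow> 'w \<Rightarrow> 's) \<Rightarrow> bool" where
  "ctmc M S r x0 X \<longleftrightarrow>
     prob_space M \<and> finite S \<and> x0 \<in> S \<and>
     (\<forall>t\<ge>0. X t \<in> measurable M (count_space S)) \<and>
     (\<forall>\<omega>\<in>space M. \<forall>t\<ge>0. \<forall>\<^sub>F s in at_right t. X s \<omega> = X t \<omega>) \<and>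
     (\<forall>k (t :: nat \<Rightarrow> real) x.
        t 0 = 0 \<and> (\<forall>i<k. t i \<le> t (Suc i)) \<and> x 0 = x0 \<and> (\<forall>i\<le>k. x i \<in> S) \<longrightarrow>
        measure M {\<omega> \<in> space M. \<forall>i\<le>k. X (t i) \<omega> = x i}
          = (\<Prod>i<k. transition S r (t (Suc i) - t i) (x i) (x (Suc i))))"

definition partitions :: "nat \<Rightarrow> nat set set set" where
  "partitions n = {P. partition_on {1..n} P}"

text \<open>The rate of going from \<open>P\<close> to \<open>P'\<close>: every block \<open>b\<close> of \<open>P\<close> with \<open>m \<ge> 2\<close> elements splits
  independently at rate \<open>phi \<beta> (m - 1)\<close> into an ordered pair \<open>(c, b - c)\<close>, each ordered pair having
  probability \<open>q \<beta> m (card c) / (m choose card c)\<close>. Both orders of the pair lead to the same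
  unordered partition, so both terms contribute to the rate.\<close>

definition split_rate :: "real \<Rightarrow> nat set set \<Rightarrow> nat set set \<Rightarrow> real" where
  "split_rate \<beta> P P' =
     (\<Sum>b\<in>{b \<in> P. card b \<ge> 2}. \<Sum>c\<in>{c. c \<noteq> {} \<and> c \<subset> b}.
        if P' = (P - {b}) \<union> {c, b - c}
        then phi \<beta> (real (card b) - 1) * (q \<beta> (card b) (card c) / real (card b choose card c))
        else 0)"

definition beta_splitting_chain ::
  "real \<Rightarrow> nat \<Rightarrow> 'w measure \<Rightarrow> (real \<Rightarrow> 'w \<Rightarrow> nat set set) \<Rightarrow> bool" where
  "beta_splitting_chain \<beta> n M X \<longleftrightarrow> ctmc M (partitions n) (split_rate \<beta>) {{1..n}} X"

text \<open>\<open>U\<close> is a uniform label, independent of the whole process \<open>(X t)\<close>, \<open>t \<ge> 0\<close>.\<close>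

definition uniform_label ::
  "nat \<Rightarrow> 'w measure \<Rightarrow> (real \<Rightarrow> 'w \<Rightarrow> nat set set) \<Rightarrow> ('w \<Rightarrow> nat) \<Rightarrow> bool" where
  "uniform_label n M X U \<longleftrightarrow>
     U \<in> measurable M (count_space {1..n}) \<and>
     distr M (count_space {1..n}) U = uniform_count_measure {1..n} \<and>
     prob_space.indep_set M
       (sets (vimage_algebra (space M) U (count_space {1..n})))
       (sets (vimage_algebra (space M) (\<lambda>\<omega>. \<lambda>t\<in>{0..}. X t \<omega>)
          (PiM {0..} (\<lambda>_. count_space (partitions n)))))"

text \<open>The infimum is over a nonempty set almost surely, since the chain is
  absorbed in the partition into singletons.\<close>

definition leaf_height :: "(real \<Rightarrow> 'w \<Rightarrow> nat set set) \<Rightarrow> ('w \<Rightarrow> nat) \<Rightarrow> 'w \<Rightarrow> real" where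
  "leaf_height X U \<omega> = Inf {t. 0 \<le> t \<and> {U \<omega>} \<in> X t \<omega>}"

end

theory Submission
  imports Defs "HOL-Real_Asymp.Real_Asymp"
begin

text \<open>Follow the block that contains a fixed label \<open>u\<close>. A split of a block can be described as follows:
  a number \<open>s\<close> is chosen with the (possibly infinite) intensity \<open>s powr (\<beta> + 1) * (1 - s) powr \<beta>\<close>,
  and every other label of the block of \<open>u\<close> stays with \<open>u\<close> with probability \<open>s\<close>, independently.
  So the first of \<open>k\<close> given companions of \<open>u\<close> is lost at the rate
  \<open>\<integral> 1 - s powr k = phi \<beta> k\<close>, however large the block is: the indicator that a set \<open>W\<close> of labels lies
  in one block is an eigenfunction of the generator, with eigenvalue \<open>- phi \<beta> (card W - 1)\<close>
  (\<open>generator_together\<close>). Its expectation at time \<open>t\<close> is therefore \<open>exp (- phi \<beta> (card W - 1) * t)\<close>,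
  and inclusion-exclusion over the possible companions gives the distribution function of the height
  of a leaf in closed form (\<open>prob_D_le\<close>):
  \<open>P (D\<^sub>n \<le> t) = cover_prob \<beta> (n - 1) t = (\<Sum>k\<le>n - 1. (- 1) ^ k * (n - 1 choose k) * exp (- phi \<beta> k * t))\<close>.

  Since \<open>exp (- phi \<beta> k * t)\<close> is the Laplace transform of a subordinator \<open>\<xi>\<close> with Laplace exponent
  \<open>phi \<beta>\<close>, the alternating sum is the expectation of \<open>(1 - exp (- \<xi>\<^sub>t)) ^ (n - 1)\<close>, that is, the
  probability that \<open>\<xi>\<^sub>t\<close> exceeds the maximum of \<open>n - 1\<close> independent standard exponential variables. This
  maximum is \<open>ln n\<close> up to an error bounded in probability, and \<open>\<xi>\<^sub>t\<close> is asymptotically normal with mean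
  \<open>mu \<beta> * t\<close> and variance \<open>tau2 \<beta> * t\<close>; solving \<open>\<xi>\<^sub>t = ln n\<close> for \<open>t\<close> yields the normal limit
  (\<open>cover_prob_tendsto_normal\<close>).

  In place of the subordinator at time \<open>t\<close>, the proof uses a random walk of \<open>K\<close> steps. One step is
  \<open>- ln s\<close>, where \<open>s\<close> has the intensity above multiplied by \<open>t / K\<close> and cut off near \<open>s = 1\<close> so that
  its mass is at most one; the remaining mass makes no move. For fixed \<open>t\<close> and \<open>n\<close> and \<open>K \<rightarrow> \<infinity>\<close> the
  expectation of \<open>(1 - exp (- Y)) ^ (n - 1)\<close> for the endpoint \<open>Y\<close> tends to \<open>cover_prob \<beta> (n - 1) t\<close>
  (\<open>walk_cover_prob_tendsto\<close>), so \<open>K\<close> may be taken so large, in terms of \<open>t\<close> and \<open>n\<close>, that all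
  differences are negligible. The characteristic function of the walk is a \<open>K\<close>-th power, and a second
  order expansion with explicit error (\<open>char_walk_normalized_error\<close>) together with the continuity
  theorem gives the normal limit.

  For the mean, the union bound \<open>P (D\<^sub>n > t) \<le> (n - 1) * exp (- phi \<beta> 1 * t)\<close> (\<open>cover_prob_tail\<close>)
  shows that the part of \<open>D\<^sub>n\<close> above a multiple of \<open>ln n\<close> has bounded expectation, while the normal limit
  shows that \<open>D\<^sub>n / ln n\<close> tends to \<open>1 / mu \<beta>\<close> in probability; \<open>expectation_D_bounds\<close> combines
  the two.\<close>

section \<open>The splitting measure and the Laplace exponent\<close>

definition dislocation :: "real \<Rightarrow> real measure" where
  "dislocation \<beta> =
     density lborel (\<lambda>s. ennreal (indicator {0<..<1} s * (s powr (\<beta> + 1) * (1 - s) powr \<beta>)))"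

lemma sets_dislocation [simp, measurable_cong]: "sets (dislocation \<beta>) = sets borel"
  and space_dislocation [simp]: "space (dislocation \<beta>) = UNIV"
  by (simp_all add: dislocation_def)

lemma AE_dislocation: "AE s in dislocation \<beta>. 0 < s \<and> s < 1"
  unfolding dislocation_def by (subst AE_density) (auto simp: indicator_def)

lemma
  fixes f :: "real \<Rightarrow> real"
  assumes [measurable]: "f \<in> borel_measurable borel"
  shows integral_dislocation: "(\<integral>s. f s \<partial>dislocation \<beta>) =
           (LINT s:{0<..<1}|lborel. f s * (s powr (\<beta> + 1) * (1 - s) powr \<beta>))"
    and integrable_dislocation_iff: "integrable (dislocation \<beta>) f \<longleftrightarrow>
           set_integrable lborel {0<..<1} (\<lambda>s. f s * (s powr (\<beta> + 1) * (1 - s) powr \<beta>))"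
proof -
  show "(\<integral>s. f s \<partial>dislocation \<beta>) =
      (LINT s:{0<..<1}|lborel. f s * (s powr (\<beta> + 1) * (1 - s) powr \<beta>))"
    unfolding dislocation_def set_lebesgue_integral_def
    by (subst integral_density) (auto intro!: Bochner_Integration.integral_cong)
  show "integrable (dislocation \<beta>) f \<longleftrightarrow>
           set_integrable lborel {0<..<1} (\<lambda>s. f s * (s powr (\<beta> + 1) * (1 - s) powr \<beta>))"
    unfolding dislocation_def set_integrable_def
    by (subst integrable_density)
      (auto intro!: arg_cong[where f="integrable lborel"] simp: algebra_simps)
qed

lemma phi_eq_dislocation: "phi \<beta> z = (\<integral>s. 1 - s powr z \<partial>dislocation \<beta>)"
  unfolding phi_def by (subst integral_dislocation) (auto simp: algebra_simps)

lemma
  assumes "a + \<beta> + 2 > 0" "b + \<beta> + 1 > 0"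
  shows integrable_dislocation_powr:
      "integrable (dislocation \<beta>) (\<lambda>s. s powr a * (1 - s) powr b)"
    and integral_dislocation_powr:
      "(\<integral>s. s powr a * (1 - s) powr b \<partial>dislocation \<beta>) = Beta (a + \<beta> + 2) (b + \<beta> + 1)"
proof -
  let ?g = "\<lambda>s::real. s powr ((a + \<beta> + 2) - 1) * (1 - s) powr ((b + \<beta> + 1) - 1)"
  have eq: "s powr a * (1 - s) powr b * (s powr (\<beta> + 1) * (1 - s) powr \<beta>) = ?g s"
    if "s \<in> {0<..<1}" for s
  proof -
    have "?g s = s powr (a + (\<beta> + 1)) * (1 - s) powr (b + \<beta>)"
      by (simp add: algebra_simps)
    also have "\<dots> = (s powr a * s powr (\<beta> + 1)) * ((1 - s) powr b * (1 - s) powr \<beta>)"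
      using that by (simp only: powr_add)
    finally show ?thesis by (simp only: mult_ac)
  qed
  have int: "set_integrable lborel {0<..<1} ?g"
    by (rule set_integrable_subset[OF integrable_Beta]) (use assms in auto)
  have "set_integrable lborel {0<..<1} ?g \<longleftrightarrow> set_integrable lborel {0<..<1}
      (\<lambda>s. s powr a * (1 - s) powr b * (s powr (\<beta> + 1) * (1 - s) powr \<beta>))"
    by (rule set_integrable_cong) (use eq in auto)
  with int show "integrable (dislocation \<beta>) (\<lambda>s. s powr a * (1 - s) powr b)"
    by (subst integrable_dislocation_iff) auto
  have "(\<integral>s. s powr a * (1 - s) powr b \<partial>dislocation \<beta>) = (LINT s:{0<..<1}|lborel. ?g s)"
    by (subst integral_dislocation, measurable, rule set_lebesgue_integral_cong) (use eq in auto)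
  also have "\<dots> = integral {0<..<1} ?g"
    by (rule set_borel_integral_eq_integral(2)[OF int])
  also have "\<dots> = Beta (a + \<beta> + 2) (b + \<beta> + 1)"
    using has_integral_Beta_real[of "a + \<beta> + 2" "b + \<beta> + 1"] assms
    by (simp add: has_integral_Icc_iff_Ioo integral_unique)
  finally show "(\<integral>s. s powr a * (1 - s) powr b \<partial>dislocation \<beta>) = Beta (a + \<beta> + 2) (b + \<beta> + 1)" .
qed

lemma integrable_dislocationI:
  fixes f :: "real \<Rightarrow> real"
  assumes "\<beta> > -2" and [measurable]: "f \<in> borel_measurable borel"
    and c: "c + \<beta> + 2 > 0"
    and le: "\<And>s. 0 < s \<Longrightarrow> s < 1 \<Longrightarrow> \<bar>f s\<bar> \<le> C * ((1 - s) * s powr c)"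
  shows "integrable (dislocation \<beta>) f"
proof (rule Bochner_Integration.integrable_bound)
  show "integrable (dislocation \<beta>) (\<lambda>s. C * (s powr c * (1 - s) powr 1))"
    using assms by (intro integrable_mult_right integrable_dislocation_powr) auto
  show "AE s in dislocation \<beta>. norm (f s) \<le> norm (C * (s powr c * (1 - s) powr 1))"
    using AE_dislocation
  proof eventually_elim
    fix s :: real assume "0 < s \<and> s < 1"
    with le[of s] show "norm (f s) \<le> norm (C * (s powr c * (1 - s) powr 1))"
      by (simp add: mult_ac)
  qed
qed simp

text \<open>Both endpoints at once: near \<open>1\<close> the logarithm vanishes to first order, which pays for the
  singularity \<open>(1 - s) powr \<beta>\<close> with \<open>\<beta> > -2\<close>, and near \<open>0\<close> it costs only an arbitrarily small power
  of \<open>s\<close>. The inequality is \<open>ln x \<le> x - 1\<close> at \<open>x = s powr (- d)\<close>.\<close>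
lemma abs_ln_le_powr:
  fixes s d :: real
  assumes "0 < s" "s < 1" "0 < d" "d \<le> 1"
  shows "\<bar>ln s\<bar> \<le> (1 - s) * s powr (-d) / d"
proof -
  have "- (d * ln s) = ln (s powr (-d))" using assms by (simp add: ln_powr)
  also have "\<dots> \<le> s powr (-d) - 1" using assms by (intro ln_le_minus_one) auto
  also have "\<dots> = s powr (-d) * (1 - s powr d)"
    using assms by (simp add: powr_minus field_simps)
  also have "\<dots> \<le> s powr (-d) * (1 - s)"
    using assms powr_mono'[of d 1 s] by (intro mult_left_mono) auto
  finally show ?thesis using assms by (simp add: field_simps)
qed

lemma integrable_dislocation_ln_powr:
  assumes "\<beta> > -2" "j \<ge> 1" "z > - (\<beta> + 2) / 2"
  shows "integrable (dislocation \<beta>) (\<lambda>s. ln s ^ j * s powr z)"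
proof -
  \<comment> \<open>Chosen so that \<open>j\<close> factors \<open>s powr (- d)\<close> use up at most half of the available exponent \<open>\<beta> + 2\<close>.\<close>
  define d where "d = min 1 ((\<beta> + 2) / (2 * real j))"
  have d: "0 < d" "d \<le> 1" using assms by (auto simp: d_def)
  have "real j * d \<le> real j * ((\<beta> + 2) / (2 * real j))"
    unfolding d_def by (intro mult_left_mono) auto
  then have jd: "real j * d \<le> (\<beta> + 2) / 2" using assms by simp
  show ?thesis
  proof (rule integrable_dislocationI[where c = "z - real j * d" and C = "1 / d ^ j"])
    show "z - real j * d + \<beta> + 2 > 0" using jd assms by (simp add: field_simps)
    fix s :: real assume s: "0 < s" "s < 1"
    have "\<bar>ln s\<bar> ^ j \<le> ((1 - s) * s powr (-d) / d) ^ j"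
      using abs_ln_le_powr[OF s d] by (intro power_mono) auto
    also have "\<dots> = (1 - s) ^ j * s powr (- real j * d) / d ^ j"
      using s by (simp add: power_mult_distrib power_divide powr_realpow[symmetric] powr_powr mult_ac)
    also have "\<dots> \<le> (1 - s) * s powr (- real j * d) / d ^ j"
      using s d assms power_decreasing[of 1 j "1 - s"]
      by (intro divide_right_mono mult_right_mono) auto
    finally have "\<bar>ln s\<bar> ^ j * s powr z \<le> (1 - s) * s powr (- real j * d) / d ^ j * s powr z"
      by (intro mult_right_mono) auto
    also have "\<dots> = 1 / d ^ j * ((1 - s) * s powr (z - real j * d))"
      using s by (simp add: powr_diff powr_minus field_simps)
    finally show "\<bar>ln s ^ j * s powr z\<bar> \<le> 1 / d ^ j * ((1 - s) * s powr (z - real j * d))"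
      by (simp add: abs_mult power_abs)
  qed (use assms in auto)
qed

text \<open>The mean value form of \<open>exp (z * ln s)\<close>; for negative \<open>z\<close> the factor \<open>s powr (- \<bar>z\<bar>)\<close> is what makes
  \<open>phi \<beta>\<close> finite on both sides of \<open>0\<close>, so that its derivatives at \<open>0\<close> are two-sided.\<close>
lemma one_minus_powr_bound:
  fixes s z :: real
  assumes "0 < s" "s < 1"
  shows "\<bar>1 - s powr z\<bar> \<le> \<bar>z\<bar> * \<bar>ln s\<bar> * s powr (- \<bar>z\<bar>)"
proof -
  obtain t where t: "\<bar>t\<bar> \<le> \<bar>z * ln s\<bar>" "exp (z * ln s) = 1 + exp t * (z * ln s)"
    using Maclaurin_exp_le[of "z * ln s" 1] by auto
  have "exp t \<le> exp (\<bar>z\<bar> * - ln s)"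
    using t(1) assms by (auto simp: abs_mult)
  then have "\<bar>exp t * (z * ln s)\<bar> \<le> exp (\<bar>z\<bar> * - ln s) * \<bar>z * ln s\<bar>"
    unfolding abs_mult by (intro mult_right_mono) auto
  then show ?thesis using t(2) assms by (simp add: powr_def abs_mult mult_ac)
qed

lemma integrable_one_minus_powr_near_0:
  assumes "\<beta> > -2" "\<bar>z\<bar> < (\<beta> + 2) / 2"
  shows "integrable (dislocation \<beta>) (\<lambda>s. 1 - s powr z)"
proof (rule Bochner_Integration.integrable_bound)
  show "integrable (dislocation \<beta>) (\<lambda>s. \<bar>z\<bar> * \<bar>ln s ^ 1 * s powr (- \<bar>z\<bar>)\<bar>)"
    using assms by (intro integrable_mult_right integrable_abs integrable_dislocation_ln_powr) auto
  show "AE s in dislocation \<beta>. norm (1 - s powr z) \<le> norm (\<bar>z\<bar> * \<bar>ln s ^ 1 * s powr (- \<bar>z\<bar>)\<bar>)"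
    using AE_dislocation
    by eventually_elim (use one_minus_powr_bound in \<open>auto simp: abs_mult mult_ac\<close>)
qed simp

lemma integrable_one_minus_powr:
  assumes "\<beta> > -2" "z \<ge> 0"
  shows "integrable (dislocation \<beta>) (\<lambda>s. 1 - s powr z)"
proof (rule Bochner_Integration.integrable_bound)
  show "integrable (dislocation \<beta>) (\<lambda>s. z * \<bar>ln s ^ 1 * s powr 0\<bar>)"
    using assms by (intro integrable_mult_right integrable_abs integrable_dislocation_ln_powr) auto
  show "AE s in dislocation \<beta>. norm (1 - s powr z) \<le> norm (z * \<bar>ln s ^ 1 * s powr 0\<bar>)"
    using AE_dislocation
  proof eventually_elim
    fix s :: real assume s: "0 < s \<and> s < 1"
    have "1 - exp (z * ln s) \<le> - (z * ln s)" using exp_ge_add_one_self[of "z * ln s"] by linarith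
    moreover have "s powr z \<le> 1" using s assms by (intro powr_le1) auto
    ultimately show "norm (1 - s powr z) \<le> norm (z * \<bar>ln s ^ 1 * s powr 0\<bar>)"
      using s assms by (simp add: powr_def abs_mult)
  qed
qed simp

text \<open>Differentiation under the integral sign for \<open>z \<mapsto> ln s ^ j * s powr z\<close>: the remainder of the first
  order Taylor expansion at \<open>w\<close> is at most \<open>h\<^sup>2\<close> times a fixed integrable function. The correction
  \<open>c s\<close> allows \<open>j = 0\<close>, where only \<open>s powr z - 1\<close> is integrable.\<close>
lemma has_derivative_dislocation_ln_powr:
  fixes c :: "real \<Rightarrow> real"
  assumes "\<beta> > -2" "\<bar>w\<bar> < (\<beta> + 2) / 4"
    and int: "\<And>z. \<bar>z\<bar> < (\<beta> + 2) / 2 \<Longrightarrow>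
               integrable (dislocation \<beta>) (\<lambda>s. ln s ^ j * s powr z - c s)"
  shows "((\<lambda>z. \<integral>s. ln s ^ j * s powr z - c s \<partial>dislocation \<beta>) has_real_derivative
           (\<integral>s. ln s ^ Suc j * s powr w \<partial>dislocation \<beta>)) (at w)"
proof -
  let ?\<nu> = "dislocation \<beta>"
  define r where "r = (\<beta> + 2) / 4"
  have r: "r > 0" "\<bar>w\<bar> < r" using assms by (auto simp: r_def)
  define F where "F z = (\<integral>s. ln s ^ j * s powr z - c s \<partial>?\<nu>)" for z
  define G where "G = (\<integral>s. ln s ^ Suc j * s powr w \<partial>?\<nu>)"
  define B where "B = (\<integral>s. \<bar>ln s ^ (j + 2) * s powr (w - (r - \<bar>w\<bar>))\<bar> \<partial>?\<nu>)"
  have intB: "integrable ?\<nu> (\<lambda>s. \<bar>ln s ^ (j + 2) * s powr (w - (r - \<bar>w\<bar>))\<bar>)"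
    using assms r by (intro integrable_abs integrable_dislocation_ln_powr) (auto simp: r_def field_simps)
  have intG: "integrable ?\<nu> (\<lambda>s. ln s ^ Suc j * s powr w)"
    using assms r by (intro integrable_dislocation_ln_powr) (auto simp: r_def field_simps)
  have bound: "\<bar>(F (w + h) - F w) / h - G\<bar> \<le> \<bar>h\<bar> * B" if h: "h \<noteq> 0" "\<bar>h\<bar> < r - \<bar>w\<bar>" for h
  proof -
    let ?e = "\<lambda>s. ln s ^ j * s powr (w + h) - ln s ^ j * s powr w - h * (ln s ^ Suc j * s powr w)"
    have i1: "integrable ?\<nu> (\<lambda>s. ln s ^ j * s powr (w + h) - c s)"
      "integrable ?\<nu> (\<lambda>s. ln s ^ j * s powr w - c s)"
    proof -
      have "\<bar>w + h\<bar> < r" "\<bar>w\<bar> < r" using h r by linarith+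
      then have "\<bar>w + h\<bar> < (\<beta> + 2) / 2" "\<bar>w\<bar> < (\<beta> + 2) / 2" using assms(1) by (auto simp: r_def)
      from this[THEN int] show "integrable ?\<nu> (\<lambda>s. ln s ^ j * s powr (w + h) - c s)"
        "integrable ?\<nu> (\<lambda>s. ln s ^ j * s powr w - c s)" .
    qed
    have "F (w + h) - F w - h * G = (\<integral>s. (ln s ^ j * s powr (w + h) - c s)
        - (ln s ^ j * s powr w - c s) - h * (ln s ^ Suc j * s powr w) \<partial>?\<nu>)"
      unfolding F_def G_def
      using Bochner_Integration.integral_diff[OF Bochner_Integration.integrable_diff[OF i1]
          integrable_mult_right[OF intG, of h]] Bochner_Integration.integral_diff[OF i1]
      by simp
    also have "\<dots> = (\<integral>s. ?e s \<partial>?\<nu>)" by (simp add: algebra_simps)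
    finally have "\<bar>F (w + h) - F w - h * G\<bar> = \<bar>\<integral>s. ?e s \<partial>?\<nu>\<bar>" by simp
    also have "\<dots> \<le> (\<integral>s. h\<^sup>2 * \<bar>ln s ^ (j + 2) * s powr (w - (r - \<bar>w\<bar>))\<bar> \<partial>?\<nu>)"
    proof (rule order.trans[OF integral_abs_bound integral_mono_AE'])
      show "integrable ?\<nu> (\<lambda>s. h\<^sup>2 * \<bar>ln s ^ (j + 2) * s powr (w - (r - \<bar>w\<bar>))\<bar>)"
        using intB by (intro integrable_mult_right)
      show "AE s in ?\<nu>. \<bar>?e s\<bar> \<le> h\<^sup>2 * \<bar>ln s ^ (j + 2) * s powr (w - (r - \<bar>w\<bar>))\<bar>"
        using AE_dislocation
      proof eventually_elim
        fix s :: real assume s: "0 < s \<and> s < 1"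
        let ?x = "h * ln s"
        obtain t where t: "\<bar>t\<bar> \<le> \<bar>?x\<bar>" "exp ?x = (\<Sum>m<2. ?x ^ m / fact m) + exp t / fact 2 * ?x ^ 2"
          using Maclaurin_exp_le[of ?x 2] by blast
        then have ex: "exp ?x - 1 - ?x = exp t / 2 * ?x ^ 2" by (simp add: eval_nat_numeral)
        have et: "exp t / 2 \<le> exp (- (r - \<bar>w\<bar>) * ln s)"
        proof -
          have "t \<le> \<bar>h\<bar> * - ln s" using t(1) s by (auto simp: abs_mult)
          also have "\<dots> \<le> (r - \<bar>w\<bar>) * - ln s" using h s by (intro mult_right_mono) auto
          also have "\<dots> = - (r - \<bar>w\<bar>) * ln s" by (simp add: algebra_simps)
          finally have "exp t \<le> exp (- (r - \<bar>w\<bar>) * ln s)" by (simp only: exp_le_cancel_iff)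
          then show ?thesis using exp_gt_zero[of t] by linarith
        qed
        have "?e s = ln s ^ j * s powr w * (exp ?x - 1 - ?x)"
          using s by (simp add: powr_def distrib_right exp_add algebra_simps)
        also have "\<dots> = ln s ^ j * s powr w * (exp t / 2 * ?x ^ 2)" by (simp only: ex)
        finally have e: "?e s = ln s ^ j * s powr w * (exp t / 2 * ?x ^ 2)" .
        have "\<bar>?e s\<bar> = \<bar>ln s\<bar> ^ j * s powr w * (exp t / 2) * ?x ^ 2"
          unfolding e by (simp add: abs_mult power_abs power_mult_distrib)
        also have "\<dots> \<le> \<bar>ln s\<bar> ^ j * s powr w * exp (- (r - \<bar>w\<bar>) * ln s) * ?x ^ 2"
          using et by (intro mult_right_mono mult_left_mono) auto
        also have "\<dots> = h\<^sup>2 * \<bar>ln s ^ (j + 2) * s powr (w - (r - \<bar>w\<bar>))\<bar>"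
        proof -
          have "s powr w * exp (- (r - \<bar>w\<bar>) * ln s) = s powr (w - (r - \<bar>w\<bar>))"
            using s by (simp add: powr_def exp_add[symmetric] algebra_simps)
          then show ?thesis
            by (simp add: abs_mult power_abs power_add power_mult_distrib power2_eq_square mult_ac)
        qed
        finally show "\<bar>?e s\<bar> \<le> h\<^sup>2 * \<bar>ln s ^ (j + 2) * s powr (w - (r - \<bar>w\<bar>))\<bar>" .
      qed
      show "AE s in ?\<nu>. 0 \<le> h\<^sup>2 * \<bar>ln s ^ (j + 2) * s powr (w - (r - \<bar>w\<bar>))\<bar>" by simp
    qed
    also have "\<dots> = h\<^sup>2 * B" unfolding B_def by simp
    finally have "\<bar>F (w + h) - F w - h * G\<bar> / \<bar>h\<bar> \<le> h\<^sup>2 * B / \<bar>h\<bar>"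
      by (intro divide_right_mono) auto
    moreover have "\<bar>(F (w + h) - F w) / h - G\<bar> = \<bar>F (w + h) - F w - h * G\<bar> / \<bar>h\<bar>"
      using h by (subst abs_divide[symmetric]) (simp add: field_simps)
    moreover have "h\<^sup>2 * B / \<bar>h\<bar> = \<bar>h\<bar> * B" using h by (simp add: field_simps power2_eq_square)
    ultimately show ?thesis by simp
  qed
  have "((\<lambda>h. (F (w + h) - F w) / h - G) \<longlongrightarrow> 0) (at 0)"
  proof (rule Lim_null_comparison)
    show "\<forall>\<^sub>F h in at 0. norm ((F (w + h) - F w) / h - G) \<le> \<bar>h\<bar> * B"
      using r bound by (auto simp: eventually_at intro!: exI[of _ "r - \<bar>w\<bar>"])
    show "((\<lambda>h. \<bar>h\<bar> * B) \<longlongrightarrow> 0) (at 0)" by (auto intro!: tendsto_eq_intros)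
  qed
  then have "((\<lambda>h. (F (w + h) - F w) / h) \<longlongrightarrow> G) (at 0)" by (rule LIM_zero_cancel)
  then show ?thesis unfolding F_def G_def has_field_derivative_def by (simp add: DERIV_def flip: has_field_derivative_def)
qed

text \<open>A formula on a whole neighbourhood of \<open>0\<close>, because \<open>tau2 \<beta>\<close> is defined through the second derivative.\<close>
lemma phi_has_derivative:
  assumes "\<beta> > -2" "\<bar>w\<bar> < (\<beta> + 2) / 4"
  shows "(phi \<beta> has_real_derivative - (\<integral>s. ln s * s powr w \<partial>dislocation \<beta>)) (at w)"
proof -
  have int: "integrable (dislocation \<beta>) (\<lambda>s. ln s ^ 0 * s powr z - 1)" if "\<bar>z\<bar> < (\<beta> + 2) / 2" for z
    using Bochner_Integration.integrable_minus[OF integrable_one_minus_powr_near_0[OF assms(1) that]] by simp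
  have eq: "phi \<beta> = (\<lambda>z. - (\<integral>s. ln s ^ 0 * s powr z - 1 \<partial>dislocation \<beta>))"
    by (rule ext, subst Bochner_Integration.integral_minus[symmetric]) (simp add: phi_eq_dislocation)
  show ?thesis unfolding eq
    using DERIV_minus[OF has_derivative_dislocation_ln_powr[OF assms(1,2) int]] by simp
qed

lemma mu_eq:
  assumes "\<beta> > -2"
  shows "mu \<beta> = (\<integral>s. - ln s \<partial>dislocation \<beta>)"
proof -
  have "deriv (phi \<beta>) 0 = - (\<integral>s. ln s * s powr 0 \<partial>dislocation \<beta>)"
    using assms by (intro DERIV_imp_deriv phi_has_derivative) auto
  also have "(\<integral>s. ln s * s powr 0 \<partial>dislocation \<beta>) = (\<integral>s. ln s \<partial>dislocation \<beta>)"
    using AE_dislocation[of \<beta>] by (intro integral_cong_AE) (auto elim!: eventually_mono)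
  finally show ?thesis by (simp add: mu_def)
qed

lemma tau2_eq:
  assumes "\<beta> > -2"
  shows "tau2 \<beta> = (\<integral>s. (ln s)\<^sup>2 \<partial>dislocation \<beta>)"
proof -
  have ev: "\<forall>\<^sub>F w in nhds 0. deriv (phi \<beta>) w = - (\<integral>s. ln s ^ 1 * s powr w - 0 \<partial>dislocation \<beta>)"
    unfolding eventually_nhds_metric
    using assms DERIV_imp_deriv[OF phi_has_derivative[OF assms]] by (intro exI[of _ "(\<beta> + 2) / 4"]) auto
  have "((\<lambda>z. \<integral>s. ln s ^ 1 * s powr z - 0 \<partial>dislocation \<beta>) has_real_derivative
           (\<integral>s. ln s ^ Suc 1 * s powr 0 \<partial>dislocation \<beta>)) (at 0)"
    by (rule has_derivative_dislocation_ln_powr)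
       (use assms integrable_dislocation_ln_powr[of \<beta> 1] in auto)
  from DERIV_imp_deriv[OF DERIV_minus[OF this]]
  have "tau2 \<beta> = (\<integral>s. ln s ^ Suc 1 * s powr 0 \<partial>dislocation \<beta>)"
    unfolding tau2_def deriv_cong_ev[OF ev refl] by simp
  also have "\<dots> = (\<integral>s. (ln s)\<^sup>2 \<partial>dislocation \<beta>)"
    using AE_dislocation[of \<beta>]
    by (intro integral_cong_AE) (auto elim!: eventually_mono simp: power2_eq_square)
  finally show ?thesis .
qed

lemma integral_dislocation_pos:
  fixes f :: "real \<Rightarrow> real"
  assumes "integrable (dislocation \<beta>) f" "\<And>s. 0 < s \<Longrightarrow> s < 1 \<Longrightarrow> 0 < f s"
  shows "0 < (\<integral>s. f s \<partial>dislocation \<beta>)"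
proof -
  have nn: "AE s in dislocation \<beta>. 0 \<le> f s"
    using AE_dislocation by eventually_elim (use assms in \<open>auto intro: less_imp_le\<close>)
  have "(\<integral>s. f s \<partial>dislocation \<beta>) \<noteq> 0"
  proof
    assume "(\<integral>s. f s \<partial>dislocation \<beta>) = 0"
    then have "AE s in dislocation \<beta>. f s = 0"
      using integral_nonneg_eq_0_iff_AE[OF assms(1) nn] by simp
    with AE_dislocation have "AE s in dislocation \<beta>. False"
      by eventually_elim (use assms(2) in force)
    then have "AE s in lborel. \<not> (s \<in> {0<..<1::real})"
      unfolding dislocation_def
      by (subst (asm) AE_density) (auto elim!: eventually_mono simp: indicator_def ennreal_mult'' zero_less_mult_iff)
    then have "emeasure lborel {0<..<1::real} = 0"
      by (subst (asm) AE_iff_measurable[where N = "{0<..<1}"]) auto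
    then show False by simp
  qed
  moreover have "0 \<le> (\<integral>s. f s \<partial>dislocation \<beta>)" by (rule integral_nonneg_AE[OF nn])
  ultimately show ?thesis by simp
qed

lemma integrable_dislocation_ln_power:
  assumes "\<beta> > -2" "j \<ge> 1"
  shows "integrable (dislocation \<beta>) (\<lambda>s. ln s ^ j)"
proof -
  have "integrable (dislocation \<beta>) (\<lambda>s. ln s ^ j * s powr 0)"
    by (rule integrable_dislocation_ln_powr) (use assms in auto)
  moreover have "AE s in dislocation \<beta>. ln s ^ j * s powr 0 = ln s ^ j"
    using AE_dislocation by eventually_elim auto
  ultimately show ?thesis by (subst integrable_cong_AE[symmetric]) auto
qed

lemma mu_pos:
  assumes "\<beta> > -2"
  shows "0 < mu \<beta>"
  unfolding mu_eq[OF assms] using integrable_dislocation_ln_power[of \<beta> 1] assms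
  by (intro integral_dislocation_pos) auto

lemma tau2_pos: "\<beta> > -2 \<Longrightarrow> 0 < tau2 \<beta>"
  using integrable_dislocation_ln_power[of \<beta> 2]
  by (subst tau2_eq) (auto intro!: integral_dislocation_pos)

lemma phi_pos: "\<beta> > -2 \<Longrightarrow> z > 0 \<Longrightarrow> 0 < phi \<beta> z"
  using integrable_one_minus_powr[of \<beta> z]
  by (subst phi_eq_dislocation, intro integral_dislocation_pos)
     (use powr_less_mono2[of z _ 1] in auto)

lemma phi_0: "phi \<beta> 0 = 0"
proof -
  have "(\<integral>s. 1 - s powr 0 \<partial>dislocation \<beta>) = (\<integral>s. 0 \<partial>dislocation \<beta>)"
    using AE_dislocation[of \<beta>] by (intro integral_cong_AE) (auto elim!: eventually_mono)
  then show ?thesis by (simp add: phi_eq_dislocation)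
qed

section \<open>Eigenfunctions of the generator\<close>

lemma generator_power_sum_eigen:
  assumes "finite S" and eig: "\<And>x. x \<in> S \<Longrightarrow> (\<Sum>y\<in>S. generator S r x y * f y) = - l * f x"
    and "x \<in> S"
  shows "(\<Sum>y\<in>S. generator_power S r k x y * f y) = (- l) ^ k * f x"
  using assms(3)
proof (induction k arbitrary: x)
  case 0
  then show ?case using assms(1) by (simp add: if_distrib[of "\<lambda>a. a * _"] cong: if_cong)
next
  case (Suc k)
  have "(\<Sum>y\<in>S. generator_power S r (Suc k) x y * f y)
      = (\<Sum>z\<in>S. generator S r x z * (\<Sum>y\<in>S. generator_power S r k z y * f y))"
    by (simp add: sum_distrib_right sum_distrib_left mult.assoc) (rule sum.swap)
  also have "\<dots> = (\<Sum>z\<in>S. generator S r x z * ((- l) ^ k * f z))"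
    using Suc.IH by (intro sum.cong) auto
  also have "\<dots> = (- l) ^ k * (\<Sum>z\<in>S. generator S r x z * f z)"
    by (simp add: sum_distrib_left mult_ac)
  also have "\<dots> = (- l) ^ Suc k * f x" using eig[OF Suc.prems] by simp
  finally show ?case .
qed

lemma generator_power_bound:
  assumes "finite S" "x \<in> S"
  shows "\<bar>generator_power S r k x y\<bar> \<le> (\<Sum>x\<in>S. \<Sum>z\<in>S. \<bar>generator S r x z\<bar>) ^ k"
  using assms(2)
proof (induction k arbitrary: x)
  case (Suc k)
  let ?C = "\<Sum>x\<in>S. \<Sum>z\<in>S. \<bar>generator S r x z\<bar>"
  have C: "0 \<le> ?C" by (intro sum_nonneg) auto
  have "\<bar>generator_power S r (Suc k) x y\<bar> \<le> (\<Sum>z\<in>S. \<bar>generator S r x z\<bar> * \<bar>generator_power S r k z y\<bar>)"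
    by (simp add: abs_mult[symmetric])
  also have "\<dots> \<le> (\<Sum>z\<in>S. \<bar>generator S r x z\<bar> * ?C ^ k)"
    using Suc.IH by (intro sum_mono mult_left_mono) auto
  also have "\<dots> = (\<Sum>z\<in>S. \<bar>generator S r x z\<bar>) * ?C ^ k" by (simp add: sum_distrib_right)
  also have "\<dots> \<le> ?C * ?C ^ k"
    using C Suc.prems assms(1) member_le_sum[of x S "\<lambda>x. \<Sum>z\<in>S. \<bar>generator S r x z\<bar>"]
    by (intro mult_right_mono) (auto intro!: sum_nonneg)
  finally show ?case by simp
qed simp

lemma summable_transition:
  assumes "finite S" "x \<in> S"
  shows "summable (\<lambda>k. t ^ k / fact k * generator_power S r k x y)"
proof (rule summable_comparison_test')
  let ?C = "\<Sum>x\<in>S. \<Sum>z\<in>S. \<bar>generator S r x z\<bar>"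
  show "summable (\<lambda>k. inverse (fact k) * (\<bar>t\<bar> * ?C) ^ k)"
    using summable_exp by blast
  show "norm (t ^ k / fact k * generator_power S r k x y) \<le> inverse (fact k) * (\<bar>t\<bar> * ?C) ^ k"
    if "k \<ge> 0" for k
    using generator_power_bound[OF assms, of r k y]
    by (auto simp: abs_mult power_abs power_mult_distrib divide_inverse mult_ac
             intro!: mult_left_mono)
qed

text \<open>An eigenfunction of the generator is an eigenfunction of every power of it, hence of the exponential
  series. This is how expectations along the chain are computed below.\<close>
lemma transition_sum_eigen:
  assumes "finite S" "\<And>x. x \<in> S \<Longrightarrow> (\<Sum>y\<in>S. generator S r x y * f y) = - l * f x" "x \<in> S"
  shows "(\<Sum>y\<in>S. transition S r t x y * f y) = exp (- l * t) * f x"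
proof -
  have "(\<Sum>y\<in>S. transition S r t x y * f y)
      = (\<Sum>y\<in>S. \<Sum>k. t ^ k / fact k * generator_power S r k x y * f y)"
    unfolding transition_def
    by (intro sum.cong refl suminf_mult2 summable_transition assms)
  also have "\<dots> = (\<Sum>k. \<Sum>y\<in>S. t ^ k / fact k * generator_power S r k x y * f y)"
    by (intro suminf_sum[symmetric] summable_mult2 summable_transition assms)
  also have "\<dots> = (\<Sum>k. t ^ k / fact k * (\<Sum>y\<in>S. generator_power S r k x y * f y))"
    by (simp add: sum_distrib_left mult_ac)
  also have "\<dots> = (\<Sum>k. (- l * t) ^ k /\<^sub>R fact k * f x)"
  proof (intro suminf_cong)
    fix k
    have "(\<Sum>y\<in>S. generator_power S r k x y * f y) = (- l) ^ k * f x"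
      using assms by (rule generator_power_sum_eigen)
    then show "t ^ k / fact k * (\<Sum>y\<in>S. generator_power S r k x y * f y) = (- l * t) ^ k /\<^sub>R fact k * f x"
      by (simp only: power_mult_distrib) (simp add: divide_inverse mult_ac)
  qed
  also have "\<dots> = exp (- l * t) * f x"
    unfolding exp_def by (intro suminf_mult2[symmetric] summable_exp_generic)
  finally show ?thesis .
qed

lemma generator_sum:
  assumes "finite S" "x \<in> S"
  shows "(\<Sum>y\<in>S. generator S r x y * f y) = (\<Sum>y\<in>S. r x y * (f y - f x))"
proof -
  have "(\<Sum>y\<in>S. generator S r x y * f y)
      = generator S r x x * f x + (\<Sum>y\<in>S - {x}. generator S r x y * f y)"
    using assms by (rule sum.remove)
  also have "\<dots> = (\<Sum>y\<in>S - {x}. r x y * f y) - (\<Sum>y\<in>S - {x}. r x y * f x)"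
  proof -
    have "(\<Sum>y\<in>S - {x}. generator S r x y * f y) = (\<Sum>y\<in>S - {x}. r x y * f y)"
      by (intro sum.cong) (auto simp: generator_def)
    then show ?thesis by (simp add: generator_def sum_distrib_right)
  qed
  also have "\<dots> = (\<Sum>y\<in>S - {x}. r x y * (f y - f x))"
    by (simp add: sum_subtractf algebra_simps)
  also have "\<dots> = (\<Sum>y\<in>S. r x y * (f y - f x))"
    using assms by (subst (2) sum.remove[of _ x]) auto
  finally show ?thesis .
qed

lemma generator_power_eq_0:
  assumes "finite S"
    and gen: "\<And>x z. x \<in> A \<inter> S \<Longrightarrow> z \<in> S - A \<Longrightarrow> r x z = 0"
    and "x \<in> A \<inter> S" "y \<in> S - A"
  shows "generator_power S r k x y = 0"
  using assms(3)
proof (induction k arbitrary: x)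
  case (Suc k)
  have "generator S r x z * generator_power S r k z y = 0" if "z \<in> S" for z
  proof (cases "z \<in> A")
    case True then show ?thesis using Suc.IH[of z] that by simp
  next
    case False
    with Suc.prems have "x \<noteq> z" by auto
    with False gen[of x z] that Suc.prems show ?thesis by (simp add: generator_def)
  qed
  then show ?case by (simp add: sum.neutral)
qed (use assms(4) in auto)

lemma transition_eq_0:
  assumes "finite S"
    and "\<And>x z. x \<in> A \<inter> S \<Longrightarrow> z \<in> S - A \<Longrightarrow> r x z = 0"
    and "x \<in> A \<inter> S" "y \<in> S - A"
  shows "transition S r t x y = 0"
proof -
  have "generator_power S r k x y = 0" for k
    using assms by (rule generator_power_eq_0)
  then show ?thesis by (simp add: transition_def)
qed

section \<open>Splits that break up a set of labels\<close>

lemma finite_partitions: "finite (partitions n)"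
proof (rule finite_subset)
  show "partitions n \<subseteq> Pow (Pow {1..n})"
    unfolding partitions_def partition_on_def by auto
qed auto

lemma partitionsD:
  assumes "P \<in> partitions n"
  shows "\<Union>P = {1..n}" "finite P" "\<And>b. b \<in> P \<Longrightarrow> finite b" "{} \<notin> P"
    "\<And>b b'. b \<in> P \<Longrightarrow> b' \<in> P \<Longrightarrow> b \<inter> b' \<noteq> {} \<Longrightarrow> b = b'"
proof -
  have P: "partition_on {1..n} P" using assms by (simp add: partitions_def)
  then show U: "\<Union>P = {1..n}" "{} \<notin> P" by (auto simp: partition_on_def)
  then show "finite P" by (metis finite_UnionD finite_atLeastAtMost)
  show "finite b" if "b \<in> P" for b using U that by (metis Union_upper finite_atLeastAtMost finite_subset)
  show "b = b'" if "b \<in> P" "b' \<in> P" "b \<inter> b' \<noteq> {}" for b b'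
    using P that by (auto simp: partition_on_def disjoint_def)
qed

lemma split_in_partitions:
  assumes "P \<in> partitions n" "b \<in> P" "c \<noteq> {}" "c \<subset> b"
  shows "(P - {b}) \<union> {c, b - c} \<in> partitions n"
proof -
  note P = partitionsD[OF assms(1)]
  have "\<Union>((P - {b}) \<union> {c, b - c}) = {1..n}"
    using P(1) assms by auto
  moreover have "disjoint ((P - {b}) \<union> {c, b - c})"
    unfolding disjoint_def using P(5) assms(2,4) by blast
  moreover have "{} \<notin> (P - {b}) \<union> {c, b - c}" using P(4) assms by auto
  ultimately show ?thesis unfolding partitions_def partition_on_def by simp
qed

definition splits :: "'a set \<Rightarrow> 'a set set" where
  "splits b = {c. c \<noteq> {} \<and> c \<subset> b}"

lemma finite_splits: "finite b \<Longrightarrow> finite (splits b)"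
  by (rule finite_subset[of _ "Pow b"]) (auto simp: splits_def)

text \<open>The normalisation \<open>phi \<beta> (m - 1)\<close> and the binomial coefficient cancel: a block splits into the ordered
  pair \<open>(c, b - c)\<close> at a rate that depends on the two sizes only.\<close>
lemma split_rate_term:
  assumes "\<beta> > -2" "finite b" "c \<in> splits b"
  shows "phi \<beta> (real (card b) - 1) * (q \<beta> (card b) (card c) / real (card b choose card c))
      = Beta (real (card c) + \<beta> + 1) (real (card (b - c)) + \<beta> + 1) / 2"
proof -
  have c: "c \<noteq> {}" "c \<subset> b" using assms by (auto simp: splits_def)
  then have "finite c" "card c < card b" "0 < card c"
    using assms(2) finite_subset psubset_card_mono by (auto simp: card_gt_0_iff)
  moreover from this have "phi \<beta> (real (card b) - 1) > 0" using assms(1) by (intro phi_pos) auto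
  moreover have "real (card (b - c)) = real (card b) - real (card c)"
    using c assms(2) \<open>finite c\<close> \<open>card c < card b\<close> by (simp add: card_Diff_subset psubset_imp_subset)
  ultimately show ?thesis by (simp add: q_def)
qed

lemma split_rate_eq_0:
  assumes "\<And>b c. b \<in> P \<Longrightarrow> c \<in> splits b \<Longrightarrow> P' \<noteq> (P - {b}) \<union> {c, b - c}"
  shows "split_rate \<beta> P P' = 0"
  unfolding split_rate_def using assms by (intro sum.neutral ballI) (auto simp: splits_def)

text \<open>Summation over target partitions turned into summation over splits. Blocks of size one have no splits,
  so the restriction to blocks with two labels disappears.\<close>
lemma split_rate_sum:
  assumes "\<beta> > -2" "P \<in> partitions n"
  shows "(\<Sum>P'\<in>partitions n. split_rate \<beta> P P' * g P') =
    (\<Sum>b\<in>P. \<Sum>c\<in>splits b. Beta (real (card c) + \<beta> + 1) (real (card (b - c)) + \<beta> + 1) / 2 *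
        g ((P - {b}) \<union> {c, b - c}))"
proof -
  let ?w = "\<lambda>b c. Beta (real (card c) + \<beta> + 1) (real (card (b - c)) + \<beta> + 1) / 2"
  let ?S = "partitions n"
  let ?P2 = "{b \<in> P. 2 \<le> card b}"
  note P = partitionsD[OF assms(2)]
  have rate: "split_rate \<beta> P P' * g P' =
      (\<Sum>b\<in>?P2. \<Sum>c\<in>splits b. if P' = (P - {b}) \<union> {c, b - c} then ?w b c * g P' else 0)" for P'
  proof -
    have "split_rate \<beta> P P' =
      (\<Sum>b\<in>?P2. \<Sum>c\<in>splits b. if P' = (P - {b}) \<union> {c, b - c} then ?w b c else 0)"
      unfolding split_rate_def splits_def[symmetric]
      by (intro sum.cong refl if_cong split_rate_term[OF assms(1)]) (use P(3) in auto)
    then show ?thesis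
      by (simp add: sum_distrib_right if_distrib[of "\<lambda>a. a * _"] cong: if_cong)
  qed
  have "(\<Sum>P'\<in>?S. split_rate \<beta> P P' * g P') =
      (\<Sum>b\<in>?P2. \<Sum>P'\<in>?S. \<Sum>c\<in>splits b. if P' = (P - {b}) \<union> {c, b - c} then ?w b c * g P' else 0)"
    unfolding rate by (rule sum.swap)
  also have "\<dots> = (\<Sum>b\<in>?P2. \<Sum>c\<in>splits b. \<Sum>P'\<in>?S.
      if P' = (P - {b}) \<union> {c, b - c} then ?w b c * g P' else 0)"
    by (intro sum.cong refl sum.swap)
  also have "\<dots> = (\<Sum>b\<in>?P2. \<Sum>c\<in>splits b. ?w b c * g ((P - {b}) \<union> {c, b - c}))"
    using split_in_partitions[OF assms(2)] finite_partitions
    by (intro sum.cong refl) (auto simp: splits_def)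
  also have "\<dots> = (\<Sum>b\<in>P. \<Sum>c\<in>splits b. ?w b c * g ((P - {b}) \<union> {c, b - c}))"
  proof (intro sum.mono_neutral_left ballI)
    fix b assume b: "b \<in> P - ?P2"
    have "c \<notin> splits b" for c
    proof
      assume "c \<in> splits b"
      then have "c \<noteq> {}" "c \<subset> b" by (auto simp: splits_def)
      moreover have "finite b" using P(3) b by auto
      ultimately have "0 < card c" "card c < card b"
        by (auto simp: card_gt_0_iff psubset_card_mono intro: finite_subset)
      with b show False by auto
    qed
    then have "splits b = {}" by auto
    then show "(\<Sum>c\<in>splits b. ?w b c * g ((P - {b}) \<union> {c, b - c})) = 0" by simp
  qed (use P in auto)
  finally show ?thesis .
qed

text \<open>The probability that a random subset of \<open>b\<close>, which contains each label independently with
  probability \<open>s\<close>, contains \<open>W\<close>.\<close>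
lemma sum_subsets_power:
  fixes s :: real
  assumes "finite b" "W \<subseteq> b"
  shows "(\<Sum>c\<in>{c. W \<subseteq> c \<and> c \<subseteq> b}. s ^ card c * (1 - s) ^ card (b - c)) = s ^ card W"
proof -
  have fW: "finite W" using assms finite_subset by auto
  have "(\<Sum>c\<in>{c. W \<subseteq> c \<and> c \<subseteq> b}. s ^ card c * (1 - s) ^ card (b - c))
      = (\<Sum>d\<in>Pow (b - W). s ^ card (d \<union> W) * (1 - s) ^ card (b - (d \<union> W)))"
    by (rule sum.reindex_bij_witness[where i = "\<lambda>d. d \<union> W" and j = "\<lambda>c. c - W"])
       (use assms in \<open>auto simp: Un_absorb2 intro!: arg_cong[where f = card]\<close>)
  also have "\<dots> = (\<Sum>d\<in>Pow (b - W). s ^ card W * ((\<Prod>x\<in>d. s) * (\<Prod>x\<in>(b - W) - d. 1 - s)))"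
  proof (intro sum.cong refl)
    fix d assume d: "d \<in> Pow (b - W)"
    then have "card (d \<union> W) = card d + card W"
      using assms fW by (intro card_Un_disjoint) (auto intro: finite_subset)
    moreover have "b - (d \<union> W) = (b - W) - d" by auto
    ultimately show "s ^ card (d \<union> W) * (1 - s) ^ card (b - (d \<union> W))
        = s ^ card W * ((\<Prod>x\<in>d. s) * (\<Prod>x\<in>(b - W) - d. 1 - s))"
      by (simp add: power_add)
  qed
  also have "\<dots> = s ^ card W * (\<Prod>x\<in>b - W. s + (1 - s))"
    using assms by (subst prod_add) (auto simp: sum_distrib_left)
  finally show ?thesis by simp
qed

text \<open>The total rate of splits that break up \<open>W\<close>. It does not depend on the block \<open>b \<supseteq> W\<close>, which is the
  consistency of the model under removal of labels. By the symmetry \<open>c \<mapsto> b - c\<close> it suffices to count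
  the parts \<open>c\<close> that contain the label \<open>u \<in> W\<close>, twice. The beta function is then an integral against
  the splitting measure, under which the labels other than \<open>u\<close> join \<open>u\<close> independently with
  probability \<open>s\<close>; the set \<open>W\<close> is broken up with probability \<open>1 - s ^ (card W - 1)\<close>.\<close>
lemma sum_separating_splits:
  assumes "\<beta> > -2" "finite b" "W \<subseteq> b" "u \<in> W"
  shows "(\<Sum>c\<in>{c\<in>splits b. \<not> W \<subseteq> c \<and> \<not> W \<subseteq> b - c}.
            Beta (real (card c) + \<beta> + 1) (real (card (b - c)) + \<beta> + 1) / 2)
      = phi \<beta> (real (card W) - 1)" (is "(\<Sum>c\<in>?C. ?w c) = _")
proof -
  let ?Cu = "{c. u \<in> c \<and> c \<subseteq> b \<and> \<not> W \<subseteq> c}"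
  have fC: "finite ?C" using finite_splits[OF assms(2)] by simp
  have C1: "{c\<in>?C. u \<in> c} = ?Cu" using assms by (auto simp: splits_def)
  have "(\<Sum>c\<in>?C. ?w c) = (\<Sum>c\<in>{c\<in>?C. u \<in> c}. ?w c) + (\<Sum>c\<in>{c\<in>?C. u \<notin> c}. ?w c)"
    using fC sum.Int_Diff[OF fC, of ?w "{c. u \<in> c}"] by (auto simp: Int_def set_diff_eq)
  also have "(\<Sum>c\<in>{c\<in>?C. u \<notin> c}. ?w c) = (\<Sum>c\<in>{c\<in>?C. u \<in> c}. ?w c)"
    by (rule sum.reindex_bij_witness[where i = "\<lambda>c. b - c" and j = "\<lambda>c. b - c"])
       (use assms in \<open>auto simp: splits_def double_diff Beta_commute\<close>)
  also have "(\<Sum>c\<in>{c\<in>?C. u \<in> c}. ?w c) + (\<Sum>c\<in>{c\<in>?C. u \<in> c}. ?w c)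
      = (\<Sum>c\<in>?Cu. Beta (real (card c) + \<beta> + 1) (real (card (b - c)) + \<beta> + 1))"
    unfolding C1 by (simp add: sum.distrib[symmetric])
  also have "\<dots> = (\<Sum>c\<in>?Cu. \<integral>s. s powr (real (card c) - 1) * (1 - s) powr real (card (b - c)) \<partial>dislocation \<beta>)"
  proof (intro sum.cong refl)
    fix c assume c: "c \<in> ?Cu"
    then have "finite c" using assms(2) finite_subset by auto
    with c have "1 \<le> card c" by (auto simp: Suc_le_eq card_gt_0_iff)
    moreover have "1 \<le> card (b - c)"
      using assms c by (auto simp: Suc_le_eq card_gt_0_iff)
    ultimately show "Beta (real (card c) + \<beta> + 1) (real (card (b - c)) + \<beta> + 1) =
      (\<integral>s. s powr (real (card c) - 1) * (1 - s) powr real (card (b - c)) \<partial>dislocation \<beta>)"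
      using assms(1) by (subst integral_dislocation_powr) (auto simp: algebra_simps)
  qed
  also have "\<dots> = (\<integral>s. (\<Sum>c\<in>?Cu. s powr (real (card c) - 1) * (1 - s) powr real (card (b - c))) \<partial>dislocation \<beta>)"
  proof (intro Bochner_Integration.integral_sum[symmetric] integrable_dislocation_powr)
    fix c assume c: "c \<in> ?Cu"
    then have "finite c" using assms(2) finite_subset by auto
    with c have "1 \<le> card c" by (auto simp: Suc_le_eq card_gt_0_iff)
    then show "0 < real (card c) - 1 + \<beta> + 2" using assms(1) by simp
    have "1 \<le> card (b - c)" using assms c by (auto simp: Suc_le_eq card_gt_0_iff)
    then show "0 < real (card (b - c)) + \<beta> + 1" using assms(1) by simp
  qed
  also have "\<dots> = (\<integral>s. 1 - s powr (real (card W) - 1) \<partial>dislocation \<beta>)"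
  proof (intro integral_cong_AE)
    show "AE s in dislocation \<beta>. (\<Sum>c\<in>?Cu. s powr (real (card c) - 1) * (1 - s) powr real (card (b - c)))
        = 1 - s powr (real (card W) - 1)"
      using AE_dislocation
    proof eventually_elim
      fix s :: real assume s: "0 < s \<and> s < 1"
      let ?f = "\<lambda>c. s ^ card c * (1 - s) ^ card (b - c)"
      have "{c. {u} \<subseteq> c \<and> c \<subseteq> b} = ?Cu \<union> {c. W \<subseteq> c \<and> c \<subseteq> b}" using assms by auto
      moreover have "finite ?Cu" "finite {c. W \<subseteq> c \<and> c \<subseteq> b}"
        using assms(2) by (auto intro: finite_subset[of _ "Pow b"])
      ultimately have "sum ?f {c. {u} \<subseteq> c \<and> c \<subseteq> b} = sum ?f ?Cu + sum ?f {c. W \<subseteq> c \<and> c \<subseteq> b}"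
        by (simp only:) (subst sum.union_disjoint, auto)
      moreover have "{u} \<subseteq> b" using assms by auto
      ultimately have "sum ?f ?Cu = s - s ^ card W"
        using sum_subsets_power[of b "{u}" s] sum_subsets_power[OF assms(2,3), of s] assms(2) by simp
      moreover have "(\<Sum>c\<in>?Cu. s powr (real (card c) - 1) * (1 - s) powr real (card (b - c))) = sum ?f ?Cu / s"
        using s by (simp add: sum_divide_distrib powr_diff powr_realpow)
      moreover have "s powr (real (card W) - 1) = s ^ card W / s"
        using s by (simp add: powr_diff powr_realpow)
      ultimately show "(\<Sum>c\<in>?Cu. s powr (real (card c) - 1) * (1 - s) powr real (card (b - c)))
        = 1 - s powr (real (card W) - 1)"
        using s by (simp add: diff_divide_distrib)
    qed
  qed auto
  finally show ?thesis by (simp add: phi_eq_dislocation)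
qed

definition together :: "'a set \<Rightarrow> 'a set set \<Rightarrow> real" where
  "together W P = of_bool (\<exists>b\<in>P. W \<subseteq> b)"

text \<open>If \<open>W\<close> is already broken up, it stays so. If it lies in a block, the function changes only when that
  block splits through \<open>W\<close>, at the total rate just computed.\<close>
lemma generator_together:
  assumes "\<beta> > -2" "P \<in> partitions n" "u \<in> W"
  shows "(\<Sum>P'\<in>partitions n. generator (partitions n) (split_rate \<beta>) P P' * together W P')
      = - phi \<beta> (real (card W) - 1) * together W P"
proof -
  note P = partitionsD[OF assms(2)]
  let ?w = "\<lambda>b c. Beta (real (card c) + \<beta> + 1) (real (card (b - c)) + \<beta> + 1) / 2"
  let ?f = "together W"
  have sum: "(\<Sum>P'\<in>partitions n. generator (partitions n) (split_rate \<beta>) P P' * ?f P') =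
    (\<Sum>b\<in>P. \<Sum>c\<in>splits b. ?w b c * (?f ((P - {b}) \<union> {c, b - c}) - ?f P))"
    using assms by (simp add: generator_sum finite_partitions split_rate_sum)
  show ?thesis
  proof (cases "\<exists>b\<in>P. W \<subseteq> b")
    case False
    have "?f ((P - {b}) \<union> {c, b - c}) = 0" if "b \<in> P" "c \<in> splits b" for b c
      using False that by (auto simp: together_def splits_def)
    with False show ?thesis unfolding sum by (simp add: together_def)
  next
    case True
    then obtain b0 where b0: "b0 \<in> P" "W \<subseteq> b0" by auto
    have fP: "?f P = 1" using b0 by (auto simp: together_def)
    have other: "?f ((P - {b}) \<union> {c, b - c}) = 1" if "b \<in> P - {b0}" for b c
      using b0 that by (auto simp: together_def)
    have at: "?f ((P - {b0}) \<union> {c, b0 - c}) - 1 = (if \<not> W \<subseteq> c \<and> \<not> W \<subseteq> b0 - c then - 1 else 0)" for c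
    proof -
      have "\<not> W \<subseteq> b'" if "b' \<in> P - {b0}" for b'
        using P(5)[of b' b0] b0 that assms(3) by blast
      then show ?thesis by (auto simp: together_def)
    qed
    have "(\<Sum>b\<in>P. \<Sum>c\<in>splits b. ?w b c * (?f ((P - {b}) \<union> {c, b - c}) - ?f P))
        = (\<Sum>c\<in>splits b0. ?w b0 c * (?f ((P - {b0}) \<union> {c, b0 - c}) - 1)) + 0"
      unfolding fP using b0 P(2) other by (subst sum.remove[of _ b0]) (auto simp: sum.neutral)
    also have "\<dots> = - (\<Sum>c\<in>{c\<in>splits b0. \<not> W \<subseteq> c \<and> \<not> W \<subseteq> b0 - c}. ?w b0 c)"
      unfolding at using finite_splits[OF P(3)[OF b0(1)]]
      by (simp add: sum.inter_filter sum_negf[symmetric] if_distrib cong: if_cong)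
    also have "\<dots> = - phi \<beta> (real (card W) - 1)"
      using sum_separating_splits[OF assms(1) P(3)[OF b0(1)] b0(2) assms(3)] by simp
    finally show ?thesis unfolding sum fP by simp
  qed
qed

lemma sum_Pow_card:
  fixes g :: "nat \<Rightarrow> real"
  assumes "finite B"
  shows "(\<Sum>A\<in>Pow B. g (card A)) = (\<Sum>k\<le>card B. real (card B choose k) * g k)"
proof -
  have "(\<Sum>A\<in>Pow B. g (card A)) = (\<Sum>k\<le>card B. \<Sum>A\<in>{A \<in> Pow B. card A = k}. g (card A))"
    using assms by (intro sum.group[symmetric]) (auto intro: card_mono)
  also have "\<dots> = (\<Sum>k\<le>card B. real (card B choose k) * g k)"
    using assms by (intro sum.cong refl) (simp add: n_subsets)
  finally show ?thesis .
qed

text \<open>For a subordinator \<open>\<xi>\<close> with Laplace exponent \<open>phi \<beta>\<close> this is the expectation of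
  \<open>(1 - exp (- \<xi>\<^sub>t)) ^ N\<close>: the probability that \<open>\<xi>\<close> has covered \<open>N\<close> independent standard exponential
  points by time \<open>t\<close>.\<close>
definition cover_prob :: "real \<Rightarrow> nat \<Rightarrow> real \<Rightarrow> real" where
  "cover_prob \<beta> N t = (\<Sum>k\<le>N. real (N choose k) * ((- 1) ^ k * exp (- phi \<beta> (real k) * t)))"

lemma together_insert:
  assumes "P \<in> partitions n" "b \<in> P" "u \<in> b"
  shows "together (insert u A) P = of_bool (A \<subseteq> b)"
  using partitionsD(5)[OF assms(1) assms(2)] assms(2,3) unfolding together_def by auto

lemma singleton_block_iff:
  assumes "P \<in> partitions n" "b \<in> P" "u \<in> b"
  shows "{u} \<in> P \<longleftrightarrow> b = {u}"
  using partitionsD(5)[OF assms(1) assms(2), of "{u}"] assms(2,3) by auto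

text \<open>The label \<open>u\<close> is alone if none of the other labels is in its block \<open>b\<close>; the alternating sum over the
  subsets of \<open>b - {u}\<close> is the product of \<open>card b - 1\<close> zeros.\<close>
lemma singleton_block_inclusion_exclusion:
  assumes P: "P \<in> partitions n" and u: "u \<in> {1..n}"
  shows "of_bool ({u} \<in> P) = (\<Sum>A\<in>Pow ({1..n} - {u}). (- 1) ^ card A * together (insert u A) P)"
proof -
  obtain b where b: "b \<in> P" "u \<in> b" using partitionsD(1)[OF P] u by (metis UnionE)
  have bs: "b \<subseteq> {1..n}" "finite b" using partitionsD[OF P] b by auto
  have "(\<Sum>A\<in>Pow ({1..n} - {u}). (- 1) ^ card A * together (insert u A) P)
      = (\<Sum>A\<in>Pow (b - {u}). (- 1) ^ card A :: real)"
    unfolding together_insert[OF P b] using bs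
    by (intro sum.mono_neutral_cong_right) auto
  also have "\<dots> = (\<Sum>A\<in>Pow (b - {u}). (\<Prod>x\<in>A. - 1) * (\<Prod>x\<in>b - {u} - A. 1))" by simp
  also have "\<dots> = (\<Prod>x\<in>b - {u}. - 1 + 1)"
    using bs by (intro prod_add[symmetric]) auto
  also have "\<dots> = of_bool ({u} \<in> P)"
  proof -
    have "card (b - {u}) = 0 \<longleftrightarrow> b - {u} = {}" using bs(2) by (intro card_0_eq) auto
    also have "\<dots> \<longleftrightarrow> {u} \<in> P" unfolding singleton_block_iff[OF P b] using b by auto
    finally have c: "card (b - {u}) = 0 \<longleftrightarrow> {u} \<in> P" .
    have "(\<Prod>x\<in>b - {u}. - 1 + 1 :: real) = 0 ^ card (b - {u})" by simp
    then show ?thesis unfolding power_0_left c by simp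
  qed
  finally show ?thesis by simp
qed

lemma one_block_in_partitions: "n \<ge> 1 \<Longrightarrow> {{1..n}} \<in> partitions n"
  by (auto simp: partitions_def partition_on_def disjoint_def)

lemma transition_together:
  assumes "\<beta> > -2" "n \<ge> 1" "W \<subseteq> {1..n}" "u \<in> W"
  shows "(\<Sum>P\<in>partitions n. transition (partitions n) (split_rate \<beta>) t {{1..n}} P * together W P)
    = exp (- phi \<beta> (real (card W) - 1) * t)"
  using assms
  by (subst transition_sum_eigen[OF finite_partitions generator_together[OF assms(1) _ assms(4)]
        one_block_in_partitions]) (auto simp: together_def)

lemma transition_singleton:
  assumes "\<beta> > -2" "u \<in> {1..n}"
  shows "(\<Sum>P\<in>partitions n. transition (partitions n) (split_rate \<beta>) t {{1..n}} P * of_bool ({u} \<in> P))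
    = cover_prob \<beta> (n - 1) t"
proof -
  let ?p = "transition (partitions n) (split_rate \<beta>) t {{1..n}}"
  let ?B = "{1..n} - {u}"
  have "(\<Sum>P\<in>partitions n. ?p P * of_bool ({u} \<in> P))
      = (\<Sum>P\<in>partitions n. \<Sum>A\<in>Pow ?B. (- 1) ^ card A * (?p P * together (insert u A) P))"
    using singleton_block_inclusion_exclusion[OF _ assms(2)]
    by (intro sum.cong refl) (simp add: sum_distrib_left mult_ac)
  also have "\<dots> = (\<Sum>A\<in>Pow ?B. (- 1) ^ card A * (\<Sum>P\<in>partitions n. ?p P * together (insert u A) P))"
    by (subst sum.swap) (simp add: sum_distrib_left)
  also have "\<dots> = (\<Sum>A\<in>Pow ?B. (- 1) ^ card A * exp (- phi \<beta> (real (card A)) * t))"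
  proof (intro sum.cong refl)
    fix A assume A: "A \<in> Pow ?B"
    then have "finite A" "u \<notin> A" by (auto intro: finite_subset)
    then have "real (card (insert u A)) - 1 = real (card A)" by simp
    moreover have "insert u A \<subseteq> {1..n}" "n \<ge> 1" using A assms(2) by auto
    ultimately show "(- 1) ^ card A * (\<Sum>P\<in>partitions n. ?p P * together (insert u A) P)
        = (- 1) ^ card A * exp (- phi \<beta> (real (card A)) * t)"
      using transition_together[OF assms(1), of n "insert u A" u t] by simp
  qed
  also have "\<dots> = (\<Sum>k\<le>card ?B. real (card ?B choose k) * ((- 1) ^ k * exp (- phi \<beta> (real k) * t)))"
    by (rule sum_Pow_card) simp
  also have "card ?B = n - 1" using assms(2) by simp
  finally show ?thesis unfolding cover_prob_def .
qed

text \<open>The union bound behind the exponential tail of the height: a label that is not alone has some companion.\<close>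
lemma not_singleton_le_together:
  assumes P: "P \<in> partitions n" and u: "u \<in> {1..n}"
  shows "1 - of_bool ({u} \<in> P) \<le> (\<Sum>v\<in>{1..n} - {u}. together {u, v} P)"
proof -
  obtain b where b: "b \<in> P" "u \<in> b" using partitionsD(1)[OF P] u by (metis UnionE)
  show ?thesis
  proof (cases "b = {u}")
    case True
    then show ?thesis using b by (auto simp: together_def intro!: sum_nonneg)
  next
    case False
    then obtain v where v: "v \<in> b" "v \<noteq> u" using b by auto
    then have "v \<in> {1..n} - {u}" using partitionsD(1)[OF P] b by auto
    then have "together {u, v} P \<le> (\<Sum>v\<in>{1..n} - {u}. together {u, v} P)"
      by (intro member_le_sum) (auto simp: together_def)
    moreover have "together {u, v} P = 1" using v b by (auto simp: together_def)
    ultimately show ?thesis by simp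
  qed
qed

lemma split_rate_singleton_absorbing:
  assumes "{u} \<in> P" "{u} \<notin> P'"
  shows "split_rate \<beta> P P' = 0"
proof (rule split_rate_eq_0)
  fix b c assume "b \<in> P" "c \<in> splits b"
  then have "b \<noteq> {u}" by (auto simp: splits_def)
  then show "P' \<noteq> (P - {b}) \<union> {c, b - c}" using assms by auto
qed

section \<open>Marginals of a finite-state chain\<close>

lemma
  assumes "ctmc M S r x0 X"
  shows ctmc_prob_space: "prob_space M"
    and ctmc_finite: "finite S"
    and ctmc_start: "x0 \<in> S"
    and ctmc_measurable: "t \<ge> 0 \<Longrightarrow> X t \<in> measurable M (count_space S)"
    and ctmc_right_continuous:
      "\<omega> \<in> space M \<Longrightarrow> t \<ge> 0 \<Longrightarrow> \<forall>\<^sub>F s in at_right t. X s \<omega> = X t \<omega>"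
    and ctmc_fidi: "(t' :: nat \<Rightarrow> real) 0 = 0 \<Longrightarrow> (\<And>i. i < k \<Longrightarrow> t' i \<le> t' (Suc i)) \<Longrightarrow> x 0 = x0 \<Longrightarrow>
      (\<And>i. i \<le> k \<Longrightarrow> x i \<in> S) \<Longrightarrow>
      measure M {\<omega> \<in> space M. \<forall>i\<le>k. X (t' i) \<omega> = x i}
          = (\<Prod>i<k. transition S r (t' (Suc i) - t' i) (x i) (x (Suc i)))"
  using assms unfolding ctmc_def by blast+

lemma ctmc_state_sets:
  assumes "ctmc M S r x0 X" "t \<ge> 0"
  shows "{\<omega> \<in> space M. X t \<omega> \<in> B} \<in> sets M"
proof -
  have "{\<omega> \<in> space M. X t \<omega> \<in> B} = X t -` (B \<inter> S) \<inter> space M"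
    using measurable_space[OF ctmc_measurable[OF assms]] by auto
  also have "\<dots> \<in> sets M"
    by (rule measurable_sets[OF ctmc_measurable[OF assms]]) auto
  finally show ?thesis .
qed

lemma ctmc_start_AE:
  assumes "ctmc M S r x0 X"
  shows "AE \<omega> in M. X 0 \<omega> = x0"
proof -
  interpret prob_space M using assms by (rule ctmc_prob_space)
  have "measure M {\<omega> \<in> space M. X 0 \<omega> = x0} = 1"
    using ctmc_fidi[OF assms, of "\<lambda>_. 0" 0 "\<lambda>_. x0"] ctmc_start[OF assms] by simp
  then show ?thesis
    using prob_Collect_eq_1[of "\<lambda>\<omega>. X 0 \<omega> = x0"] ctmc_state_sets[OF assms, of 0 "{x0}"] by simp
qed

text \<open>The finite-dimensional distributions are given for sequences of times that begin with \<open>0\<close>; as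
  the chain starts almost surely in \<open>x0\<close>, the condition at time \<open>0\<close> can be dropped.\<close>
lemma ctmc_prob2:
  assumes "ctmc M S r x0 X" "0 \<le> t" "t \<le> s" "y \<in> S" "z \<in> S"
  shows "measure M {\<omega> \<in> space M. X t \<omega> = y \<and> X s \<omega> = z}
    = transition S r t x0 y * transition S r (s - t) y z"
proof -
  interpret prob_space M using assms(1) by (rule ctmc_prob_space)
  let ?t = "\<lambda>i::nat. if i = 0 then 0 else if i = 1 then t else s"
  let ?x = "\<lambda>i::nat. if i = 0 then x0 else if i = 1 then y else z"
  have "measure M {\<omega> \<in> space M. \<forall>i\<le>2. X (?t i) \<omega> = ?x i}
    = (\<Prod>i<2. transition S r (?t (Suc i) - ?t i) (?x i) (?x (Suc i)))"
    using assms ctmc_start[OF assms(1)] by (intro ctmc_fidi[OF assms(1)]) auto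
  also have "\<dots> = transition S r t x0 y * transition S r (s - t) y z"
    by (simp add: numeral_2_eq_2)
  also have "{\<omega> \<in> space M. \<forall>i\<le>2. X (?t i) \<omega> = ?x i}
      = {\<omega> \<in> space M. X 0 \<omega> \<in> {x0}} \<inter> {\<omega> \<in> space M. X t \<omega> \<in> {y}} \<inter> {\<omega> \<in> space M. X s \<omega> \<in> {z}}" (is "_ = ?A")
    by (auto simp: numeral_2_eq_2 le_Suc_eq)
  also have "measure M ?A = measure M ({\<omega> \<in> space M. X t \<omega> \<in> {y}} \<inter> {\<omega> \<in> space M. X s \<omega> \<in> {z}})"
    using assms ctmc_start_AE[OF assms(1)]
    by (intro measure_eq_AE sets.Int ctmc_state_sets[OF assms(1)]) auto
  also have "{\<omega> \<in> space M. X t \<omega> \<in> {y}} \<inter> {\<omega> \<in> space M. X s \<omega> \<in> {z}}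
      = {\<omega> \<in> space M. X t \<omega> = y \<and> X s \<omega> = z}" by auto
  finally show ?thesis .
qed

lemma ctmc_prob:
  assumes "ctmc M S r x0 X" "0 \<le> t" "y \<in> S"
  shows "measure M {\<omega> \<in> space M. X t \<omega> = y} = transition S r t x0 y"
proof -
  interpret prob_space M using assms(1) by (rule ctmc_prob_space)
  let ?t = "\<lambda>i::nat. if i = 0 then 0 else t"
  let ?x = "\<lambda>i::nat. if i = 0 then x0 else y"
  have "measure M {\<omega> \<in> space M. \<forall>i\<le>1. X (?t i) \<omega> = ?x i}
    = (\<Prod>i<1. transition S r (?t (Suc i) - ?t i) (?x i) (?x (Suc i)))"
    using assms ctmc_start[OF assms(1)] by (intro ctmc_fidi[OF assms(1)]) auto
  also have "\<dots> = transition S r t x0 y" by simp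
  also have "{\<omega> \<in> space M. \<forall>i\<le>1. X (?t i) \<omega> = ?x i}
      = {\<omega> \<in> space M. X 0 \<omega> \<in> {x0}} \<inter> {\<omega> \<in> space M. X t \<omega> \<in> {y}}" (is "_ = ?A")
    by (auto simp: le_Suc_eq)
  also have "measure M ?A = measure M {\<omega> \<in> space M. X t \<omega> \<in> {y}}"
    using assms ctmc_start_AE[OF assms(1)]
    by (intro measure_eq_AE sets.Int ctmc_state_sets[OF assms(1)]) auto
  finally show ?thesis by simp
qed

lemma ctmc_prob_set:
  assumes "ctmc M S r x0 X" "0 \<le> t"
  shows "measure M {\<omega> \<in> space M. X t \<omega> \<in> B} = (\<Sum>y\<in>S. transition S r t x0 y * of_bool (y \<in> B))"
proof -
  interpret prob_space M using assms(1) by (rule ctmc_prob_space)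
  note fin = ctmc_finite[OF assms(1)]
  have "{\<omega> \<in> space M. X t \<omega> \<in> B} = (\<Union>y\<in>S \<inter> B. {\<omega> \<in> space M. X t \<omega> = y})"
    using measurable_space[OF ctmc_measurable[OF assms]] by auto
  also have "measure M \<dots> = (\<Sum>y\<in>S \<inter> B. measure M {\<omega> \<in> space M. X t \<omega> = y})"
    using ctmc_state_sets[OF assms, of "{_}"] fin
    by (intro finite_measure_finite_Union) (auto simp: disjoint_family_on_def)
  also have "\<dots> = (\<Sum>y\<in>S \<inter> B. transition S r t x0 y)"
    using ctmc_prob[OF assms] by (intro sum.cong) auto
  also have "\<dots> = (\<Sum>y\<in>S. transition S r t x0 y * of_bool (y \<in> B))"
    using fin by (simp add: sum.inter_restrict of_bool_def if_distrib[of "\<lambda>a. _ * a"] cong: if_cong)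
  finally show ?thesis .
qed

text \<open>For two fixed times this follows from the transition function alone, because the joint law of the chain
  at the two times gives no mass to pairs of states in \<open>A\<close> and outside \<open>A\<close>.\<close>
lemma ctmc_absorbing:
  assumes "ctmc M S r x0 X" "0 \<le> t" "t \<le> s"
    and "\<And>x z. x \<in> A \<inter> S \<Longrightarrow> z \<in> S - A \<Longrightarrow> r x z = 0"
  shows "AE \<omega> in M. X t \<omega> \<in> A \<longrightarrow> X s \<omega> \<in> A"
proof -
  interpret prob_space M using assms(1) by (rule ctmc_prob_space)
  note fin = ctmc_finite[OF assms(1)]
  have "AE \<omega> in M. \<not> (X t \<omega> = y \<and> X s \<omega> = z)" if "y \<in> A \<inter> S" "z \<in> S - A" for y z
  proof -
    have "measure M {\<omega> \<in> space M. X t \<omega> = y \<and> X s \<omega> = z} = 0"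
      using that transition_eq_0[OF fin assms(4) that]
      by (subst ctmc_prob2[OF assms(1-3)]) auto
    moreover have "{\<omega> \<in> space M. X t \<omega> = y \<and> X s \<omega> = z} \<in> events"
    proof -
      have "{\<omega> \<in> space M. X t \<omega> = y \<and> X s \<omega> = z}
        = {\<omega> \<in> space M. X t \<omega> \<in> {y}} \<inter> {\<omega> \<in> space M. X s \<omega> \<in> {z}}" by auto
      also have "\<dots> \<in> events"
        using assms by (intro sets.Int ctmc_state_sets[OF assms(1)]) auto
      finally show ?thesis .
    qed
    ultimately show ?thesis
      using prob_Collect_eq_0[of "\<lambda>\<omega>. X t \<omega> = y \<and> X s \<omega> = z"] by simp
  qed
  then have "AE \<omega> in M. \<forall>y\<in>A \<inter> S. \<forall>z\<in>S - A. \<not> (X t \<omega> = y \<and> X s \<omega> = z)"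
    using fin by (intro AE_finite_allI) auto
  moreover have "AE \<omega> in M. X t \<omega> \<in> S \<and> X s \<omega> \<in> S"
    using measurable_space[OF ctmc_measurable[OF assms(1)]] assms by (intro AE_I2) auto
  ultimately show ?thesis by eventually_elim auto
qed

section \<open>The law of the height of a uniform leaf\<close>

locale labelled_beta_splitting_chain =
  fixes \<beta> :: real and n :: nat and M :: "'w measure" and X :: "real \<Rightarrow> 'w \<Rightarrow> nat set set" and U :: "'w \<Rightarrow> nat"
  assumes beta_gt: "\<beta> > -2" and n_ge_1: "n \<ge> 1"
    and chain: "beta_splitting_chain \<beta> n M X"
    and label: "uniform_label n M X U"
begin

lemma ctmc: "ctmc M (partitions n) (split_rate \<beta>) {{1..n}} X"
  using chain by (simp add: beta_splitting_chain_def)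

sublocale prob_space M using ctmc by (rule ctmc_prob_space)

definition isolated :: "real \<Rightarrow> 'w set" where
  "isolated t = {\<omega> \<in> space M. {U \<omega>} \<in> X t \<omega>}"

lemma U_range: "\<omega> \<in> space M \<Longrightarrow> U \<omega> \<in> {1..n}"
  using label measurable_space[of U M "count_space {1..n}" \<omega>] by (simp add: uniform_label_def)

lemma isolated_eq: "isolated t = (\<Union>u\<in>{1..n}. (U -` {u} \<inter> space M) \<inter> {\<omega> \<in> space M. X t \<omega> \<in> {P. {u} \<in> P}})"
  using U_range by (auto simp: isolated_def)

lemma U_sets: "U -` {u} \<inter> space M \<in> events"
proof -
  have U: "U \<in> measurable M (count_space {1..n})" using label by (simp add: uniform_label_def)
  have "U -` {u} \<inter> space M = U -` ({u} \<inter> {1..n}) \<inter> space M" using U_range by auto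
  also have "\<dots> \<in> events" by (rule measurable_sets[OF U]) auto
  finally show ?thesis .
qed

lemma isolated_sets [measurable]: "t \<ge> 0 \<Longrightarrow> isolated t \<in> events"
  unfolding isolated_eq by (intro sets.finite_UN sets.Int U_sets ctmc_state_sets[OF ctmc]) auto

lemma prob_singleton:
  assumes "t \<ge> 0" "u \<in> {1..n}"
  shows "prob {\<omega> \<in> space M. X t \<omega> \<in> {P. {u} \<in> P}} = cover_prob \<beta> (n - 1) t"
  unfolding ctmc_prob_set[OF ctmc assms(1)] using transition_singleton[OF beta_gt assms(2), of t] by simp

lemma prob_label: "u \<in> {1..n} \<Longrightarrow> prob (U -` {u} \<inter> space M) = 1 / real n"
proof -
  assume u: "u \<in> {1..n}"
  have U: "U \<in> measurable M (count_space {1..n})"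
    and d: "distr M (count_space {1..n}) U = uniform_count_measure {1..n}"
    using label by (simp_all add: uniform_label_def)
  have "prob (U -` {u} \<inter> space M) = measure (distr M (count_space {1..n}) U) {u}"
    using u U by (subst measure_distr) auto
  also have "\<dots> = 1 / real n"
    unfolding d using u by (subst measure_uniform_count_measure) auto
  finally show ?thesis .
qed

text \<open>The probability that a given label is alone is the same for all labels, so that conditioning on the
  independent uniform label changes nothing.\<close>
lemma prob_isolated:
  assumes "t \<ge> 0"
  shows "prob (isolated t) = cover_prob \<beta> (n - 1) t"
proof -
  let ?A = "\<lambda>u. U -` {u} \<inter> space M" and ?B = "\<lambda>u. {\<omega> \<in> space M. X t \<omega> \<in> {P. {u} \<in> P}}"
  have "prob (isolated t) = (\<Sum>u\<in>{1..n}. prob (?A u \<inter> ?B u))"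
    unfolding isolated_eq
  proof (intro finite_measure_finite_Union image_subsetI)
    show "?A u \<inter> ?B u \<in> events" for u
      by (intro sets.Int U_sets ctmc_state_sets[OF ctmc assms])
  qed (auto simp: disjoint_family_on_def)
  also have "\<dots> = (\<Sum>u\<in>{1..n}. prob (?A u) * prob (?B u))"
  proof (intro sum.cong refl)
    fix u assume u: "u \<in> {1..n}"
    let ?N = "PiM {0..} (\<lambda>_::real. count_space (partitions n))"
    let ?F = "(\<lambda>f. f t) -` ({P. {u} \<in> P} \<inter> partitions n) \<inter> space ?N"
    let ?g = "\<lambda>\<omega>. \<lambda>t\<in>{0..}. X t \<omega>"
    have "(\<lambda>f. f t) \<in> measurable ?N (count_space (partitions n))"
      using assms by (intro measurable_component_singleton) simp
    then have F: "?F \<in> sets ?N" by (rule measurable_sets) simp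
    have X: "X s \<omega> \<in> partitions n" if "\<omega> \<in> space M" "s \<ge> 0" for s \<omega>
      using measurable_space[OF ctmc_measurable[OF ctmc that(2)] that(1)] by simp
    have "?B u = ?g -` ?F \<inter> space M"
    proof (rule set_eqI)
      fix \<omega>
      show "\<omega> \<in> ?B u \<longleftrightarrow> \<omega> \<in> ?g -` ?F \<inter> space M"
      proof (cases "\<omega> \<in> space M")
        case True
        then have "?g \<omega> \<in> space ?N" using X by (simp add: space_PiM PiE_iff)
        with True X[OF True assms] assms show ?thesis by simp
      qed simp
    qed
    then have "?B u \<in> sets (vimage_algebra (space M) ?g ?N)"
      using in_vimage_algebra[OF F, of ?g "space M"] by (simp only:)
    moreover have "?A u \<in> sets (vimage_algebra (space M) U (count_space {1..n}))"
      using u by (intro in_vimage_algebra) simp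
    moreover have "indep_set (sets (vimage_algebra (space M) U (count_space {1..n})))
        (sets (vimage_algebra (space M) ?g ?N))"
      using label unfolding uniform_label_def by (elim conjE)
    ultimately show "prob (?A u \<inter> ?B u) = prob (?A u) * prob (?B u)"
      by (intro indep_setD)
  qed
  also have "\<dots> = (\<Sum>u\<in>{1..n}. 1 / real n * cover_prob \<beta> (n - 1) t)"
    using prob_label prob_singleton[OF assms] by (intro sum.cong) auto
  also have "\<dots> = cover_prob \<beta> (n - 1) t" using n_ge_1 by simp
  finally show ?thesis .
qed

lemma isolated_mono_AE:
  assumes "0 \<le> t" "t \<le> s"
  shows "AE \<omega> in M. \<omega> \<in> isolated t \<longrightarrow> \<omega> \<in> isolated s"
proof -
  have "AE \<omega> in M. \<forall>u\<in>{1..n}. X t \<omega> \<in> {P. {u} \<in> P} \<longrightarrow> X s \<omega> \<in> {P. {u} \<in> P}"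
  proof (intro AE_finite_allI ctmc_absorbing[OF ctmc assms])
    fix u x z assume "x \<in> {P. {u} \<in> P} \<inter> partitions n" "z \<in> partitions n - {P. {u} \<in> P}"
    then show "split_rate \<beta> x z = 0" by (intro split_rate_singleton_absorbing[of u]) auto
  qed auto
  then show ?thesis
    by (rule AE_mp) (auto intro!: AE_I2 simp: isolated_def dest: U_range)
qed

text \<open>A pair of labels stays together up to time \<open>t\<close> with probability \<open>exp (- phi \<beta> 1 * t)\<close>, and there are
  \<open>n - 1\<close> possible companions.\<close>
lemma cover_prob_tail:
  assumes "t \<ge> 0"
  shows "1 - cover_prob \<beta> (n - 1) t \<le> real (n - 1) * exp (- phi \<beta> 1 * t)"
proof -
  let ?p = "transition (partitions n) (split_rate \<beta>) t {{1..n}}"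
  have u: "1 \<in> {1..n}" using n_ge_1 by auto
  have p: "0 \<le> ?p P" if "P \<in> partitions n" for P
    using ctmc_prob[OF ctmc assms that] measure_nonneg by metis
  have one: "(\<Sum>P\<in>partitions n. ?p P) = 1"
    using ctmc_prob_set[OF ctmc assms, of UNIV] prob_space by simp
  have "1 - cover_prob \<beta> (n - 1) t = (\<Sum>P\<in>partitions n. ?p P * (1 - of_bool ({1} \<in> P)))"
    using one transition_singleton[OF beta_gt u, of t]
    by (simp add: sum_subtractf right_diff_distrib)
  also have "\<dots> \<le> (\<Sum>P\<in>partitions n. ?p P * (\<Sum>v\<in>{1..n} - {1}. together {1, v} P))"
    using p not_singleton_le_together[OF _ u] by (intro sum_mono mult_left_mono) auto
  also have "\<dots> = (\<Sum>v\<in>{1..n} - {1}. \<Sum>P\<in>partitions n. ?p P * together {1, v} P)"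
    by (subst sum.swap) (simp add: sum_distrib_left)
  also have "\<dots> = (\<Sum>v\<in>{1..n} - {1}. exp (- phi \<beta> 1 * t))"
    using n_ge_1 by (intro sum.cong refl, subst transition_together[OF beta_gt, where u = 1]) auto
  also have "\<dots> = real (n - 1) * exp (- phi \<beta> 1 * t)" using n_ge_1 by simp
  finally show ?thesis .
qed

abbreviation "D \<equiv> leaf_height X U"

text \<open>Right-continuity holds on every path, so the infimum can be tested at rational times, which gives
  measurability.\<close>
lemma D_lt_iff:
  assumes "\<omega> \<in> space M" "\<exists>t\<ge>0. \<omega> \<in> isolated t"
  shows "D \<omega> < a \<longleftrightarrow> (\<exists>r\<in>\<rat> \<inter> {0..<a}. \<omega> \<in> isolated r)"
proof -
  let ?T = "{t. 0 \<le> t \<and> {U \<omega>} \<in> X t \<omega>}"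
  have T: "?T \<noteq> {}" "bdd_below ?T" using assms by (auto simp: isolated_def intro: bdd_belowI[of _ 0])
  have "D \<omega> < a \<longleftrightarrow> (\<exists>t\<in>?T. t < a)"
    unfolding leaf_height_def using T by (rule cInf_less_iff)
  also have "\<dots> \<longleftrightarrow> (\<exists>r\<in>\<rat> \<inter> {0..<a}. \<omega> \<in> isolated r)"
  proof
    assume "\<exists>t\<in>?T. t < a"
    then obtain t where t: "0 \<le> t" "{U \<omega>} \<in> X t \<omega>" "t < a" by auto
    have "\<forall>\<^sub>F s in at_right t. X s \<omega> = X t \<omega>"
      by (rule ctmc_right_continuous[OF ctmc assms(1) t(1)])
    then obtain b where b: "b > t" "\<And>s. t < s \<Longrightarrow> s < b \<Longrightarrow> X s \<omega> = X t \<omega>"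
      unfolding eventually_at_right_field by metis
    obtain r where r: "r \<in> \<rat>" "t < r" "r < min a b"
      using Rats_dense_in_real[of t "min a b"] t b by auto
    with t b assms(1) show "\<exists>r\<in>\<rat> \<inter> {0..<a}. \<omega> \<in> isolated r"
      by (intro bexI[of _ r]) (auto simp: isolated_def)
  qed (auto simp: isolated_def)
  finally show ?thesis .
qed

lemma ex_isolated_rat:
  assumes "\<omega> \<in> space M" "\<exists>t\<ge>0. \<omega> \<in> isolated t"
  shows "\<exists>r\<in>\<rat> \<inter> {0..}. \<omega> \<in> isolated r"
  using D_lt_iff[OF assms, of "D \<omega> + 1"] by auto

text \<open>On the null set of paths on which the label is never alone, the height is the infimum of the empty set,
  some fixed real number; that set has to be treated separately.\<close>
lemma D_measurable [measurable]: "D \<in> borel_measurable M"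
proof (rule borel_measurableI_less)
  fix a
  let ?N = "{\<omega> \<in> space M. \<forall>r\<in>\<rat> \<inter> {0..}. \<omega> \<notin> isolated r}"
  have N: "D \<omega> = Inf {}" if "\<omega> \<in> ?N" for \<omega>
  proof -
    have "{t. 0 \<le> t \<and> {U \<omega>} \<in> X t \<omega>} = {}"
      using ex_isolated_rat[of \<omega>] that by (auto simp: isolated_def)
    then show ?thesis by (simp only: leaf_height_def)
  qed
  have "{\<omega> \<in> space M. D \<omega> < a} = (if Inf {} < a then ?N else {}) \<union> (\<Union>r\<in>\<rat> \<inter> {0..<a}. isolated r)"
  proof (intro set_eqI iffI)
    fix \<omega> assume "\<omega> \<in> {\<omega> \<in> space M. D \<omega> < a}"
    then show "\<omega> \<in> (if Inf {} < a then ?N else {}) \<union> (\<Union>r\<in>\<rat> \<inter> {0..<a}. isolated r)"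
      using N[of \<omega>] D_lt_iff[of \<omega> a] by (cases "\<omega> \<in> ?N") auto
  next
    fix \<omega> assume "\<omega> \<in> (if Inf {} < a then ?N else {}) \<union> (\<Union>r\<in>\<rat> \<inter> {0..<a}. isolated r)"
    then consider "\<omega> \<in> ?N" "Inf {} < a" | r where "r \<in> \<rat> \<inter> {0..<a}" "\<omega> \<in> isolated r"
      by (auto split: if_splits)
    then show "\<omega> \<in> {\<omega> \<in> space M. D \<omega> < a}"
    proof cases
      case 1 then show ?thesis using N by simp
    next
      case 2
      then have "\<omega> \<in> space M" by (simp add: isolated_def)
      moreover have "\<exists>t\<ge>0. \<omega> \<in> isolated t" using 2 by auto
      ultimately show ?thesis using 2 D_lt_iff[of \<omega> a] by auto
    qed
  qed
  moreover have "?N \<in> events"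
  proof -
    have "?N = space M - (\<Union>r\<in>\<rat> \<inter> {0..}. isolated r)" by auto
    moreover have "(\<Union>r\<in>\<rat> \<inter> {0..}. isolated r) \<in> events"
      using countable_rat isolated_sets by (intro sets.countable_UN') auto
    ultimately show ?thesis by auto
  qed
  moreover have "(\<Union>r\<in>\<rat> \<inter> {0..<a}. isolated r) \<in> events"
    using countable_rat isolated_sets by (intro sets.countable_UN') auto
  ultimately show "{\<omega> \<in> space M. D \<omega> < a} \<in> events" by auto
qed

lemma AE_isolated: "AE \<omega> in M. \<exists>t\<ge>0. \<omega> \<in> isolated t"
proof -
  have lim: "(\<lambda>k. real (n - 1) * exp (- phi \<beta> 1 * real k)) \<longlonglongrightarrow> 0"
    using phi_pos[OF beta_gt, of 1] by real_asymp
  let ?E = "\<Union>k. isolated (real k)"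
  have E: "?E \<in> events" by auto
  have "1 - prob ?E \<le> real (n - 1) * exp (- phi \<beta> 1 * real k)" for k
  proof -
    have "prob (isolated (real k)) \<le> prob ?E" using E by (intro finite_measure_mono) auto
    then show ?thesis using cover_prob_tail[of "real k"] prob_isolated[of "real k"] by simp
  qed
  then have "1 - prob ?E \<le> 0" by (intro LIMSEQ_le_const[OF lim]) auto
  then have "prob ?E = 1" using prob_le_1[of ?E] by linarith
  then have "AE \<omega> in M. \<omega> \<in> ?E" using prob_eq_1[OF E] by simp
  then show ?thesis by eventually_elim (metis UN_E of_nat_0_le_iff)
qed

lemma D_nonneg_AE: "AE \<omega> in M. D \<omega> \<ge> 0"
  using AE_isolated
proof (rule AE_mp, intro AE_I2 impI)
  fix \<omega> assume "\<exists>t\<ge>0. \<omega> \<in> isolated t"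
  then show "D \<omega> \<ge> 0" unfolding leaf_height_def by (intro cInf_greatest) (auto simp: isolated_def)
qed

text \<open>If the label is alone at time \<open>t\<close>, then \<open>D \<le> t\<close> on every path. Conversely \<open>D \<le> t\<close> makes the label
  alone at some rational time before \<open>t + e\<close>, hence almost surely at time \<open>t + e\<close>; then \<open>e\<close> tends to
  \<open>0\<close>, where the formula for the probability is continuous.\<close>
lemma prob_D_le:
  assumes "t \<ge> 0"
  shows "prob {\<omega> \<in> space M. D \<omega> \<le> t} = cover_prob \<beta> (n - 1) t"
proof (rule antisym)
  have "isolated t \<subseteq> {\<omega> \<in> space M. D \<omega> \<le> t}"
    using assms by (auto simp: isolated_def leaf_height_def intro!: cInf_lower bdd_belowI[of _ 0])
  then show "cover_prob \<beta> (n - 1) t \<le> prob {\<omega> \<in> space M. D \<omega> \<le> t}"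
    unfolding prob_isolated[OF assms, symmetric] by (intro finite_measure_mono) auto
next
  have le: "prob {\<omega> \<in> space M. D \<omega> \<le> t} \<le> cover_prob \<beta> (n - 1) (t + e)" if e: "e > 0" for e
  proof -
    have "AE \<omega> in M. \<forall>r\<in>\<rat> \<inter> {0..<t + e}. \<omega> \<in> isolated r \<longrightarrow> \<omega> \<in> isolated (t + e)"
      using countable_rat by (intro AE_ball_countable[THEN iffD2] ballI isolated_mono_AE) auto
    with AE_isolated AE_space have "AE \<omega> in M. \<omega> \<in> {\<omega> \<in> space M. D \<omega> \<le> t} \<longrightarrow> \<omega> \<in> isolated (t + e)"
    proof eventually_elim
      fix \<omega> assume \<omega>: "\<exists>t\<ge>0. \<omega> \<in> isolated t" "\<omega> \<in> space M"
        and mono: "\<forall>r\<in>\<rat> \<inter> {0..<t + e}. \<omega> \<in> isolated r \<longrightarrow> \<omega> \<in> isolated (t + e)"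
      show "\<omega> \<in> {\<omega> \<in> space M. D \<omega> \<le> t} \<longrightarrow> \<omega> \<in> isolated (t + e)"
      proof
        assume "\<omega> \<in> {\<omega> \<in> space M. D \<omega> \<le> t}"
        then have "D \<omega> < t + e" using e by simp
        then show "\<omega> \<in> isolated (t + e)" using D_lt_iff[OF \<omega>(2,1)] mono by auto
      qed
    qed
    then have "prob {\<omega> \<in> space M. D \<omega> \<le> t} \<le> prob (isolated (t + e))"
      using assms e by (intro finite_measure_mono_AE) auto
    then show ?thesis using prob_isolated[of "t + e"] assms e by simp
  qed
  have "((\<lambda>e. cover_prob \<beta> (n - 1) (t + e)) \<longlongrightarrow> cover_prob \<beta> (n - 1) (t + 0)) (at_right 0)"
    unfolding cover_prob_def by (intro tendsto_intros)
  then show "prob {\<omega> \<in> space M. D \<omega> \<le> t} \<le> cover_prob \<beta> (n - 1) t"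
    using le by (intro tendsto_lowerbound[where F = "at_right 0"])
       (auto simp: eventually_at_filter)
qed

end

section \<open>A random walk that approximates the subordinator\<close>

text \<open>The points \<open>s\<close> at distance more than \<open>C * h\<close> from \<open>1\<close>, where \<open>C = Beta (\<beta> + 2) (\<beta> + 2)\<close> is the
  integral of \<open>1 - s\<close> against the splitting measure. By Markov's inequality for \<open>1 - s\<close> their mass is at
  most \<open>1 / h\<close>.\<close>
definition cutoff :: "real \<Rightarrow> real \<Rightarrow> real set" where
  "cutoff \<beta> h = {..<1 - Beta (\<beta> + 2) (\<beta> + 2) * h}"

lemma cutoff_sets [measurable]: "cutoff \<beta> h \<in> sets borel"
  by (simp add: cutoff_def)

lemma Beta_cutoff_pos: "\<beta> > -2 \<Longrightarrow> Beta (\<beta> + 2) (\<beta> + 2 :: real) > 0"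
  by (simp add: Beta_def Gamma_real_pos)

lemma
  assumes "\<beta> > -2" "h > 0"
  shows integrable_cutoff: "integrable (dislocation \<beta>) (indicator (cutoff \<beta> h) :: real \<Rightarrow> real)"
    and cutoff_mass_le: "h * (\<integral>s. indicator (cutoff \<beta> h) s \<partial>dislocation \<beta>) \<le> 1"
proof -
  let ?C = "Beta (\<beta> + 2) (\<beta> + 2)"
  note C = Beta_cutoff_pos[OF assms(1)]
  let ?f = "\<lambda>s. 1 / (?C * h) * (s powr 0 * (1 - s) powr 1)"
  have int: "integrable (dislocation \<beta>) ?f"
    using assms by (intro integrable_mult_right integrable_dislocation_powr) auto
  have le: "AE s in dislocation \<beta>. indicator (cutoff \<beta> h) s \<le> ?f s"
    using AE_dislocation
  proof eventually_elim
    fix s :: real assume "0 < s \<and> s < 1"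
    then show "indicator (cutoff \<beta> h) s \<le> ?f s"
      using C assms by (auto simp: indicator_def cutoff_def field_simps)
  qed
  show i: "integrable (dislocation \<beta>) (indicator (cutoff \<beta> h) :: real \<Rightarrow> real)"
  proof (rule Bochner_Integration.integrable_bound[OF int])
    show "AE s in dislocation \<beta>. norm (indicator (cutoff \<beta> h) s :: real) \<le> norm (?f s)"
      using le
    proof eventually_elim
      fix s assume "indicator (cutoff \<beta> h) s \<le> ?f s"
      also have "\<dots> \<le> norm (?f s)" by (simp only: real_norm_def abs_ge_self)
      finally show "norm (indicator (cutoff \<beta> h) s :: real) \<le> norm (?f s)" by simp
    qed
  qed simp
  have "(\<integral>s. indicator (cutoff \<beta> h) s \<partial>dislocation \<beta>) \<le> (\<integral>s. ?f s \<partial>dislocation \<beta>)"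
    by (rule integral_mono_AE[OF i int le])
  also have "\<dots> = 1 / (?C * h) * Beta (0 + \<beta> + 2) (1 + \<beta> + 1)"
    using assms(1) by (subst integral_mult_right_zero, subst integral_dislocation_powr) auto
  also have "\<dots> = 1 / h" using C by (simp add: add.commute)
  finally show "h * (\<integral>s. indicator (cutoff \<beta> h) s \<partial>dislocation \<beta>) \<le> 1"
    using assms by (simp add: field_simps)
qed

text \<open>\<open>h\<close> times the truncated splitting measure on \<open>(0, 1)\<close>. The missing mass, which stands for no move, is
  spread over the interval \<open>[1, 2]\<close>, where \<open>jump\<close> vanishes: in this way the law of a step is a
  density although the law of the move has an atom at \<open>0\<close>.\<close>
definition step_density :: "real \<Rightarrow> real \<Rightarrow> real \<Rightarrow> real" where
  "step_density \<beta> h s =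
     h * (indicator {0<..<1} s * (s powr (\<beta> + 1) * (1 - s) powr \<beta>) * indicator (cutoff \<beta> h) s)
   + (1 - h * (\<integral>s. indicator (cutoff \<beta> h) s \<partial>dislocation \<beta>)) * indicator {1..2} s"

definition step :: "real \<Rightarrow> real \<Rightarrow> real measure" where
  "step \<beta> h = density lborel (\<lambda>s. ennreal (step_density \<beta> h s))"

definition jump :: "real \<Rightarrow> real" where
  "jump s = (if 0 < s \<and> s < 1 then - ln s else 0)"

lemma jump_measurable [measurable]: "jump \<in> borel_measurable borel"
  unfolding jump_def by measurable

lemma jump_nonneg: "jump s \<ge> 0"
  by (simp add: jump_def)

lemma sets_step [simp, measurable_cong]: "sets (step \<beta> h) = sets borel"
  by (simp add: step_def)

lemma step_density_measurable [measurable]: "step_density \<beta> h \<in> borel_measurable borel"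
  unfolding step_density_def by measurable

lemma step_density_nonneg:
  assumes "\<beta> > -2" "h > 0"
  shows "step_density \<beta> h s \<ge> 0"
  using assms cutoff_mass_le[OF assms] unfolding step_density_def by (intro add_nonneg_nonneg mult_nonneg_nonneg) auto

text \<open>Functions that vanish off \<open>(0, 1)\<close> do not see the mass on \<open>[1, 2]\<close>.\<close>
lemma
  fixes f :: "real \<Rightarrow> real"
  assumes "\<beta> > -2" "h > 0" "integrable (dislocation \<beta>) f"
    and [measurable]: "f \<in> borel_measurable borel" and 0: "\<And>s. \<not> (0 < s \<and> s < 1) \<Longrightarrow> f s = 0"
  shows integrable_step: "integrable (step \<beta> h) f"
    and integral_step: "(\<integral>s. f s \<partial>step \<beta> h) = h * (\<integral>s. indicator (cutoff \<beta> h) s * f s \<partial>dislocation \<beta>)"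
proof -
  let ?w = "\<lambda>s. s powr (\<beta> + 1) * (1 - s) powr \<beta>"
  have eq: "step_density \<beta> h s * f s
      = h * (indicator {0<..<1} s * (indicator (cutoff \<beta> h) s * f s * ?w s))" for s
    using 0[of s] by (cases "0 < s \<and> s < 1") (auto simp: step_density_def)
  have nn: "AE s in lborel. 0 \<le> step_density \<beta> h s" using step_density_nonneg[OF assms(1,2)] by simp
  have int: "integrable (dislocation \<beta>) (\<lambda>s. indicator (cutoff \<beta> h) s * f s)"
    by (rule Bochner_Integration.integrable_bound[OF assms(3)]) (auto simp: indicator_def)
  have m: "(\<lambda>s. indicator (cutoff \<beta> h) s * f s) \<in> borel_measurable borel" by measurable
  show "integrable (step \<beta> h) f"
    unfolding step_def using int m
    by (subst integrable_density[OF _ _ nn]) (auto simp: eq integrable_dislocation_iff set_integrable_def)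
  show "(\<integral>s. f s \<partial>step \<beta> h) = h * (\<integral>s. indicator (cutoff \<beta> h) s * f s \<partial>dislocation \<beta>)"
    unfolding step_def using m
    by (subst integral_density[OF _ _ nn]) (simp_all add: eq integral_dislocation set_lebesgue_integral_def)
qed

lemma prob_space_step:
  assumes "\<beta> > -2" "h > 0"
  shows "prob_space (step \<beta> h)"
proof (rule prob_spaceI)
  let ?w = "\<lambda>s. s powr (\<beta> + 1) * (1 - s) powr \<beta>"
  let ?g = "\<lambda>s. indicator {0<..<1} s * ?w s * indicator (cutoff \<beta> h) s"
  let ?l = "\<integral>s. indicator (cutoff \<beta> h) s \<partial>dislocation \<beta>"
  have i1: "integrable lborel ?g"
    using integrable_cutoff[OF assms] by (simp add: integrable_dislocation_iff set_integrable_def mult_ac)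
  have g: "(\<integral>s. ?g s \<partial>lborel) = ?l"
    using integral_dislocation[of "indicator (cutoff \<beta> h)" \<beta>]
    by (simp add: set_lebesgue_integral_def mult_ac)
  have i2: "integrable lborel (indicator {1..2::real} :: real \<Rightarrow> real)"
    by (auto intro!: integrable_real_indicator)
  have "emeasure (step \<beta> h) (space (step \<beta> h)) = (\<integral>\<^sup>+s. ennreal (step_density \<beta> h s) \<partial>lborel)"
    unfolding step_def by (subst emeasure_density) auto
  also have "\<dots> = ennreal (\<integral>s. step_density \<beta> h s \<partial>lborel)"
    using i1 i2 step_density_nonneg[OF assms]
    by (intro nn_integral_eq_integral) (auto simp: step_density_def[abs_def])
  also have "(\<integral>s. step_density \<beta> h s \<partial>lborel) = h * ?l + (1 - h * ?l) * 1"
    unfolding step_density_def using i1 i2 g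
    by (subst Bochner_Integration.integral_add) auto
  finally show "emeasure (step \<beta> h) (space (step \<beta> h)) = 1" by simp
qed

definition walk :: "real \<Rightarrow> real \<Rightarrow> nat \<Rightarrow> real measure" where
  "walk \<beta> h K = distr (PiM {..<K} (\<lambda>_. step \<beta> h)) borel (\<lambda>x. \<Sum>i<K. jump (x i))"

lemma walk_sum_measurable [measurable]:
  "(\<lambda>x. \<Sum>i<K. jump (x i)) \<in> borel_measurable (PiM {..<K} (\<lambda>_. step \<beta> h))"
proof (rule borel_measurable_sum)
  fix i assume "i \<in> {..<K}"
  then have "(\<lambda>x. x i) \<in> measurable (PiM {..<K} (\<lambda>_. step \<beta> h)) borel"
    using measurable_component_singleton[of i "{..<K}" "\<lambda>_. step \<beta> h"] by simp
  then show "(\<lambda>x. jump (x i)) \<in> borel_measurable (PiM {..<K} (\<lambda>_. step \<beta> h))"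
    by (rule measurable_compose[OF _ jump_measurable])
qed

lemma prob_space_steps:
  assumes "\<beta> > -2" "h > 0"
  shows "prob_space (PiM {..<K} (\<lambda>_. step \<beta> h))"
  by (rule prob_space_PiM) (rule prob_space_step[OF assms])

lemma real_distribution_walk:
  assumes "\<beta> > -2" "h > 0"
  shows "real_distribution (walk \<beta> h K)"
  unfolding walk_def
  by (rule prob_space.real_distribution_distr[OF prob_space_steps[OF assms]]) simp

lemma AE_walk_nonneg: "AE y in walk \<beta> h K. 0 \<le> y"
  unfolding walk_def
  by (subst AE_distr_iff) (auto intro!: sum_nonneg jump_nonneg)

text \<open>Used for real exponentials and for characters, the two kinds of functions \<open>g\<close> that turn the endpoint into
  a product over the steps.\<close>
lemma integral_walk_prod:
  fixes g :: "real \<Rightarrow> 'b::{real_normed_field, banach, second_countable_topology}"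
  assumes "\<beta> > -2" "h > 0" and [measurable]: "g \<in> borel_measurable borel"
    and int: "integrable (step \<beta> h) (\<lambda>s. g (jump s))"
    and mult: "\<And>(K::nat) x. g (\<Sum>i<K. x i) = (\<Prod>i<K. g (x i))"
  shows "(\<integral>y. g y \<partial>walk \<beta> h K) = (\<integral>s. g (jump s) \<partial>step \<beta> h) ^ K"
proof -
  interpret prob_space "step \<beta> h" by (rule prob_space_step[OF assms(1,2)])
  interpret product_sigma_finite "\<lambda>_::nat. step \<beta> h" ..
  have "(\<integral>y. g y \<partial>walk \<beta> h K) = (\<integral>x. g (\<Sum>i<K. jump (x i)) \<partial>PiM {..<K} (\<lambda>_. step \<beta> h))"
    unfolding walk_def by (rule integral_distr) auto
  also have "\<dots> = (\<integral>x. (\<Prod>i\<in>{..<K}. g (jump (x i))) \<partial>PiM {..<K} (\<lambda>_. step \<beta> h))"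
    by (simp only: mult)
  also have "\<dots> = (\<Prod>i<K. \<integral>s. g (jump s) \<partial>step \<beta> h)"
    by (rule product_integral_prod) (auto intro: int)
  finally show ?thesis by simp
qed

definition trunc_integral :: "real \<Rightarrow> real \<Rightarrow> (real \<Rightarrow> real) \<Rightarrow> real" where
  "trunc_integral \<beta> h f = (\<integral>s. indicator (cutoff \<beta> h) s * f s \<partial>dislocation \<beta>)"

lemma trunc_integral_tendsto:
  fixes f :: "real \<Rightarrow> real"
  assumes "\<beta> > -2" "integrable (dislocation \<beta>) f" and [measurable]: "f \<in> borel_measurable borel"
    and h: "h \<longlonglongrightarrow> 0"
  shows "(\<lambda>K. trunc_integral \<beta> (h K) f) \<longlonglongrightarrow> (\<integral>s. f s \<partial>dislocation \<beta>)"
  unfolding trunc_integral_def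
proof (rule integral_dominated_convergence)
  show "integrable (dislocation \<beta>) (\<lambda>s. \<bar>f s\<bar>)" using assms by simp
  show "AE s in dislocation \<beta>. norm (indicator (cutoff \<beta> (h K)) s * f s) \<le> \<bar>f s\<bar>" for K
    by (auto simp: indicator_def)
  show "AE s in dislocation \<beta>. (\<lambda>K. indicator (cutoff \<beta> (h K)) s * f s) \<longlonglongrightarrow> f s"
    using AE_dislocation
  proof eventually_elim
    fix s :: real assume s: "0 < s \<and> s < 1"
    have "(\<lambda>K. 1 - Beta (\<beta> + 2) (\<beta> + 2) * h K) \<longlonglongrightarrow> 1 - Beta (\<beta> + 2) (\<beta> + 2) * 0"
      by (intro tendsto_intros h)
    then have "\<forall>\<^sub>F K in sequentially. s < 1 - Beta (\<beta> + 2) (\<beta> + 2) * h K"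
      using s by (intro order_tendstoD(1)) auto
    then have "\<forall>\<^sub>F K in sequentially. indicator (cutoff \<beta> (h K)) s * f s = f s"
      by eventually_elim (auto simp: cutoff_def)
    then show "(\<lambda>K. indicator (cutoff \<beta> (h K)) s * f s) \<longlonglongrightarrow> f s"
      by (rule tendsto_eventually)
  qed
qed (use assms in auto)

lemma trunc_integral_cong:
  assumes "\<And>s. 0 < s \<Longrightarrow> s < 1 \<Longrightarrow> f s = g s" and [measurable]: "f \<in> borel_measurable borel" "g \<in> borel_measurable borel"
  shows "trunc_integral \<beta> h f = trunc_integral \<beta> h g"
  unfolding trunc_integral_def
proof (rule integral_cong_AE)
  show "AE s in dislocation \<beta>. indicator (cutoff \<beta> h) s * f s = indicator (cutoff \<beta> h) s * g s"
    using AE_dislocation by eventually_elim (simp add: assms(1))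
qed auto

lemma integral_dislocation_cong:
  fixes f g :: "real \<Rightarrow> real"
  assumes "\<And>s. 0 < s \<Longrightarrow> s < 1 \<Longrightarrow> f s = g s" and [measurable]: "f \<in> borel_measurable borel" "g \<in> borel_measurable borel"
  shows "integral\<^sup>L (dislocation \<beta>) f = integral\<^sup>L (dislocation \<beta>) g"
    and "integrable (dislocation \<beta>) f \<longleftrightarrow> integrable (dislocation \<beta>) g"
proof -
  have ae: "AE s in dislocation \<beta>. f s = g s"
    using AE_dislocation by eventually_elim (simp add: assms(1))
  show "integral\<^sup>L (dislocation \<beta>) f = integral\<^sup>L (dislocation \<beta>) g"
    by (rule integral_cong_AE[OF _ _ ae]) auto
  show "integrable (dislocation \<beta>) f \<longleftrightarrow> integrable (dislocation \<beta>) g"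
    by (rule integrable_cong_AE[OF _ _ ae]) auto
qed

lemma
  assumes "\<beta> > -2" "h > 0"
  shows integrable_step_exp: "integrable (step \<beta> h) (\<lambda>s. exp (- real k * jump s))"
    and integral_step_exp:
      "(\<integral>s. exp (- real k * jump s) \<partial>step \<beta> h) = 1 - h * trunc_integral \<beta> h (\<lambda>s. 1 - s powr real k)"
proof -
  interpret prob_space "step \<beta> h" by (rule prob_space_step[OF assms])
  have eq: "1 - exp (- real k * jump s) = 1 - s powr real k" if "0 < s" "s < 1" for s
    using that by (simp add: jump_def powr_def)
  have m: "(\<lambda>s. 1 - exp (- real k * jump s)) \<in> borel_measurable borel"
    "(\<lambda>s. 1 - s powr real k) \<in> borel_measurable borel" by measurable
  have i: "integrable (dislocation \<beta>) (\<lambda>s. 1 - exp (- real k * jump s))"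
    using integral_dislocation_cong(2)[OF eq m, of \<beta>] integrable_one_minus_powr[OF assms(1)] by simp
  have z: "1 - exp (- real k * jump s) = 0" if "\<not> (0 < s \<and> s < 1)" for s
    using that by (auto simp: jump_def)
  note st = integrable_step[OF assms i m(1) z] integral_step[OF assms i m(1) z]
  show e: "integrable (step \<beta> h) (\<lambda>s. exp (- real k * jump s))"
    using Bochner_Integration.integrable_diff[OF integrable_const[of "1::real"] st(1)] by simp
  have "(\<integral>s. 1 - exp (- real k * jump s) \<partial>step \<beta> h) = h * trunc_integral \<beta> h (\<lambda>s. 1 - exp (- real k * jump s))"
    unfolding trunc_integral_def by (rule st(2))
  also have "\<dots> = h * trunc_integral \<beta> h (\<lambda>s. 1 - s powr real k)"
    by (simp only: trunc_integral_cong[OF eq m, of \<beta> h])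
  finally have "(\<integral>s. 1 - exp (- real k * jump s) \<partial>step \<beta> h) = h * trunc_integral \<beta> h (\<lambda>s. 1 - s powr real k)" .
  then show "(\<integral>s. exp (- real k * jump s) \<partial>step \<beta> h) = 1 - h * trunc_integral \<beta> h (\<lambda>s. 1 - s powr real k)"
    using e by (simp add: prob_space)
qed

lemma
  assumes "\<beta> > -2" "h > 0" "j \<ge> 1"
  shows integrable_step_power: "integrable (step \<beta> h) (\<lambda>s. jump s ^ j)"
    and integral_step_power: "(\<integral>s. jump s ^ j \<partial>step \<beta> h) = h * trunc_integral \<beta> h (\<lambda>s. (- ln s) ^ j)"
proof -
  have eq: "jump s ^ j = (- ln s) ^ j" if "0 < s" "s < 1" for s
    using that by (simp add: jump_def)
  have m: "(\<lambda>s. jump s ^ j) \<in> borel_measurable borel"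
    "(\<lambda>s::real. (- ln s) ^ j) \<in> borel_measurable borel" by measurable
  have "integrable (dislocation \<beta>) (\<lambda>s. (- 1) ^ j * ln s ^ j)"
    using integrable_dislocation_ln_power[OF assms(1,3)] by (rule integrable_mult_right)
  then have "integrable (dislocation \<beta>) (\<lambda>s. (- ln s) ^ j)"
    by (simp add: power_mult_distrib[symmetric])
  then have i: "integrable (dislocation \<beta>) (\<lambda>s. jump s ^ j)"
    using integral_dislocation_cong(2)[OF eq m, of \<beta>] by simp
  have z: "jump s ^ j = 0" if "\<not> (0 < s \<and> s < 1)" for s
    using that assms(3) by (auto simp: jump_def)
  show "integrable (step \<beta> h) (\<lambda>s. jump s ^ j)" by (rule integrable_step[OF assms(1,2) i m(1) z])
  show "(\<integral>s. jump s ^ j \<partial>step \<beta> h) = h * trunc_integral \<beta> h (\<lambda>s. (- ln s) ^ j)"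
  proof -
    have "(\<integral>s. jump s ^ j \<partial>step \<beta> h) = h * trunc_integral \<beta> h (\<lambda>s. jump s ^ j)"
      unfolding trunc_integral_def by (rule integral_step[OF assms(1,2) i m(1) z])
    also have "trunc_integral \<beta> h (\<lambda>s. jump s ^ j) = trunc_integral \<beta> h (\<lambda>s. (- ln s) ^ j)"
      by (rule trunc_integral_cong[OF eq m])
    finally show ?thesis .
  qed
qed

lemma integral_walk_exp:
  assumes "\<beta> > -2" "h > 0"
  shows "(\<integral>y. exp (- real k * y) \<partial>walk \<beta> h K) = (1 - h * trunc_integral \<beta> h (\<lambda>s. 1 - s powr real k)) ^ K"
  unfolding integral_step_exp[OF assms, symmetric]
  by (rule integral_walk_prod[OF assms _ integrable_step_exp[OF assms]])
     (auto simp: sum_distrib_left exp_sum simp flip: sum_negf)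

lemma integrable_walk_exp:
  assumes "\<beta> > -2" "h > 0"
  shows "integrable (walk \<beta> h K) (\<lambda>y. exp (- real k * y))"
proof -
  interpret real_distribution "walk \<beta> h K" by (rule real_distribution_walk[OF assms])
  show ?thesis
    by (rule integrable_const_bound[where B = 1]) (use AE_walk_nonneg[of \<beta> h K] in \<open>auto elim!: eventually_mono\<close>)
qed

text \<open>The probability that the walk ends above \<open>N\<close> independent standard exponential variables.\<close>
definition walk_cover_prob :: "real \<Rightarrow> real \<Rightarrow> nat \<Rightarrow> nat \<Rightarrow> real" where
  "walk_cover_prob \<beta> h K N = (\<integral>y. (1 - exp (- y)) ^ N \<partial>walk \<beta> h K)"

lemma one_minus_exp_power:
  "(1 - exp (- y)) ^ N = (\<Sum>k\<le>N. real (N choose k) * ((- 1) ^ k * exp (- real k * y)))" for y :: real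
proof -
  have "(1 - exp (- y)) ^ N = (- exp (- y) + 1) ^ N" by simp
  also have "\<dots> = (\<Sum>k\<le>N. real (N choose k) * (- exp (- y)) ^ k * 1 ^ (N - k))"
    by (rule binomial_ring)
  also have "\<dots> = (\<Sum>k\<le>N. real (N choose k) * ((- 1) ^ k * exp (- real k * y)))"
  proof (intro sum.cong refl)
    fix k
    have "(- exp (- y)) ^ k = (- 1) ^ k * exp (- y) ^ k" by (rule power_minus)
    also have "exp (- y) ^ k = exp (- real k * y)" by (simp add: exp_of_nat_mult[symmetric])
    finally show "real (N choose k) * (- exp (- y)) ^ k * 1 ^ (N - k)
        = real (N choose k) * ((- 1) ^ k * exp (- real k * y))" by simp
  qed
  finally show ?thesis .
qed

lemma walk_cover_prob_eq:
  assumes "\<beta> > -2" "h > 0"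
  shows "walk_cover_prob \<beta> h K N = (\<Sum>k\<le>N. real (N choose k) *
            ((- 1) ^ k * (1 - h * trunc_integral \<beta> h (\<lambda>s. 1 - s powr real k)) ^ K))"
proof -
  have "walk_cover_prob \<beta> h K N
      = (\<Sum>k\<le>N. \<integral>y. real (N choose k) * ((- 1) ^ k * exp (- real k * y)) \<partial>walk \<beta> h K)"
    unfolding walk_cover_prob_def one_minus_exp_power
    by (rule Bochner_Integration.integral_sum) (intro integrable_mult_right integrable_walk_exp[OF assms])
  then show ?thesis by (simp only: integral_mult_right_zero integral_walk_exp[OF assms])
qed

text \<open>The limit \<open>(1 - c / K) ^ K \<rightarrow> exp (- c)\<close> with a varying numerator. Both bases have absolute value at most
  one, so the powers differ by at most \<open>K\<close> times the difference of the bases.\<close>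
lemma power_exp_limit:
  fixes a :: "nat \<Rightarrow> real"
  assumes a: "a \<longlonglongrightarrow> c" and le: "\<forall>\<^sub>F K in sequentially. \<bar>1 - a K / real K\<bar> \<le> 1" and c: "c \<ge> 0"
  shows "(\<lambda>K. (1 - a K / real K) ^ K) \<longlonglongrightarrow> exp (- c)"
proof -
  have lim: "(\<lambda>K. \<bar>a K - c\<bar> + \<bar>real K * (exp (- c / real K) - 1 + c / real K)\<bar>) \<longlonglongrightarrow> \<bar>c - c\<bar> + 0"
  proof (intro tendsto_intros a)
    show "(\<lambda>K. \<bar>real K * (exp (- c / real K) - 1 + c / real K)\<bar>) \<longlonglongrightarrow> 0"
      by (rule tendsto_rabs_zero) real_asymp
  qed
  have "(\<lambda>K. (1 - a K / real K) ^ K - exp (- c / real K) ^ K) \<longlonglongrightarrow> 0"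
  proof (rule Lim_null_comparison)
    show "\<forall>\<^sub>F K in sequentially. norm ((1 - a K / real K) ^ K - exp (- c / real K) ^ K)
        \<le> \<bar>a K - c\<bar> + \<bar>real K * (exp (- c / real K) - 1 + c / real K)\<bar>"
      using le eventually_gt_at_top[of 0]
    proof eventually_elim
      fix K :: nat assume K: "\<bar>1 - a K / real K\<bar> \<le> 1" "K > 0"
      have "norm ((1 - a K / real K) ^ K - exp (- c / real K) ^ K)
          \<le> real K * norm ((1 - a K / real K) - exp (- c / real K))"
        using K c by (intro norm_power_diff) auto
      also have "\<dots> = \<bar>(c - a K) - real K * (exp (- c / real K) - 1 + c / real K)\<bar>"
      proof -
        have "real K * ((1 - a K / real K) - exp (- c / real K))
            = (c - a K) - real K * (exp (- c / real K) - 1 + c / real K)"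
          using K by (simp add: right_diff_distrib distrib_left)
        then show ?thesis by (metis abs_mult abs_of_nat real_norm_def)
      qed
      also have "\<dots> \<le> \<bar>a K - c\<bar> + \<bar>real K * (exp (- c / real K) - 1 + c / real K)\<bar>"
        by (metis abs_minus_commute abs_triangle_ineq4)
      finally show "norm ((1 - a K / real K) ^ K - exp (- c / real K) ^ K)
        \<le> \<bar>a K - c\<bar> + \<bar>real K * (exp (- c / real K) - 1 + c / real K)\<bar>" .
    qed
    show "(\<lambda>K. \<bar>a K - c\<bar> + \<bar>real K * (exp (- c / real K) - 1 + c / real K)\<bar>) \<longlonglongrightarrow> 0"
      using lim by simp
  qed
  moreover have "\<forall>\<^sub>F K in sequentially. exp (- c / real K) ^ K = exp (- c)"
    using eventually_gt_at_top[of 0] by eventually_elim (simp add: exp_of_nat_mult[symmetric])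
  then have "(\<lambda>K. exp (- c / real K) ^ K) \<longlonglongrightarrow> exp (- c)" by (rule tendsto_eventually)
  ultimately show ?thesis using tendsto_add by fastforce
qed

lemma walk_cover_prob_tendsto:
  assumes "\<beta> > -2" "t > 0"
  shows "(\<lambda>K. walk_cover_prob \<beta> (t / real K) K N) \<longlonglongrightarrow> cover_prob \<beta> N t"
proof -
  let ?tr = "\<lambda>k K. trunc_integral \<beta> (t / real K) (\<lambda>s. 1 - s powr real k)"
  have h0: "(\<lambda>K. t / real K) \<longlonglongrightarrow> 0" by real_asymp
  have "(\<lambda>K. (1 - t * ?tr k K / real K) ^ K) \<longlonglongrightarrow> exp (- (t * phi \<beta> (real k)))" for k
  proof (rule power_exp_limit)
    show "(\<lambda>K. t * ?tr k K) \<longlonglongrightarrow> t * phi \<beta> (real k)"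
      unfolding phi_eq_dislocation using integrable_one_minus_powr[OF assms(1)]
      by (intro tendsto_intros trunc_integral_tendsto[OF assms(1) _ _ h0]) auto
    show "0 \<le> t * phi \<beta> (real k)"
      using assms phi_pos[OF assms(1), of "real k"] phi_0[of \<beta>] by (cases "k = 0") auto
    show "\<forall>\<^sub>F K in sequentially. \<bar>1 - t * ?tr k K / real K\<bar> \<le> 1"
      using eventually_gt_at_top[of 0]
    proof eventually_elim
      fix K :: nat assume "K > 0"
      then have h: "t / real K > 0" using assms by simp
      interpret prob_space "step \<beta> (t / real K)" by (rule prob_space_step[OF assms(1) h])
      have "\<bar>\<integral>s. exp (- real k * jump s) \<partial>step \<beta> (t / real K)\<bar> \<le> (\<integral>s. 1 \<partial>step \<beta> (t / real K))"
        by (rule order.trans[OF integral_abs_bound], rule integral_mono)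
           (use integrable_step_exp[OF assms(1) h] in \<open>auto intro!: mult_nonneg_nonneg jump_nonneg\<close>)
      then show "\<bar>1 - t * ?tr k K / real K\<bar> \<le> 1"
        unfolding integral_step_exp[OF assms(1) h] by (simp add: prob_space)
    qed
  qed
  then have "(\<lambda>K. \<Sum>k\<le>N. real (N choose k) * ((- 1) ^ k * (1 - t * ?tr k K / real K) ^ K))
    \<longlonglongrightarrow> (\<Sum>k\<le>N. real (N choose k) * ((- 1) ^ k * exp (- (t * phi \<beta> (real k)))))"
    by (intro tendsto_intros)
  also have "(\<Sum>k\<le>N. real (N choose k) * ((- 1) ^ k * exp (- (t * phi \<beta> (real k))))) = cover_prob \<beta> N t"
    by (simp add: cover_prob_def mult.commute)
  finally show ?thesis
  proof (rule Lim_transform_eventually)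
    show "\<forall>\<^sub>F K in sequentially. (\<Sum>k\<le>N. real (N choose k) * ((- 1) ^ k * (1 - t * ?tr k K / real K) ^ K))
      = walk_cover_prob \<beta> (t / real K) K N"
      using eventually_gt_at_top[of 0]
      by eventually_elim (use assms in \<open>simp add: walk_cover_prob_eq\<close>)
  qed
qed

section \<open>The central limit theorem for the walk\<close>

lemma integrable_iexp_step:
  assumes "\<beta> > -2" "h > 0"
  shows "integrable (step \<beta> h) (\<lambda>s. iexp (x * jump s))"
proof -
  interpret prob_space "step \<beta> h" by (rule prob_space_step[OF assms])
  show ?thesis by (rule integrable_iexp) simp_all
qed

text \<open>The second order expansion of the characteristic function of one step. Its moments are \<open>h\<close> times the
  truncated logarithmic moments of the splitting measure, all of which are finite.\<close>
lemma step_char_approx: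
  assumes "\<beta> > -2" "h > 0"
  defines "T \<equiv> \<lambda>j. trunc_integral \<beta> h (\<lambda>s. (- ln s) ^ j)"
  shows "norm ((\<integral>s. iexp (x * jump s) \<partial>step \<beta> h)
      - (1 + \<i> * complex_of_real (x * (h * T 1)) - complex_of_real (x\<^sup>2 / 2 * (h * T 2))))
      \<le> \<bar>x\<bar> ^ 3 / 6 * (h * T 3)"
proof -
  interpret prob_space "step \<beta> h" by (rule prob_space_step[OF assms(1,2)])
  let ?f = "\<lambda>s. 1 + \<i> * complex_of_real (x * jump s ^ 1) - complex_of_real (x\<^sup>2 / 2 * jump s ^ 2)"
  have ip: "integrable (step \<beta> h) (\<lambda>s. jump s ^ j)" if "j \<ge> 1" for j
    by (rule integrable_step_power[OF assms(1,2) that])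
  have E: "(\<integral>s. jump s ^ j \<partial>step \<beta> h) = h * T j" if "j \<ge> 1" for j
    unfolding T_def by (rule integral_step_power[OF assms(1,2) that])
  have i1: "integrable (step \<beta> h) (\<lambda>s. complex_of_real (x * jump s ^ 1))"
    "integrable (step \<beta> h) (\<lambda>s. complex_of_real (x\<^sup>2 / 2 * jump s ^ 2))"
    by (intro integrable_of_real integrable_mult_right ip; simp)+
  have int_f: "integrable (step \<beta> h) ?f"
    by (intro Bochner_Integration.integrable_diff Bochner_Integration.integrable_add
        integrable_mult_right i1 integrable_const)
  have "(\<integral>s. ?f s \<partial>step \<beta> h) = (\<integral>s. 1 \<partial>step \<beta> h) + \<i> * (\<integral>s. complex_of_real (x * jump s ^ 1) \<partial>step \<beta> h)
      - (\<integral>s. complex_of_real (x\<^sup>2 / 2 * jump s ^ 2) \<partial>step \<beta> h)"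
    using i1 by (subst Bochner_Integration.integral_diff, simp, simp, subst Bochner_Integration.integral_add) simp_all
  also have "\<dots> = 1 + \<i> * complex_of_real (x * (h * T 1)) - complex_of_real (x\<^sup>2 / 2 * (h * T 2))"
    unfolding integral_complex_of_real integral_mult_right_zero using E[of 1] E[of 2] prob_space by simp
  finally have f: "(\<integral>s. ?f s \<partial>step \<beta> h)
      = 1 + \<i> * complex_of_real (x * (h * T 1)) - complex_of_real (x\<^sup>2 / 2 * (h * T 2))" .
  have "norm ((\<integral>s. iexp (x * jump s) \<partial>step \<beta> h) - (\<integral>s. ?f s \<partial>step \<beta> h))
      = norm (\<integral>s. iexp (x * jump s) - ?f s \<partial>step \<beta> h)"
    by (subst Bochner_Integration.integral_diff[OF integrable_iexp_step[OF assms(1,2)] int_f]) simp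
  also have "\<dots> \<le> (\<integral>s. \<bar>x\<bar> ^ 3 / 6 * jump s ^ 3 \<partial>step \<beta> h)"
  proof (rule order.trans[OF integral_norm_bound integral_mono])
    show "integrable (step \<beta> h) (\<lambda>s. norm (iexp (x * jump s) - ?f s))"
      by (rule integrable_norm[OF Bochner_Integration.integrable_diff[OF integrable_iexp_step[OF assms(1,2)] int_f]])
    show "integrable (step \<beta> h) (\<lambda>s. \<bar>x\<bar> ^ 3 / 6 * jump s ^ 3)"
      by (intro integrable_mult_right ip) simp
    fix s
    have "(\<Sum>k\<le>2. (\<i> * complex_of_real (x * jump s)) ^ k / fact k) = ?f s"
      by (simp add: eval_nat_numeral power_mult_distrib algebra_simps)
    then have "norm (iexp (x * jump s) - ?f s) \<le> \<bar>x * jump s\<bar> ^ Suc 2 / fact (Suc 2)"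
      using iexp_approx1[of "x * jump s" 2] by (simp only:)
    also have "\<dots> = \<bar>x * jump s\<bar> ^ 3 / 6" by (simp add: eval_nat_numeral)
    also have "\<dots> = \<bar>x\<bar> ^ 3 / 6 * jump s ^ 3"
      by (simp add: abs_mult power_mult_distrib jump_nonneg)
    finally show "norm (iexp (x * jump s) - ?f s) \<le> \<bar>x\<bar> ^ 3 / 6 * jump s ^ 3" .
  qed
  also have "\<dots> = \<bar>x\<bar> ^ 3 / 6 * (h * T 3)"
    unfolding integral_mult_right_zero using E[of 3] by simp
  finally show ?thesis unfolding f .
qed

text \<open>The sign is reversed: the event that the walk reaches a level becomes an event \<open>{..w}\<close>, and the
  limit is symmetric.\<close>
definition walk_normalized :: "real \<Rightarrow> real \<Rightarrow> nat \<Rightarrow> real measure" where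
  "walk_normalized \<beta> t K =
     distr (walk \<beta> (t / real K) K) borel (\<lambda>y. (mu \<beta> * t - y) / sqrt (tau2 \<beta> * t))"

lemma char_walk_normalized:
  fixes \<theta> :: real
  assumes "\<beta> > -2" "t > 0" "K > 0"
  defines "x \<equiv> - \<theta> / sqrt (tau2 \<beta> * t)"
  shows "char (walk_normalized \<beta> t K) \<theta> =
    iexp (- (x * mu \<beta> * t)) * (\<integral>s. iexp (x * jump s) \<partial>step \<beta> (t / real K)) ^ K"
proof -
  have h: "t / real K > 0" using assms by simp
  have [measurable_cong]: "sets (walk \<beta> (t / real K) K) = sets borel" by (simp add: walk_def)
  have "char (walk_normalized \<beta> t K) \<theta>
      = (\<integral>y. iexp (\<theta> * ((mu \<beta> * t - y) / sqrt (tau2 \<beta> * t))) \<partial>walk \<beta> (t / real K) K)"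
    unfolding char_def walk_normalized_def by (rule integral_distr) measurable
  also have "(\<lambda>y. iexp (\<theta> * ((mu \<beta> * t - y) / sqrt (tau2 \<beta> * t))))
      = (\<lambda>y. iexp (- (x * mu \<beta> * t)) * iexp (x * y))"
    by (rule ext) (simp add: x_def exp_add[symmetric] diff_divide_distrib algebra_simps)
  also have "(\<integral>y. iexp (- (x * mu \<beta> * t)) * iexp (x * y) \<partial>walk \<beta> (t / real K) K)
      = iexp (- (x * mu \<beta> * t)) * (\<integral>y. iexp (x * y) \<partial>walk \<beta> (t / real K) K)"
    by (rule integral_mult_right_zero)
  also have "(\<integral>y. iexp (x * y) \<partial>walk \<beta> (t / real K) K)
      = (\<integral>s. iexp (x * jump s) \<partial>step \<beta> (t / real K)) ^ K"
    by (rule integral_walk_prod[OF assms(1) h _ integrable_iexp_step[OF assms(1) h]])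
       (auto simp: sum_distrib_left exp_sum)
  finally show ?thesis .
qed

text \<open>The summands bound, in this order, the third moment of the steps, the errors of the truncated first
  and second moments, and the passage from \<open>1 + z\<close> to \<open>exp z\<close> in the exponential form of one step.\<close>
definition char_error :: "real \<Rightarrow> real \<Rightarrow> real \<Rightarrow> real" where
  "char_error \<beta> \<theta> t =
     (let a = \<bar>\<theta>\<bar> / sqrt (tau2 \<beta> * t)
      in a ^ 3 * t * (\<integral>s. (- ln s) ^ 3 \<partial>dislocation \<beta>) / 6 + a + a\<^sup>2 / 2
         + exp (\<theta>\<^sup>2 / 2) * ((a * t * mu \<beta> + \<theta>\<^sup>2 / 2) / t)\<^sup>2)"

text \<open>The limit \<open>exp (- \<theta>\<^sup>2 / 2)\<close>, with the centring undone, is the \<open>K\<close>-th power of a number \<open>exp z\<close> with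
  \<open>z\<close> of order \<open>1 / K\<close>, so it is enough to compare one step with \<open>exp z\<close> up to an error small
  against \<open>1 / K\<close>. The mean of the walk grows like \<open>t\<close> and the scale like \<open>sqrt t\<close>; a
  truncated mean within \<open>1 / t\<close> of \<open>mu \<beta>\<close> thus shifts the centre by a negligible bounded amount, and \<open>K \<ge> t\<^sup>2\<close> makes \<open>K * (norm z)\<^sup>2\<close> small.\<close>
lemma char_walk_normalized_error:
  fixes \<theta> :: real
  assumes "\<beta> > -2" "t > 0" "K > 0" "real K \<ge> t\<^sup>2"
    and T1: "\<bar>trunc_integral \<beta> (t / real K) (\<lambda>s. (- ln s) ^ 1) - mu \<beta>\<bar> \<le> 1 / t"
    and T2: "\<bar>trunc_integral \<beta> (t / real K) (\<lambda>s. (- ln s) ^ 2) - tau2 \<beta>\<bar> \<le> 1 / t"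
  shows "norm (char (walk_normalized \<beta> t K) \<theta> - complex_of_real (exp (- (\<theta>\<^sup>2) / 2))) \<le> char_error \<beta> \<theta> t"
proof -
  define h where "h = t / real K"
  have h: "h > 0" "real K * h = t" using assms by (auto simp: h_def)
  define T where "T j = trunc_integral \<beta> h (\<lambda>s. (- ln s) ^ j)" for j
  define x where "x = - \<theta> / sqrt (tau2 \<beta> * t)"
  define a where "a = \<bar>\<theta>\<bar> / sqrt (tau2 \<beta> * t)"
  define m3 where "m3 = (\<integral>s. (- ln s) ^ 3 \<partial>dislocation \<beta>)"
  have tau: "tau2 \<beta> > 0" and mu: "mu \<beta> > 0" using tau2_pos mu_pos assms(1) by auto
  have a: "\<bar>x\<bar> = a" "x\<^sup>2 = a\<^sup>2" "a \<ge> 0" using tau assms by (auto simp: x_def a_def power_divide)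
  have xt: "x\<^sup>2 * t * tau2 \<beta> = \<theta>\<^sup>2" using tau assms by (simp add: x_def power_divide)
  define step_cf where "step_cf = (\<integral>s. iexp (x * jump s) \<partial>step \<beta> h)"
  define z where "z = \<i> * complex_of_real (x * (h * mu \<beta>)) - complex_of_real (\<theta>\<^sup>2 / (2 * real K))"
  interpret prob_space "step \<beta> h" by (rule prob_space_step[OF assms(1) h(1)])
  have chi: "norm step_cf \<le> 1"
    unfolding step_cf_def by (rule order.trans[OF integral_norm_bound]) (simp add: prob_space)
  have b: "norm (exp z) \<le> 1" by (simp add: z_def norm_exp_eq_Re)
  have Kz: "of_nat K * z = \<i> * complex_of_real (x * mu \<beta> * t) + complex_of_real (- (\<theta>\<^sup>2) / 2)"
    using assms(3) h(2)[symmetric] by (simp add: z_def field_simps)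
  have bK: "exp z ^ K = iexp (x * mu \<beta> * t) * complex_of_real (exp (- (\<theta>\<^sup>2) / 2))"
    unfolding exp_of_nat_mult[symmetric] Kz exp_add exp_of_real by simp
  have m3: "T 3 \<le> m3"
  proof -
    have m: "(\<lambda>s::real. (- ln s) ^ 3) \<in> borel_measurable borel" by measurable
    have i: "integrable (dislocation \<beta>) (\<lambda>s. (- ln s) ^ 3)"
      using integrable_mult_right[OF integrable_dislocation_ln_power[OF assms(1), of 3], of "-1"] by simp
    show ?thesis unfolding T_def trunc_integral_def m3_def
    proof (rule integral_mono_AE'[OF i])
      show "AE s in dislocation \<beta>. indicator (cutoff \<beta> h) s * (- ln s) ^ 3 \<le> (- ln s) ^ 3"
        using AE_dislocation by eventually_elim (auto simp: indicator_def)
      show "AE s in dislocation \<beta>. 0 \<le> (- ln s) ^ 3"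
        using AE_dislocation by eventually_elim auto
    qed
  qed
  have e1: "norm (step_cf - (1 + \<i> * complex_of_real (x * (h * T 1)) - complex_of_real (x\<^sup>2 / 2 * (h * T 2))))
      \<le> a ^ 3 / 6 * (h * m3)"
  proof (rule order.trans)
    show "norm (step_cf - (1 + \<i> * complex_of_real (x * (h * T 1)) - complex_of_real (x\<^sup>2 / 2 * (h * T 2))))
      \<le> \<bar>x\<bar> ^ 3 / 6 * (h * T 3)"
      unfolding step_cf_def T_def by (rule step_char_approx[OF assms(1) h(1)])
    show "\<bar>x\<bar> ^ 3 / 6 * (h * T 3) \<le> a ^ 3 / 6 * (h * m3)"
      unfolding a(1) using m3 h a(3) by (intro mult_left_mono) auto
  qed
  have e2: "norm (exp z - (1 + z)) \<le> exp (\<theta>\<^sup>2 / 2) * (norm z)\<^sup>2"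
  proof -
    have "\<bar>Re z\<bar> = \<theta>\<^sup>2 / (2 * real K)" by (simp add: z_def)
    also have "\<dots> \<le> \<theta>\<^sup>2 / 2" using assms(3) by (intro divide_left_mono) auto
    finally have "exp \<bar>Re z\<bar> * (norm z)\<^sup>2 \<le> exp (\<theta>\<^sup>2 / 2) * (norm z)\<^sup>2"
      by (intro mult_right_mono) auto
    then show ?thesis using Taylor_exp[of z 1] by (simp add: power2_eq_square)
  qed
  have nz: "real K * (norm z)\<^sup>2 \<le> ((a * t * mu \<beta> + \<theta>\<^sup>2 / 2) / t)\<^sup>2"
  proof -
    have "norm z \<le> norm (\<i> * complex_of_real (x * (h * mu \<beta>))) + norm (complex_of_real (\<theta>\<^sup>2 / (2 * real K)))"
      unfolding z_def by (rule norm_triangle_ineq4)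
    also have "\<dots> = a * (h * mu \<beta>) + \<theta>\<^sup>2 / (2 * real K)"
      using a h mu by (simp only: norm_mult norm_of_real norm_ii mult_1_left) (simp add: abs_mult)
    also have "\<dots> = (a * t * mu \<beta> + \<theta>\<^sup>2 / 2) / real K"
      using assms(3) by (simp add: h_def field_simps)
    finally have "(norm z)\<^sup>2 \<le> ((a * t * mu \<beta> + \<theta>\<^sup>2 / 2) / real K)\<^sup>2" by (intro power_mono) auto
    then have "real K * (norm z)\<^sup>2 \<le> real K * ((a * t * mu \<beta> + \<theta>\<^sup>2 / 2) / real K)\<^sup>2"
      by (intro mult_left_mono) auto
    also have "\<dots> = (a * t * mu \<beta> + \<theta>\<^sup>2 / 2)\<^sup>2 / real K" by (simp add: power2_eq_square)
    also have "\<dots> \<le> (a * t * mu \<beta> + \<theta>\<^sup>2 / 2)\<^sup>2 / t\<^sup>2"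
      using assms by (intro divide_left_mono) auto
    finally show ?thesis by (simp add: power_divide)
  qed
  have e3: "norm ((1 + \<i> * complex_of_real (x * (h * T 1)) - complex_of_real (x\<^sup>2 / 2 * (h * T 2))) - (1 + z))
      \<le> (a + a\<^sup>2 / 2) / real K"
  proof -
    have "(1 + \<i> * complex_of_real (x * (h * T 1)) - complex_of_real (x\<^sup>2 / 2 * (h * T 2))) - (1 + z)
        = \<i> * complex_of_real (x * h * (T 1 - mu \<beta>)) - complex_of_real (x\<^sup>2 / 2 * h * (T 2 - tau2 \<beta>))"
    proof -
      have "\<theta>\<^sup>2 / (2 * real K) = x\<^sup>2 / 2 * h * tau2 \<beta>"
        using assms(3) unfolding xt[symmetric] h_def by simp
      then have z': "z = \<i> * complex_of_real (x * (h * mu \<beta>)) - complex_of_real (x\<^sup>2 / 2 * h * tau2 \<beta>)"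
        unfolding z_def by (simp only:)
      show ?thesis unfolding z' by (simp add: field_simps)
    qed
    also have "norm \<dots> \<le> norm (\<i> * complex_of_real (x * h * (T 1 - mu \<beta>))) + norm (complex_of_real (x\<^sup>2 / 2 * h * (T 2 - tau2 \<beta>)))"
      by (rule norm_triangle_ineq4)
    also have "\<dots> = a * h * \<bar>T 1 - mu \<beta>\<bar> + a\<^sup>2 / 2 * h * \<bar>T 2 - tau2 \<beta>\<bar>"
      using a h by (simp only: norm_mult norm_ii norm_of_real mult_1_left) (simp add: abs_mult)
    also have "\<dots> \<le> a * h * (1 / t) + a\<^sup>2 / 2 * h * (1 / t)"
      using T1 T2 h a unfolding T_def h_def[symmetric] by (intro add_mono mult_left_mono) auto
    also have "\<dots> = (a + a\<^sup>2 / 2) / real K"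
      using assms(2) by (simp add: h_def add_divide_distrib)
    finally show ?thesis .
  qed
  have "norm (step_cf - exp z) \<le> a ^ 3 / 6 * (h * m3) + (a + a\<^sup>2 / 2) / real K + exp (\<theta>\<^sup>2 / 2) * (norm z)\<^sup>2"
    using norm_triangle_le_diff norm_diff_triangle_le[OF norm_diff_triangle_le[OF e1 e3], of "exp z"] e2
    by (simp add: norm_minus_commute)
  then have "real K * norm (step_cf - exp z)
      \<le> real K * (a ^ 3 / 6 * (h * m3) + (a + a\<^sup>2 / 2) / real K + exp (\<theta>\<^sup>2 / 2) * (norm z)\<^sup>2)"
    by (intro mult_left_mono) auto
  also have "\<dots> = a ^ 3 * t * m3 / 6 + a + a\<^sup>2 / 2 + exp (\<theta>\<^sup>2 / 2) * (real K * (norm z)\<^sup>2)"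
    using assms(3) h(2) by (simp add: h_def field_simps)
  also have "\<dots> \<le> a ^ 3 * t * m3 / 6 + a + a\<^sup>2 / 2 + exp (\<theta>\<^sup>2 / 2) * ((a * t * mu \<beta> + \<theta>\<^sup>2 / 2) / t)\<^sup>2"
    using nz by (intro add_left_mono mult_left_mono) auto
  also have "\<dots> = char_error \<beta> \<theta> t" by (simp add: char_error_def a_def m3_def Let_def)
  finally have main: "real K * norm (step_cf - exp z) \<le> char_error \<beta> \<theta> t" .
  have "char (walk_normalized \<beta> t K) \<theta> = iexp (- (x * mu \<beta> * t)) * step_cf ^ K"
    unfolding char_walk_normalized[OF assms(1-3)] step_cf_def x_def h_def ..
  moreover have "complex_of_real (exp (- (\<theta>\<^sup>2) / 2)) = iexp (- (x * mu \<beta> * t)) * exp z ^ K"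
    unfolding bK by (simp add: exp_add[symmetric] mult.assoc[symmetric])
  ultimately have "norm (char (walk_normalized \<beta> t K) \<theta> - complex_of_real (exp (- (\<theta>\<^sup>2) / 2)))
      = norm (iexp (- (x * mu \<beta> * t)) * (step_cf ^ K - exp z ^ K))"
    by (simp add: right_diff_distrib)
  also have "\<dots> = norm (step_cf ^ K - exp z ^ K)" by (simp only: norm_mult norm_exp_i_times)
  also have "\<dots> \<le> real K * norm (step_cf - exp z)" by (rule norm_power_diff[OF chi b])
  finally show ?thesis using main by linarith
qed

lemma char_error_tendsto:
  assumes "\<beta> > -2"
  shows "(char_error \<beta> \<theta> \<longlongrightarrow> 0) at_top"
proof -
  define c where "c = \<bar>\<theta>\<bar> / sqrt (tau2 \<beta>)"
  define m3 where "m3 = (\<integral>s. (- ln s) ^ 3 \<partial>dislocation \<beta>)"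
  have "((\<lambda>t. c ^ 3 * m3 / 6 * (1 / sqrt t) + c * (1 / sqrt t) + c\<^sup>2 / 2 * (1 / t)
        + exp (\<theta>\<^sup>2 / 2) * (c * mu \<beta> * (1 / sqrt t) + \<theta>\<^sup>2 / 2 * (1 / t))\<^sup>2) \<longlongrightarrow>
      c ^ 3 * m3 / 6 * 0 + c * 0 + c\<^sup>2 / 2 * 0
        + exp (\<theta>\<^sup>2 / 2) * (c * mu \<beta> * 0 + \<theta>\<^sup>2 / 2 * 0)\<^sup>2) (at_top :: real filter)"
  proof -
    have "((\<lambda>t::real. 1 / sqrt t) \<longlongrightarrow> 0) at_top" "((\<lambda>t::real. 1 / t) \<longlongrightarrow> 0) at_top" by real_asymp+
    then show ?thesis by (intro tendsto_intros)
  qed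
  moreover have "\<forall>\<^sub>F t in at_top. c ^ 3 * m3 / 6 * (1 / sqrt t) + c * (1 / sqrt t) + c\<^sup>2 / 2 * (1 / t)
        + exp (\<theta>\<^sup>2 / 2) * (c * mu \<beta> * (1 / sqrt t) + \<theta>\<^sup>2 / 2 * (1 / t))\<^sup>2 = char_error \<beta> \<theta> t"
    using eventually_gt_at_top[of 0]
  proof eventually_elim
    fix t :: real assume t: "t > 0"
    have a: "\<bar>\<theta>\<bar> / sqrt (tau2 \<beta> * t) = c * (1 / sqrt t)" by (simp add: c_def real_sqrt_mult)
    have s: "sqrt t * sqrt t = t" "sqrt t > 0" using t by auto
    have 3: "(c * (1 / sqrt t)) ^ 3 * t = c ^ 3 * (1 / sqrt t)"
      using s by (simp add: power3_eq_cube field_simps)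
    have 2: "(c * (1 / sqrt t))\<^sup>2 = c\<^sup>2 * (1 / t)"
      using t by (simp add: power_divide power_mult_distrib)
    have 1: "(c * (1 / sqrt t) * t * mu \<beta> + \<theta>\<^sup>2 / 2) / t = c * mu \<beta> * (1 / sqrt t) + \<theta>\<^sup>2 / 2 * (1 / t)"
      using t by (simp add: field_simps)
    show "c ^ 3 * m3 / 6 * (1 / sqrt t) + c * (1 / sqrt t) + c\<^sup>2 / 2 * (1 / t)
        + exp (\<theta>\<^sup>2 / 2) * (c * mu \<beta> * (1 / sqrt t) + \<theta>\<^sup>2 / 2 * (1 / t))\<^sup>2 = char_error \<beta> \<theta> t"
      unfolding char_error_def Let_def a 3 2 1 m3_def by simp
  qed
  ultimately show ?thesis by (auto elim: Lim_transform_eventually)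
qed

text \<open>For fixed \<open>t\<close> and \<open>N\<close> each of the requirements holds for all large \<open>K\<close>.\<close>
lemma ex_walk_length:
  assumes "\<beta> > -2" "t > 0" "e > 0"
  shows "\<exists>K>0. real K \<ge> t\<^sup>2
      \<and> \<bar>trunc_integral \<beta> (t / real K) (\<lambda>s. (- ln s) ^ 1) - mu \<beta>\<bar> \<le> 1 / t
      \<and> \<bar>trunc_integral \<beta> (t / real K) (\<lambda>s. (- ln s) ^ 2) - tau2 \<beta>\<bar> \<le> 1 / t
      \<and> \<bar>walk_cover_prob \<beta> (t / real K) K N - cover_prob \<beta> N t\<bar> \<le> e"
proof -
  have h0: "(\<lambda>K. t / real K) \<longlonglongrightarrow> 0" by real_asymp
  have i1: "integrable (dislocation \<beta>) (\<lambda>s. (- ln s) ^ 1)"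
    using integrable_dislocation_ln_power[OF assms(1), of 1] by simp
  have i2: "integrable (dislocation \<beta>) (\<lambda>s. (- ln s) ^ 2)"
    using integrable_dislocation_ln_power[OF assms(1), of 2] by simp
  have "(\<lambda>K. trunc_integral \<beta> (t / real K) (\<lambda>s. (- ln s) ^ 1)) \<longlonglongrightarrow> mu \<beta>"
    using trunc_integral_tendsto[OF assms(1) i1 _ h0] by (simp add: mu_eq[OF assms(1)])
  moreover have "(\<lambda>K. trunc_integral \<beta> (t / real K) (\<lambda>s. (- ln s) ^ 2)) \<longlonglongrightarrow> tau2 \<beta>"
    using trunc_integral_tendsto[OF assms(1) i2 _ h0] by (simp add: tau2_eq[OF assms(1)])
  moreover have near: "\<forall>\<^sub>F K in sequentially. \<bar>f K - l\<bar> \<le> d" if "f \<longlonglongrightarrow> l" "d > 0" for f :: "nat \<Rightarrow> real" and l d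
    using tendstoD[OF that] by eventually_elim (simp add: dist_real_def)
  moreover have "\<forall>\<^sub>F K in sequentially. real K \<ge> t\<^sup>2" by real_asymp
  ultimately have "\<forall>\<^sub>F K in sequentially. 0 < K \<and> real K \<ge> t\<^sup>2
      \<and> \<bar>trunc_integral \<beta> (t / real K) (\<lambda>s. (- ln s) ^ 1) - mu \<beta>\<bar> \<le> 1 / t
      \<and> \<bar>trunc_integral \<beta> (t / real K) (\<lambda>s. (- ln s) ^ 2) - tau2 \<beta>\<bar> \<le> 1 / t
      \<and> \<bar>walk_cover_prob \<beta> (t / real K) K N - cover_prob \<beta> N t\<bar> \<le> e"
    using walk_cover_prob_tendsto[OF assms(1,2), of N] assms(2,3)
    by (intro eventually_conj near) (auto intro: eventually_gt_at_top)
  then show ?thesis by (auto dest!: eventually_happens)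
qed

lemma weak_conv_walk_normalized:
  assumes "\<beta> > -2" "\<And>n. t n > 0" "filterlim t at_top sequentially"
    and "\<And>n. K n > 0" "\<And>n. real (K n) \<ge> (t n)\<^sup>2"
    and "\<And>n. \<bar>trunc_integral \<beta> (t n / real (K n)) (\<lambda>s. (- ln s) ^ 1) - mu \<beta>\<bar> \<le> 1 / t n"
    and "\<And>n. \<bar>trunc_integral \<beta> (t n / real (K n)) (\<lambda>s. (- ln s) ^ 2) - tau2 \<beta>\<bar> \<le> 1 / t n"
  shows "weak_conv_m (\<lambda>n. walk_normalized \<beta> (t n) (K n)) std_normal_distribution"
proof (rule levy_continuity)
  show "real_distribution (walk_normalized \<beta> (t n) (K n))" for n
  proof -
    have "t n / real (K n) > 0" using assms by simp
    then interpret real_distribution "walk \<beta> (t n / real (K n)) (K n)"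
      by (rule real_distribution_walk[OF assms(1)])
    show ?thesis unfolding walk_normalized_def by (rule real_distribution_distr) simp
  qed
  show "(\<lambda>n. char (walk_normalized \<beta> (t n) (K n)) \<theta>) \<longlonglongrightarrow> char std_normal_distribution \<theta>" for \<theta>
  proof -
    have "(\<lambda>n. char_error \<beta> \<theta> (t n)) \<longlonglongrightarrow> 0"
      by (rule filterlim_compose[OF char_error_tendsto[OF assms(1)] assms(3)])
    then have "(\<lambda>n. char (walk_normalized \<beta> (t n) (K n)) \<theta> - complex_of_real (exp (- (\<theta>\<^sup>2) / 2))) \<longlonglongrightarrow> 0"
      by (rule Lim_null_comparison[rotated]) (intro always_eventually allI char_walk_normalized_error assms)
    then show ?thesis unfolding char_std_normal_distribution by (rule LIM_zero_cancel)
  qed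
qed (rule real_dist_normal_dist)

section \<open>The normal limit of the covering probability\<close>

lemma cdf_walk_normalized:
  assumes "\<beta> > -2" "t > 0"
  shows "cdf (walk_normalized \<beta> t K) w
    = measure (walk \<beta> (t / real K) K) {y. mu \<beta> * t - w * sqrt (tau2 \<beta> * t) \<le> y}"
proof -
  have s: "sqrt (tau2 \<beta> * t) > 0" using tau2_pos assms by simp
  have "(\<lambda>y. (mu \<beta> * t - y) / sqrt (tau2 \<beta> * t)) -` {..w}
      = {y. mu \<beta> * t - w * sqrt (tau2 \<beta> * t) \<le> y}"
    using s by (auto simp: field_simps)
  then show ?thesis
    unfolding cdf_def2 walk_normalized_def by (subst measure_distr) (auto simp: walk_def)
qed

text \<open>The function \<open>(1 - exp (- y)) ^ N\<close> increases from \<open>0\<close> to \<open>1\<close>; it is compared with a multiple of the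
  indicator of \<open>{y0..}\<close> from below, and from above with that indicator plus its value at \<open>y0\<close>.\<close>
lemma
  fixes \<beta> t w :: real
  assumes "\<beta> > -2" "t > 0" "K > 0"
  defines "y0 \<equiv> mu \<beta> * t - w * sqrt (tau2 \<beta> * t)"
  assumes y0: "y0 \<ge> 0"
  shows walk_cover_prob_le: "walk_cover_prob \<beta> (t / real K) K N \<le> (1 - exp (- y0)) ^ N + cdf (walk_normalized \<beta> t K) w"
    and walk_cover_prob_ge: "(1 - exp (- y0)) ^ N * cdf (walk_normalized \<beta> t K) w \<le> walk_cover_prob \<beta> (t / real K) K N"
proof -
  have h: "t / real K > 0" using assms by simp
  interpret real_distribution "walk \<beta> (t / real K) K" by (rule real_distribution_walk[OF assms(1) h])
  let ?W = "walk \<beta> (t / real K) K" and ?g = "\<lambda>y. (1 - exp (- y)) ^ N"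
  have cdf: "cdf (walk_normalized \<beta> t K) w = prob {y0..}"
    unfolding cdf_walk_normalized[OF assms(1,2)] y0_def by (simp add: atLeast_def)
  have g: "0 \<le> ?g y" "?g y \<le> 1" if "0 \<le> y" for y :: real
    using that by (auto intro!: power_le_one)
  have mono: "?g y \<le> ?g y'" if "0 \<le> y" "y \<le> y'" for y y' :: real
    using that by (intro power_mono) auto
  have ig: "integrable ?W ?g"
  proof (rule integrable_const_bound[where B = 1])
    show "AE y in ?W. norm (?g y) \<le> 1"
      using AE_walk_nonneg
    proof eventually_elim
      fix y :: real assume "0 \<le> y"
      with g[OF this] show "norm (?g y) \<le> 1" by (simp only: real_norm_def abs_of_nonneg)
    qed
  qed simp
  have ii: "integrable ?W (indicator {y0..} :: real \<Rightarrow> real)"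
    by (intro integrable_real_indicator) (auto simp: emeasure_eq_measure)
  have "walk_cover_prob \<beta> (t / real K) K N \<le> (\<integral>y. ?g y0 + indicator {y0..} y \<partial>?W)"
    unfolding walk_cover_prob_def
  proof (rule integral_mono_AE[OF ig])
    show "AE y in ?W. ?g y \<le> ?g y0 + indicator {y0..} y"
      using AE_walk_nonneg
    proof eventually_elim
      fix y :: real assume y: "0 \<le> y"
      then show "?g y \<le> ?g y0 + indicator {y0..} y"
        using g[OF y] g[OF y0] mono[OF y, of y0] by (cases "y0 \<le> y") auto
    qed
  qed (use ii in auto)
  also have "\<dots> = ?g y0 + prob {y0..}" using ii prob_space by simp
  finally show "walk_cover_prob \<beta> (t / real K) K N \<le> ?g y0 + cdf (walk_normalized \<beta> t K) w" unfolding cdf .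
  have "?g y0 * prob {y0..} = (\<integral>y. ?g y0 * indicator {y0..} y \<partial>?W)" by simp
  also have "\<dots> \<le> walk_cover_prob \<beta> (t / real K) K N"
    unfolding walk_cover_prob_def
  proof (rule integral_mono_AE[OF _ ig])
    show "AE y in ?W. ?g y0 * indicator {y0..} y \<le> ?g y"
      using AE_walk_nonneg
    proof eventually_elim
      fix y :: real assume y: "0 \<le> y"
      then show "?g y0 * indicator {y0..} y \<le> ?g y"
        using g[OF y] mono[OF y0, of y] by (cases "y0 \<le> y") auto
    qed
  qed (use ii in auto)
  finally show "?g y0 * cdf (walk_normalized \<beta> t K) w \<le> walk_cover_prob \<beta> (t / real K) K N" unfolding cdf .
qed

text \<open>The maximum of \<open>n - 1\<close> independent standard exponential variables is \<open>ln n\<close> up to bounded fluctuations: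
  a level far above \<open>ln n\<close> is above the maximum, by Bernoulli's inequality.\<close>
lemma max_exp_above:
  assumes "filterlim (\<lambda>n. y n - ln (real n)) at_top sequentially"
  shows "(\<lambda>n. (1 - exp (- y n)) ^ (n - 1)) \<longlonglongrightarrow> 1"
proof (rule tendsto_sandwich)
  have ev: "\<forall>\<^sub>F n in sequentially. y n - ln (real n) \<ge> 0"
    using assms unfolding filterlim_at_top by blast
  show "\<forall>\<^sub>F n in sequentially. 1 - exp (- (y n - ln (real n))) \<le> (1 - exp (- y n)) ^ (n - 1)"
    using ev eventually_ge_at_top[of 1]
  proof eventually_elim
    fix n :: nat assume n: "y n - ln (real n) \<ge> 0" "n \<ge> 1"
    then have y: "y n \<ge> 0" using ln_ge_zero[of "real n"] by linarith
    have "1 - exp (- (y n - ln (real n))) = 1 + real n * (- exp (- y n))"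
      using n by (simp add: exp_diff exp_minus field_simps)
    also have "\<dots> \<le> 1 + real (n - 1) * (- exp (- y n))" using n by (simp add: mult_right_mono)
    also have "\<dots> \<le> (1 + - exp (- y n)) ^ (n - 1)" using y by (intro Bernoulli_inequality) auto
    finally show "1 - exp (- (y n - ln (real n))) \<le> (1 - exp (- y n)) ^ (n - 1)" by simp
  qed
  show "\<forall>\<^sub>F n in sequentially. (1 - exp (- y n)) ^ (n - 1) \<le> 1"
    using ev eventually_ge_at_top[of 1]
  proof eventually_elim
    fix n :: nat assume n: "y n - ln (real n) \<ge> 0" "n \<ge> 1"
    then have y: "y n \<ge> 0" using ln_ge_zero[of "real n"] by linarith
    then show "(1 - exp (- y n)) ^ (n - 1) \<le> 1" by (intro power_le_one) auto
  qed
  have "((\<lambda>d::real. 1 - exp (- d)) \<longlongrightarrow> 1) at_top" by real_asymp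
  from filterlim_compose[OF this assms]
  show "(\<lambda>n. 1 - exp (- (y n - ln (real n)))) \<longlonglongrightarrow> 1" .
qed simp

text \<open>The counterpart for levels far below \<open>ln n\<close>, by \<open>1 - x \<le> exp (- x)\<close>.\<close>
lemma max_exp_below:
  assumes "filterlim (\<lambda>n. y n - ln (real n)) at_bot sequentially"
    and y: "\<forall>\<^sub>F n in sequentially. y n \<ge> 0"
  shows "(\<lambda>n. (1 - exp (- y n)) ^ (n - 1)) \<longlonglongrightarrow> 0"
proof (rule tendsto_sandwich)
  show "\<forall>\<^sub>F n in sequentially. 0 \<le> (1 - exp (- y n)) ^ (n - 1)"
    using y by eventually_elim simp
  show "\<forall>\<^sub>F n in sequentially. (1 - exp (- y n)) ^ (n - 1) \<le> exp (- exp (- (y n - ln (real n))) / 2)"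
    using y eventually_ge_at_top[of 2]
  proof eventually_elim
    fix n :: nat assume n: "y n \<ge> 0" "n \<ge> 2"
    have "(1 - exp (- y n)) ^ (n - 1) \<le> exp (- exp (- y n)) ^ (n - 1)"
      using n exp_ge_add_one_self[of "- exp (- y n)"] by (intro power_mono) auto
    also have "\<dots> = exp (- (real (n - 1) * exp (- y n)))" by (simp add: exp_of_nat_mult[symmetric])
    also have "\<dots> \<le> exp (- (real n / 2 * exp (- y n)))"
      using n by (auto intro!: mult_right_mono)
    also have "real n / 2 * exp (- y n) = exp (- (y n - ln (real n))) / 2"
      using n by (simp add: exp_diff exp_minus field_simps)
    finally show "(1 - exp (- y n)) ^ (n - 1) \<le> exp (- exp (- (y n - ln (real n))) / 2)" by simp
  qed
  have "((\<lambda>d::real. exp (- exp (- d) / 2)) \<longlongrightarrow> 0) at_bot" by real_asymp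
  from filterlim_compose[OF this assms(1)]
  show "(\<lambda>n. exp (- exp (- (y n - ln (real n))) / 2)) \<longlonglongrightarrow> 0" .
qed simp

text \<open>Here \<open>L = ln n\<close>, \<open>T L\<close> is the time of the normalised height \<open>x\<close>, and \<open>m * T L - w * sqrt (v * T L)\<close>
  is the level that the subordinator exceeds at this time with asymptotic probability \<open>\<Phi> w\<close>. It lies
  on the side of \<open>L\<close> that is determined by the sign of \<open>x - w\<close>, at a distance of order \<open>sqrt L\<close>: the
  factor \<open>1 / m ^ 3\<close> in the variance of the height is what makes the two fluctuations match.\<close>
lemma
  fixes m v x w :: real
  assumes m: "m > 0" and v: "v > 0"
  defines "T \<equiv> \<lambda>L. L / m + x * sqrt (v / m ^ 3 * L)"
  shows threshold_scaled: "((\<lambda>L. (m * T L - w * sqrt (v * T L) - L) / sqrt L) \<longlongrightarrow> sqrt (v / m) * (x - w)) at_top"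
    and time_scaled: "((\<lambda>L. T L / L) \<longlongrightarrow> 1 / m) at_top"
    and time_at_top: "filterlim T at_top at_top"
proof -
  define c where "c = sqrt (v / m ^ 3)"
  have TL: "\<forall>\<^sub>F L in at_top. T L / L = 1 / m + x * c * (1 / sqrt L)"
    using eventually_gt_at_top[of 0]
  proof eventually_elim
    fix L :: real assume L: "L > 0"
    then have "sqrt L * sqrt L = L" by simp
    then have "sqrt L / L = 1 / sqrt L" using L by (simp add: field_simps)
    then show "T L / L = 1 / m + x * c * (1 / sqrt L)"
      using L unfolding T_def real_sqrt_mult c_def[symmetric] by (simp add: field_simps)
  qed
  have s0: "((\<lambda>L::real. 1 / sqrt L) \<longlongrightarrow> 0) at_top" by real_asymp
  have "((\<lambda>L. 1 / m + x * c * (1 / sqrt L)) \<longlongrightarrow> 1 / m + x * c * 0) at_top"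
    by (intro tendsto_intros s0)
  then show lim: "((\<lambda>L. T L / L) \<longlongrightarrow> 1 / m) at_top"
    by (rule Lim_transform_eventually[where f = "\<lambda>L. 1 / m + x * c * (1 / sqrt L)", THEN tendsto_eq_rhs])
      (use TL in \<open>auto elim!: eventually_mono\<close>)
  have "filterlim (\<lambda>L. T L / L * L) at_top at_top"
    by (rule filterlim_tendsto_pos_mult_at_top[OF lim _ filterlim_ident]) (use m in simp)
  then show "filterlim T at_top at_top"
    by (rule filterlim_mono_eventually[OF _ order.refl order.refl
          eventually_mono[OF eventually_gt_at_top[of 0]]]) simp
  have mc: "m * c = sqrt (v / m)"
  proof -
    have "sqrt (v / m) = sqrt (m\<^sup>2 * (v / m ^ 3))" using m by (simp add: power2_eq_square power3_eq_cube)
    also have "\<dots> = sqrt (m\<^sup>2) * c" unfolding c_def by (rule real_sqrt_mult)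
    also have "sqrt (m\<^sup>2) = m" using m by simp
    finally show ?thesis by simp
  qed
  have "((\<lambda>L. m * x * c - w * sqrt (v * (T L / L))) \<longlongrightarrow> m * x * c - w * sqrt (v * (1 / m))) at_top"
    by (intro tendsto_intros lim)
  also have "m * x * c - w * sqrt (v * (1 / m)) = sqrt (v / m) * (x - w)"
    using mc by (simp add: algebra_simps)
  finally show "((\<lambda>L. (m * T L - w * sqrt (v * T L) - L) / sqrt L) \<longlongrightarrow> sqrt (v / m) * (x - w)) at_top"
  proof (rule Lim_transform_eventually)
    show "\<forall>\<^sub>F L in at_top. m * x * c - w * sqrt (v * (T L / L)) = (m * T L - w * sqrt (v * T L) - L) / sqrt L"
      using eventually_gt_at_top[of 0]
    proof eventually_elim
      fix L :: real assume L: "L > 0"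
      have "sqrt (v * (T L / L)) = sqrt (v * T L) / sqrt L" by (simp add: real_sqrt_divide[symmetric])
      moreover have "m * T L - L = m * x * c * sqrt L"
        using m unfolding T_def real_sqrt_mult c_def[symmetric] by (simp add: algebra_simps)
      ultimately show "m * x * c - w * sqrt (v * (T L / L)) = (m * T L - w * sqrt (v * T L) - L) / sqrt L"
        using L by (simp add: field_simps)
    qed
  qed
qed

lemma
  fixes m v x w :: real
  assumes m: "m > 0" and v: "v > 0"
  defines "T \<equiv> \<lambda>L. L / m + x * sqrt (v / m ^ 3 * L)"
  defines "y \<equiv> \<lambda>L. m * T L - w * sqrt (v * T L)"
  shows threshold_above: "w < x \<Longrightarrow> filterlim (\<lambda>L. y L - L) at_top at_top"
    and threshold_below: "w > x \<Longrightarrow> filterlim (\<lambda>L. y L - L) at_bot at_top"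
    and threshold_nonneg: "\<forall>\<^sub>F L in at_top. y L \<ge> 0"
proof -
  have lim: "((\<lambda>L. (y L - L) / sqrt L) \<longlongrightarrow> sqrt (v / m) * (x - w)) at_top"
    unfolding y_def T_def by (rule threshold_scaled[OF m v])
  have sq: "sqrt (v / m) > 0" using m v by simp
  have s: "filterlim (sqrt :: real \<Rightarrow> real) at_top at_top" by (rule sqrt_at_top)
  have eq: "\<forall>\<^sub>F L in at_top. (y L - L) / sqrt L * sqrt L = y L - L"
    by (rule eventually_mono[OF eventually_gt_at_top[of 0]]) auto
  show "filterlim (\<lambda>L. y L - L) at_top at_top" if "w < x"
  proof -
    have "filterlim (\<lambda>L. (y L - L) / sqrt L * sqrt L) at_top at_top"
      by (rule filterlim_tendsto_pos_mult_at_top[OF lim _ s]) (use that sq in simp)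
    then show ?thesis by (rule filterlim_mono_eventually[OF _ order.refl order.refl eq])
  qed
  show "filterlim (\<lambda>L. y L - L) at_bot at_top" if "w > x"
  proof -
    have "filterlim (\<lambda>L. (y L - L) / sqrt L * sqrt L) at_bot at_top"
      by (rule filterlim_tendsto_neg_mult_at_bot[OF lim _ s]) (use that sq in \<open>simp add: mult_pos_neg\<close>)
    then show ?thesis by (rule filterlim_mono_eventually[OF _ order.refl order.refl eq])
  qed
  have s0: "((\<lambda>L::real. 1 / sqrt L) \<longlongrightarrow> 0) at_top" by real_asymp
  have "((\<lambda>L. 1 + (y L - L) / sqrt L * (1 / sqrt L)) \<longlongrightarrow> 1 + sqrt (v / m) * (x - w) * 0) at_top"
    by (intro tendsto_intros lim s0)
  then have "\<forall>\<^sub>F L in at_top. 0 < 1 + (y L - L) / sqrt L * (1 / sqrt L)"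
    by (intro order_tendstoD(1)) auto
  with eventually_gt_at_top[of 0] show "\<forall>\<^sub>F L in at_top. y L \<ge> 0"
  proof eventually_elim
    fix L :: real assume L: "0 < L" "0 < 1 + (y L - L) / sqrt L * (1 / sqrt L)"
    have "1 + (y L - L) / sqrt L * (1 / sqrt L) = y L / L" using L(1) by (simp add: field_simps)
    then show "y L \<ge> 0" using L by (simp add: zero_less_divide_iff)
  qed
qed

lemma isCont_std_normal_cdf: "isCont (cdf std_normal_distribution) x"
proof -
  interpret real_distribution std_normal_distribution by (rule real_dist_normal_dist)
  have "emeasure std_normal_distribution {x} = (\<integral>\<^sup>+y. ennreal (std_normal_density y) * indicator {x} y \<partial>lborel)"
    by (rule emeasure_density) auto
  also have "\<dots> = 0" by (subst nn_integral_0_iff_AE) (auto intro: AE_mp[OF AE_lborel_singleton[of x]])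
  finally show ?thesis unfolding isCont_cdf by (simp add: measure_def)
qed

text \<open>For \<open>w < x\<close> the level that the walk exceeds with probability about \<open>\<Phi> w\<close> is far above \<open>ln n\<close>, so a
  walk above it covers all \<open>n - 1\<close> points and the covering probability is at least about \<open>\<Phi> w\<close>.
  Likewise it is at most about \<open>\<Phi> w\<close> for \<open>w > x\<close>. Continuity of \<open>\<Phi>\<close> closes the gap.\<close>
lemma cover_prob_tendsto_normal:
  assumes "\<beta> > -2"
  shows "(\<lambda>n. cover_prob \<beta> (n - 1) (ln (real n) / mu \<beta> + x * sqrt (tau2 \<beta> / mu \<beta> ^ 3 * ln (real n))))
    \<longlonglongrightarrow> cdf std_normal_distribution x"
proof -
  note m = mu_pos[OF assms] and v = tau2_pos[OF assms]
  let ?\<Phi> = "cdf std_normal_distribution"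
  define T where "T L = L / mu \<beta> + x * sqrt (tau2 \<beta> / mu \<beta> ^ 3 * L)" for L
  \<comment> \<open>The maximum makes \<open>t n\<close> positive for the finitely many small \<open>n\<close>, where \<open>T (ln n)\<close> may be negative.\<close>
  define t where "t n = max 1 (T (ln (real n)))" for n
  have ln: "filterlim (\<lambda>n. ln (real n)) at_top sequentially" by real_asymp
  have Tinf: "filterlim (\<lambda>n. T (ln (real n))) at_top sequentially"
    using filterlim_compose[OF time_at_top[OF m v, of x] ln] unfolding T_def .
  then have tT: "\<forall>\<^sub>F n in sequentially. T (ln (real n)) = t n"
    unfolding filterlim_at_top t_def by (auto elim!: eventually_mono dest!: spec[of _ 1])
  have tinf: "filterlim t at_top sequentially"
    by (rule filterlim_mono_eventually[OF Tinf order.refl order.refl tT])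
  have tpos: "t n > 0" for n by (simp add: t_def)
  have "\<exists>K>0. real K \<ge> (t n)\<^sup>2
      \<and> \<bar>trunc_integral \<beta> (t n / real K) (\<lambda>s. (- ln s) ^ 1) - mu \<beta>\<bar> \<le> 1 / t n
      \<and> \<bar>trunc_integral \<beta> (t n / real K) (\<lambda>s. (- ln s) ^ 2) - tau2 \<beta>\<bar> \<le> 1 / t n
      \<and> \<bar>walk_cover_prob \<beta> (t n / real K) K (n - 1) - cover_prob \<beta> (n - 1) (t n)\<bar> \<le> 1 / real (Suc n)" for n
    by (rule ex_walk_length[OF assms tpos]) simp
  then obtain K where K: "\<And>n. K n > 0" "\<And>n. real (K n) \<ge> (t n)\<^sup>2"
      "\<And>n. \<bar>trunc_integral \<beta> (t n / real (K n)) (\<lambda>s. (- ln s) ^ 1) - mu \<beta>\<bar> \<le> 1 / t n"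
      "\<And>n. \<bar>trunc_integral \<beta> (t n / real (K n)) (\<lambda>s. (- ln s) ^ 2) - tau2 \<beta>\<bar> \<le> 1 / t n"
      "\<And>n. \<bar>walk_cover_prob \<beta> (t n / real (K n)) (K n) (n - 1) - cover_prob \<beta> (n - 1) (t n)\<bar> \<le> 1 / real (Suc n)"
    by metis
  have wc: "(\<lambda>n. cdf (walk_normalized \<beta> (t n) (K n)) w) \<longlonglongrightarrow> ?\<Phi> w" for w
    using weak_conv_walk_normalized[OF assms tpos tinf K(1-4)] isCont_std_normal_cdf
    by (simp add: weak_conv_m_def weak_conv_def)
  define y where "y w n = mu \<beta> * t n - w * sqrt (tau2 \<beta> * t n)" for w n
  have yT: "\<forall>\<^sub>F n in sequentially. mu \<beta> * T (ln (real n)) - w * sqrt (tau2 \<beta> * T (ln (real n))) = y w n" for w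
    using tT by eventually_elim (simp add: y_def)
  have ynn: "\<forall>\<^sub>F n in sequentially. y w n \<ge> 0" for w
    using yT[of w] eventually_compose_filterlim[OF threshold_nonneg[OF m v, of x w] ln]
    by eventually_elim (simp add: T_def)
  have yb: "filterlim (\<lambda>n. y w n - ln (real n)) at_bot sequentially" if "w > x" for w
    by (rule filterlim_mono_eventually[OF filterlim_compose[OF threshold_below[OF m v that] ln] order.refl order.refl])
       (use yT[of w] in \<open>eventually_elim, simp add: T_def\<close>)
  have ya: "filterlim (\<lambda>n. y w n - ln (real n)) at_top sequentially" if "w < x" for w
    by (rule filterlim_mono_eventually[OF filterlim_compose[OF threshold_above[OF m v that] ln] order.refl order.refl])
       (use yT[of w] in \<open>eventually_elim, simp add: T_def\<close>)
  have e0: "(\<lambda>n. 1 / real (Suc n)) \<longlonglongrightarrow> 0" by real_asymp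
  have "(\<lambda>n. cover_prob \<beta> (n - 1) (t n)) \<longlonglongrightarrow> ?\<Phi> x"
  proof (rule order_tendstoI)
    fix a assume "a < ?\<Phi> x"
    then have "\<forall>\<^sub>F w in at_left x. a < ?\<Phi> w \<and> w < x"
      using isCont_std_normal_cdf[of x]
      by (intro eventually_conj order_tendstoD(1)[of ?\<Phi> "?\<Phi> x"])
         (auto simp: isCont_def eventually_at_filter intro: filterlim_at_split[THEN iffD1, THEN conjunct1])
    then obtain w where w: "a < ?\<Phi> w" "w < x" by (auto dest!: eventually_happens)
    have "(\<lambda>n. (1 - exp (- y w n)) ^ (n - 1) * cdf (walk_normalized \<beta> (t n) (K n)) w - 1 / real (Suc n))
        \<longlonglongrightarrow> 1 * ?\<Phi> w - 0"
      by (intro tendsto_intros e0 wc max_exp_above ya w)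
    then have "\<forall>\<^sub>F n in sequentially. a < (1 - exp (- y w n)) ^ (n - 1)
        * cdf (walk_normalized \<beta> (t n) (K n)) w - 1 / real (Suc n)"
      using w by (intro order_tendstoD(1)) auto
    then show "\<forall>\<^sub>F n in sequentially. a < cover_prob \<beta> (n - 1) (t n)"
      using ynn[of w]
    proof eventually_elim
      fix n assume "a < (1 - exp (- y w n)) ^ (n - 1) * cdf (walk_normalized \<beta> (t n) (K n)) w - 1 / real (Suc n)"
        "0 \<le> y w n"
      then show "a < cover_prob \<beta> (n - 1) (t n)"
        using walk_cover_prob_ge[OF assms tpos K(1), where w = w and N = "n - 1", of n n] K(5)[of n] unfolding y_def by linarith
    qed
  next
    fix a assume "?\<Phi> x < a"
    then have "\<forall>\<^sub>F w in at_right x. ?\<Phi> w < a \<and> w > x"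
      using isCont_std_normal_cdf[of x]
      by (intro eventually_conj order_tendstoD(2)[of ?\<Phi> "?\<Phi> x"])
         (auto simp: isCont_def eventually_at_filter intro: filterlim_at_split[THEN iffD1, THEN conjunct2])
    then obtain w where w: "?\<Phi> w < a" "w > x" by (auto dest!: eventually_happens)
    have "(\<lambda>n. (1 - exp (- y w n)) ^ (n - 1) + cdf (walk_normalized \<beta> (t n) (K n)) w + 1 / real (Suc n))
        \<longlonglongrightarrow> 0 + ?\<Phi> w + 0"
      by (intro tendsto_intros e0 wc max_exp_below yb w ynn)
    then have "\<forall>\<^sub>F n in sequentially. (1 - exp (- y w n)) ^ (n - 1)
        + cdf (walk_normalized \<beta> (t n) (K n)) w + 1 / real (Suc n) < a"
      using w by (intro order_tendstoD(2)) auto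
    then show "\<forall>\<^sub>F n in sequentially. cover_prob \<beta> (n - 1) (t n) < a"
      using ynn[of w]
    proof eventually_elim
      fix n assume "(1 - exp (- y w n)) ^ (n - 1) + cdf (walk_normalized \<beta> (t n) (K n)) w + 1 / real (Suc n) < a"
        "0 \<le> y w n"
      then show "cover_prob \<beta> (n - 1) (t n) < a"
        using walk_cover_prob_le[OF assms tpos K(1), where w = w and N = "n - 1", of n n] K(5)[of n] unfolding y_def by linarith
    qed
  qed
  then show ?thesis
    by (rule Lim_transform_eventually) (use tT in \<open>eventually_elim, simp add: T_def\<close>)
qed

section \<open>Mean height and conclusion\<close>

context prob_space
begin

text \<open>Up to \<open>b\<close> the variable is at most \<open>c\<close>, plus \<open>b - c\<close> if it exceeds \<open>c\<close>; the excess over \<open>b\<close> is at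
  most the number of the levels \<open>b + k\<close> that it exceeds.\<close>
lemma expectation_le_geometric_tail:
  fixes Z :: "'a \<Rightarrow> real"
  assumes [measurable]: "Z \<in> borel_measurable M" and Z: "AE \<omega> in M. 0 \<le> Z \<omega>"
    and c: "0 \<le> c" "c \<le> b" and r: "0 \<le> r" "r < 1"
    and tail: "\<And>k::nat. prob {\<omega> \<in> space M. b + real k < Z \<omega>} \<le> r ^ k"
  shows "integrable M Z"
    and "expectation Z \<le> c + (b - c) * prob {\<omega> \<in> space M. c < Z \<omega>} + 1 / (1 - r)"
proof -
  let ?G = "\<lambda>a. {\<omega> \<in> space M. a < Z \<omega>}"
  have pt: "ennreal (Z \<omega>) \<le> ennreal c + ennreal (b - c) * indicator (?G c) \<omega>
      + (\<Sum>k. indicator (?G (b + real k)) \<omega>)" if \<omega>: "\<omega> \<in> space M" for \<omega>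
  proof -
    let ?S = "\<Sum>k. indicator (?G (b + real k)) \<omega> :: ennreal"
    consider "Z \<omega> \<le> c" | "c < Z \<omega>" "Z \<omega> \<le> b" | "c < Z \<omega>" "b < Z \<omega>" by linarith
    then show ?thesis
    proof cases
      case 1
      then show ?thesis by (intro add_increasing2 ennreal_leI) auto
    next
      case 2
      then have "ennreal (Z \<omega>) \<le> ennreal c + ennreal (b - c)"
        using c by (simp add: ennreal_plus[symmetric] ennreal_leI del: ennreal_plus)
      also have "\<dots> = ennreal c + ennreal (b - c) * indicator (?G c) \<omega>" using 2 \<omega> by simp
      also have "\<dots> \<le> \<dots> + ?S" by simp
      finally show ?thesis .
    next
      case 3
      define m where "m = nat \<lceil>Z \<omega> - b\<rceil>"
      have m: "Z \<omega> - b \<le> real m" unfolding m_def by (rule real_nat_ceiling_ge)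
      have ind: "indicator (?G (b + real k)) \<omega> = (1 :: ennreal)" if "k < m" for k
      proof -
        have "real k < Z \<omega> - b" using that unfolding m_def by linarith
        then show ?thesis using \<omega> by simp
      qed
      have "ennreal (Z \<omega> - b) \<le> ennreal (real m)" using m by (rule ennreal_leI)
      also have "\<dots> = (\<Sum>k<m. indicator (?G (b + real k)) \<omega>)"
        using ind by (simp add: ennreal_of_nat_eq_real_of_nat)
      also have "\<dots> \<le> ?S" by (rule sum_le_suminf) auto
      finally have S: "ennreal (Z \<omega> - b) \<le> ?S" .
      have "ennreal (Z \<omega>) = ennreal c + ennreal (b - c) + ennreal (Z \<omega> - b)"
        using 3 c by (simp add: ennreal_plus[symmetric] del: ennreal_plus)
      also have "\<dots> \<le> ennreal c + ennreal (b - c) * indicator (?G c) \<omega> + ?S"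
        using S 3 \<omega> by (intro add_mono) auto
      finally show ?thesis .
    qed
  qed
  have "(\<integral>\<^sup>+\<omega>. ennreal (Z \<omega>) \<partial>M) \<le> (\<integral>\<^sup>+\<omega>. ennreal c + ennreal (b - c) * indicator (?G c) \<omega>
      + (\<Sum>k. indicator (?G (b + real k)) \<omega>) \<partial>M)"
    by (intro nn_integral_mono pt)
  also have "\<dots> = ennreal c + ennreal (b - c) * emeasure M (?G c) + (\<Sum>k. emeasure M (?G (b + real k)))"
    by (simp add: nn_integral_add nn_integral_cmult nn_integral_suminf emeasure_space_1)
  also have "(\<Sum>k. emeasure M (?G (b + real k))) \<le> (\<Sum>k. ennreal (r ^ k))"
    by (intro suminf_le summableI) (auto simp: emeasure_eq_measure intro!: ennreal_leI tail)
  also have "(\<Sum>k. ennreal (r ^ k)) = ennreal (1 / (1 - r))"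
    using geometric_sums[of r] r by (intro suminf_ennreal_eq) auto
  also have "ennreal c + ennreal (b - c) * emeasure M (?G c) + ennreal (1 / (1 - r))
      = ennreal (c + (b - c) * prob (?G c) + 1 / (1 - r))"
    using c r by (simp add: emeasure_eq_measure ennreal_mult[symmetric] ennreal_plus[symmetric] del: ennreal_plus)
  finally have le: "(\<integral>\<^sup>+\<omega>. ennreal (Z \<omega>) \<partial>M) \<le> ennreal (c + (b - c) * prob (?G c) + 1 / (1 - r))"
    by (simp add: add_left_mono)
  show int: "integrable M Z"
    by (rule integrableI_nonneg) (use Z le in \<open>auto intro: le_less_trans\<close>)
  have "ennreal (expectation Z) \<le> ennreal (c + (b - c) * prob (?G c) + 1 / (1 - r))"
    using le nn_integral_eq_integral[OF int Z] by simp
  then show "expectation Z \<le> c + (b - c) * prob (?G c) + 1 / (1 - r)"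
    using c r by (subst (asm) ennreal_le_iff) auto
qed

lemma expectation_ge_tail:
  fixes Z :: "'a \<Rightarrow> real"
  assumes "integrable M Z" "AE \<omega> in M. 0 \<le> Z \<omega>"
  shows "c * prob {\<omega> \<in> space M. c < Z \<omega>} \<le> expectation Z"
proof -
  have [measurable]: "Z \<in> borel_measurable M" using assms by simp
  let ?G = "{\<omega> \<in> space M. c < Z \<omega>}"
  have "c * prob ?G = expectation (\<lambda>\<omega>. c * indicator ?G \<omega>)" by simp
  also have "\<dots> \<le> expectation Z"
  proof (rule integral_mono_AE)
    show "AE \<omega> in M. c * indicator ?G \<omega> \<le> Z \<omega>"
      using assms(2) by eventually_elim (auto simp: indicator_def)
  qed (auto intro!: assms(1) integrable_real_indicator simp: emeasure_eq_measure)
  finally show ?thesis .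
qed

end

context labelled_beta_splitting_chain
begin

lemma prob_D_gt:
  assumes "t \<ge> 0"
  shows "prob {\<omega> \<in> space M. t < D \<omega>} = 1 - cover_prob \<beta> (n - 1) t"
proof -
  have "{\<omega> \<in> space M. t < D \<omega>} = space M - {\<omega> \<in> space M. D \<omega> \<le> t}" by auto
  moreover have "{\<omega> \<in> space M. D \<omega> \<le> t} \<in> events" by measurable
  ultimately show ?thesis using prob_D_le[OF assms] by (simp add: prob_compl)
qed

lemma cover_prob_mono:
  assumes "0 \<le> t" "t \<le> s"
  shows "cover_prob \<beta> (n - 1) t \<le> cover_prob \<beta> (n - 1) s"
proof -
  have "0 \<le> s" using assms by simp
  then show ?thesis
    unfolding prob_D_le[OF assms(1), symmetric] prob_D_le[OF \<open>0 \<le> s\<close>, symmetric]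
    using assms by (intro finite_measure_mono) auto
qed

text \<open>From \<open>b \<ge> ln n / phi \<beta> 1\<close> on, the union bound \<open>n * exp (- phi \<beta> 1 * t)\<close> is at most one and decays
  geometrically; the contribution of this range to the mean is bounded uniformly in \<open>n\<close>.\<close>
lemma expectation_D_bounds:
  assumes c: "0 \<le> c" "c \<le> b" "ln (real n) / phi \<beta> 1 \<le> b"
  shows "c * (1 - cover_prob \<beta> (n - 1) c) \<le> expectation D"
    and "expectation D \<le> c + (b - c) * (1 - cover_prob \<beta> (n - 1) c) + 1 / (1 - exp (- phi \<beta> 1))"
proof -
  have p: "phi \<beta> 1 > 0" using phi_pos[OF beta_gt, of 1] by simp
  let ?r = "exp (- phi \<beta> 1)"
  have r: "0 \<le> ?r" "?r < 1" using p by auto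
  have tail: "prob {\<omega> \<in> space M. b + real k < D \<omega>} \<le> ?r ^ k" for k
  proof -
    have b: "0 \<le> b + real k" using c by simp
    have "prob {\<omega> \<in> space M. b + real k < D \<omega>} \<le> real (n - 1) * exp (- phi \<beta> 1 * (b + real k))"
      unfolding prob_D_gt[OF b] by (rule cover_prob_tail[OF b])
    also have "\<dots> \<le> real n * exp (- phi \<beta> 1 * (b + real k))" by (intro mult_right_mono) auto
    also have "\<dots> = exp (ln (real n) - phi \<beta> 1 * b) * ?r ^ k"
      using n_ge_1 by (simp add: exp_diff exp_minus exp_add distrib_left exp_of_nat_mult[symmetric] field_simps)
    also have "\<dots> \<le> 1 * ?r ^ k"
      using c(3) p by (intro mult_right_mono) (auto simp: field_simps)
    finally show ?thesis by simp
  qed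
  note E = expectation_le_geometric_tail[OF D_measurable D_nonneg_AE c(1,2) r tail]
  show "c * (1 - cover_prob \<beta> (n - 1) c) \<le> expectation D"
    using expectation_ge_tail[OF E(1) D_nonneg_AE, of c] prob_D_gt[OF c(1)] by simp
  show "expectation D \<le> c + (b - c) * (1 - cover_prob \<beta> (n - 1) c) + 1 / (1 - exp (- phi \<beta> 1))"
    using E(2) prob_D_gt[OF c(1)] by simp
qed

end

theorem corollary2p2:
  fixes \<beta> :: real
    and M :: "nat \<Rightarrow> 'w measure"
    and X :: "nat \<Rightarrow> real \<Rightarrow> 'w \<Rightarrow> nat set set"
    and U :: "nat \<Rightarrow> 'w \<Rightarrow> nat"
  assumes "\<beta> > -2"
    and "\<And>n. n \<ge> 1 \<Longrightarrow> beta_splitting_chain \<beta> n (M n) (X n)"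
    and "\<And>n. n \<ge> 1 \<Longrightarrow> uniform_label n (M n) (X n) (U n)"
  defines "D \<equiv> \<lambda>n. leaf_height (X n) (U n)"
  shows "(\<lambda>n. integral\<^sup>L (M n) (D n)) \<sim>[sequentially] (\<lambda>n. ln (real n) / mu \<beta>)
    \<and> weak_conv_m
        (\<lambda>n. distr (M n) borel
           (\<lambda>\<omega>. (D n \<omega> - ln (real n) / mu \<beta>) / sqrt (tau2 \<beta> / mu \<beta> ^ 3 * ln (real n))))
        std_normal_distribution"
proof
  note m = mu_pos[OF assms(1)] and v = tau2_pos[OF assms(1)]
  have loc: "labelled_beta_splitting_chain \<beta> n (M n) (X n) (U n)" if "n \<ge> 1" for n
    by standard (use assms(1-3) that in auto)
  let ?F = "\<lambda>n t. cover_prob \<beta> (n - 1) t" and ?\<Phi> = "cdf std_normal_distribution"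
  define T where "T x L = L / mu \<beta> + x * sqrt (tau2 \<beta> / mu \<beta> ^ 3 * L)" for x L
  have ln: "filterlim (\<lambda>n. ln (real n)) at_top sequentially" by real_asymp
  have clt: "(\<lambda>n. ?F n (T x (ln (real n)))) \<longlonglongrightarrow> ?\<Phi> x" for x
    unfolding T_def by (rule cover_prob_tendsto_normal[OF assms(1)])
  have Tnn: "\<forall>\<^sub>F n in sequentially. T x (ln (real n)) \<ge> 0" for x
    using filterlim_compose[OF time_at_top[OF m v, of x] ln] unfolding filterlim_at_top T_def by blast
  interpret N: real_distribution std_normal_distribution by (rule real_dist_normal_dist)

  show "weak_conv_m
        (\<lambda>n. distr (M n) borel
           (\<lambda>\<omega>. (D n \<omega> - ln (real n) / mu \<beta>) / sqrt (tau2 \<beta> / mu \<beta> ^ 3 * ln (real n))))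
        std_normal_distribution"
    unfolding weak_conv_m_def weak_conv_def
  proof (intro allI impI)
    fix x
    show "(\<lambda>n. cdf (distr (M n) borel
           (\<lambda>\<omega>. (D n \<omega> - ln (real n) / mu \<beta>) / sqrt (tau2 \<beta> / mu \<beta> ^ 3 * ln (real n)))) x) \<longlonglongrightarrow> ?\<Phi> x"
    proof (rule Lim_transform_eventually[OF clt])
      show "\<forall>\<^sub>F n in sequentially. ?F n (T x (ln (real n))) = cdf (distr (M n) borel
           (\<lambda>\<omega>. (D n \<omega> - ln (real n) / mu \<beta>) / sqrt (tau2 \<beta> / mu \<beta> ^ 3 * ln (real n)))) x"
        using Tnn[of x] eventually_ge_at_top[of 2]
      proof eventually_elim
        fix n :: nat assume n: "T x (ln (real n)) \<ge> 0" "n \<ge> 2"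
        then interpret labelled_beta_splitting_chain \<beta> n "M n" "X n" "U n" by (intro loc) simp
        define s where "s = sqrt (tau2 \<beta> / mu \<beta> ^ 3 * ln (real n))"
        have s: "s > 0" unfolding s_def using m v n(2) by simp
        have [measurable]: "D n \<in> borel_measurable (M n)" unfolding assms(4) by (rule D_measurable)
        have "cdf (distr (M n) borel (\<lambda>\<omega>. (D n \<omega> - ln (real n) / mu \<beta>) / s)) x
            = prob ((\<lambda>\<omega>. (D n \<omega> - ln (real n) / mu \<beta>) / s) -` {..x} \<inter> space (M n))"
          unfolding cdf_def2 by (rule measure_distr) auto
        also have "(\<lambda>\<omega>. (D n \<omega> - ln (real n) / mu \<beta>) / s) -` {..x} \<inter> space (M n)
            = {\<omega> \<in> space (M n). D n \<omega> \<le> T x (ln (real n))}"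
          using s unfolding T_def s_def[symmetric] by (auto simp: pos_divide_le_eq algebra_simps)
        also have "prob \<dots> = ?F n (T x (ln (real n)))"
          unfolding assms(4) by (rule prob_D_le[OF n(1)])
        finally show "?F n (T x (ln (real n))) = cdf (distr (M n) borel
           (\<lambda>\<omega>. (D n \<omega> - ln (real n) / mu \<beta>) / sqrt (tau2 \<beta> / mu \<beta> ^ 3 * ln (real n)))) x"
          unfolding s_def by simp
      qed
    qed
  qed

  have TL: "(\<lambda>n. T x (ln (real n)) / ln (real n)) \<longlonglongrightarrow> 1 / mu \<beta>" for x
    unfolding T_def by (rule filterlim_compose[OF time_scaled[OF m v] ln])
  have lnpos: "\<forall>\<^sub>F n in sequentially. ln (real n) > 0" by real_asymp
  \<comment> \<open>Law of large numbers: \<open>D\<^sub>n / ln n\<close> concentrates at \<open>1 / mu \<beta>\<close>, since \<open>c * ln n\<close> leaves every normal window.\<close>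
  have above: "\<forall>\<^sub>F n in sequentially. 1 - ?F n (c * ln (real n)) < e" if "c > 1 / mu \<beta>" "e > 0" for c e
  proof -
    have "\<forall>\<^sub>F x in at_top. 1 - e < ?\<Phi> x"
      using that N.cdf_lim_at_top_prob by (intro order_tendstoD(1)) auto
    then obtain x where x: "1 - e < ?\<Phi> x" by (auto dest!: eventually_happens)
    show ?thesis
      using order_tendstoD(2)[OF TL that(1), of x] order_tendstoD(1)[OF clt x] Tnn[of x] lnpos
        eventually_ge_at_top[of 1]
    proof eventually_elim
      fix n :: nat
      assume n: "T x (ln (real n)) / ln (real n) < c" "1 - e < ?F n (T x (ln (real n)))"
        "0 \<le> T x (ln (real n))" "0 < ln (real n)" "1 \<le> n"
      interpret labelled_beta_splitting_chain \<beta> n "M n" "X n" "U n" by (rule loc[OF n(5)])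
      have "T x (ln (real n)) \<le> c * ln (real n)" using n(1,4) by (simp add: pos_divide_less_eq)
      from cover_prob_mono[OF n(3) this] n(2) show "1 - ?F n (c * ln (real n)) < e" by linarith
    qed
  qed
  have below: "\<forall>\<^sub>F n in sequentially. ?F n (c * ln (real n)) < e"
    if "0 \<le> c" "c < 1 / mu \<beta>" "e > 0" for c e
  proof -
    have "\<forall>\<^sub>F x in at_bot. ?\<Phi> x < e"
      using that N.cdf_lim_at_bot by (intro order_tendstoD(2)) auto
    then obtain x where x: "?\<Phi> x < e" by (auto dest!: eventually_happens)
    show ?thesis
      using order_tendstoD(1)[OF TL that(2), of x] order_tendstoD(2)[OF clt x] lnpos
        eventually_ge_at_top[of 1]
    proof eventually_elim
      fix n :: nat
      assume n: "c < T x (ln (real n)) / ln (real n)" "?F n (T x (ln (real n))) < e"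
        "0 < ln (real n)" "1 \<le> n"
      interpret labelled_beta_splitting_chain \<beta> n "M n" "X n" "U n" by (rule loc[OF n(4)])
      have "c * ln (real n) \<le> T x (ln (real n))" using n(1,3) by (simp add: pos_less_divide_eq)
      from cover_prob_mono[OF _ this] that(1) n(2,3) show "?F n (c * ln (real n)) < e"
        by (smt (verit) mult_nonneg_nonneg)
    qed
  qed
  show "(\<lambda>n. integral\<^sup>L (M n) (D n)) \<sim>[sequentially] (\<lambda>n. ln (real n) / mu \<beta>)"
  proof (intro asymp_equivI' order_tendstoI)
    fix a :: real assume "a < 1"
    define d where "d = (max a 0 + 1) / 2"
    have d: "0 < d" "d < 1" "a < d" using \<open>a < 1\<close> by (auto simp: d_def)
    have e: "0 < 1 - max a 0 / d" using d by (auto simp: field_simps)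
    have c: "0 \<le> d / mu \<beta>" "d / mu \<beta> < 1 / mu \<beta>" using d m by (auto simp: divide_strict_right_mono)
    show "\<forall>\<^sub>F n in sequentially. a < integral\<^sup>L (M n) (D n) / (ln (real n) / mu \<beta>)"
      using below[OF c e] lnpos eventually_ge_at_top[of 1]
    proof eventually_elim
      fix n :: nat
      let ?L = "ln (real n)"
      assume n: "?F n (d / mu \<beta> * ?L) < 1 - max a 0 / d" "0 < ?L" "1 \<le> n"
      interpret labelled_beta_splitting_chain \<beta> n "M n" "X n" "U n" by (rule loc[OF n(3)])
      let ?c = "d / mu \<beta> * ?L"
      have c0: "0 < ?c" using d m n by simp
      have "a \<le> d * (max a 0 / d)" using d by simp
      also have "\<dots> < d * (1 - ?F n ?c)" using d n(1) by (intro mult_strict_left_mono) auto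
      also have "\<dots> = ?c * (1 - ?F n ?c) / (?L / mu \<beta>)" using m n(2) by simp
      also have "\<dots> \<le> integral\<^sup>L (M n) (D n) / (?L / mu \<beta>)"
        using expectation_D_bounds(1)[of ?c "max ?c (?L / phi \<beta> 1)"] c0 m n(2)
        unfolding assms(4) by (intro divide_right_mono) auto
      finally show "a < integral\<^sup>L (M n) (D n) / (?L / mu \<beta>)" .
    qed
  next
    fix a :: real assume "1 < a"
    define d where "d = (a + 1) / 2"
    have d: "1 < d" "d < a" using \<open>1 < a\<close> by (auto simp: d_def)
    define B where "B = max (d / mu \<beta>) (1 / phi \<beta> 1)"
    define R where "R = 1 / (1 - exp (- phi \<beta> 1))"
    \<comment> \<open>Allows the middle range, of length at most \<open>B * ln n\<close>, half of the gap between \<open>d\<close> and \<open>a\<close>.\<close>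
    define e where "e = (a - d) / (2 * (mu \<beta> * B + 1))"
    have B: "B > 0" "d / mu \<beta> \<le> B" "1 / phi \<beta> 1 \<le> B"
      using d m by (auto simp: B_def less_max_iff_disj)
    have e: "e > 0" using d m B by (auto simp: e_def intro!: divide_pos_pos add_pos_pos)
    have c: "d / mu \<beta> > 1 / mu \<beta>" using d m by (auto simp: divide_strict_right_mono)
    have "(\<lambda>n. R * mu \<beta> * inverse (ln (real n))) \<longlonglongrightarrow> R * mu \<beta> * 0"
      by (intro tendsto_intros tendsto_inverse_0_at_top ln)
    then have small: "\<forall>\<^sub>F n in sequentially. R * mu \<beta> * inverse (ln (real n)) < (a - d) / 2"
      using d by (intro order_tendstoD(2)) auto
    show "\<forall>\<^sub>F n in sequentially. integral\<^sup>L (M n) (D n) / (ln (real n) / mu \<beta>) < a"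
      using above[OF c e] small lnpos eventually_ge_at_top[of 1]
    proof eventually_elim
      fix n :: nat
      let ?L = "ln (real n)"
      assume n: "1 - ?F n (d / mu \<beta> * ?L) < e" "R * mu \<beta> * inverse ?L < (a - d) / 2" "0 < ?L" "1 \<le> n"
      interpret labelled_beta_splitting_chain \<beta> n "M n" "X n" "U n" by (rule loc[OF n(4)])
      let ?c = "d / mu \<beta> * ?L" and ?b = "B * ?L"
      have cb: "0 \<le> ?c" "?c \<le> ?b" "?L / phi \<beta> 1 \<le> ?b"
        using d m n(3) mult_right_mono[OF B(3), of ?L] mult_right_mono[OF B(2), of ?L] by auto
      have "integral\<^sup>L (M n) (D n) \<le> ?c + (?b - ?c) * (1 - ?F n ?c) + R"
        unfolding assms(4) R_def by (rule expectation_D_bounds(2)[OF cb])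
      also have "\<dots> \<le> ?c + ?b * e + R"
      proof -
        have "(?b - ?c) * (1 - ?F n ?c) \<le> (?b - ?c) * e" using cb n(1) by (intro mult_left_mono) auto
        also have "\<dots> \<le> ?b * e" using cb e by (intro mult_right_mono) auto
        finally show ?thesis by simp
      qed
      finally have "integral\<^sup>L (M n) (D n) / (?L / mu \<beta>) \<le> (?c + ?b * e + R) / (?L / mu \<beta>)"
        using m n(3) by (intro divide_right_mono) auto
      also have "\<dots> = d + mu \<beta> * B * e + R * mu \<beta> * inverse ?L"
        using m n(3) by (simp add: field_simps)
      also have "\<dots> < d + (a - d) / 2 + (a - d) / 2"
      proof -
        have "mu \<beta> * B * e \<le> (mu \<beta> * B + 1) * e" using e by (intro mult_right_mono) auto
        also have "\<dots> = (a - d) / 2"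
        proof -
          have "E * (y / (2 * E)) = y / 2" if "E > 0" for E y :: real using that by simp
          moreover have "mu \<beta> * B + 1 > 0" using m B by (auto intro!: add_pos_pos)
          ultimately show ?thesis unfolding e_def by blast
        qed
        finally show ?thesis using n(2) by linarith
      qed
      finally show "integral\<^sup>L (M n) (D n) / (?L / mu \<beta>) < a" by simp
    qed
  qed
qed

end
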